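(* Let $1\le p<\infty$, $N\in\mathbb N$, $D$ a countable dense subset of $\mathbb R^N$, and $E\subset\mathfrak{LC}_p$ with $L^p_{loc}$-bounded $l$-bounds. (i) If $(f_n)_{n\in\mathbb N}$ in $E$ converges to $f$ in $(\mathfrak{LC}_p,\mathcal T_D)$ and $(x_{0,n})_{n\in\mathbb N}$ in $\mathbb R^N$ converges to $x_0\in\mathbb R^N$, then $x(\cdot,f_n,x_{0,n})\to x(\cdot,f,x_0)$ as $n\to\infty$, uniformly in any $[T_1,T_2]\subset I_{f,x_0}$. (ii) Let $C\subset E$ be compact with respect to $\mathcal T_D$ and, for any interval $I=[q_1,q_2]$ with $q_1,q_2\in\mathbb Q$ and any $j\in\mathbb N$, define $$C^I_j=\Big\{x:J\to B_j\ \Big|\ J\subset I\text{ an interval, and }\exists f\in C\text{ such that }x(t)=x(s)+\int_s^t f(u,x(u))\,du\ \ \forall s,t\in J\Big\}.$$ Then each of the sets $C^I_j$ is equicontinuous and, denoting by $\theta^I_j$ its modulus of continuity, the set $\Theta=\{\theta^I_j\mid I=[q_1,q_2],\ q_1,q_2\in\mathbb Q,\ j\in\mathbb N\}$ is a suitable set of moduli of continuity. (iii) Let $C\subset E$ be compact with respect to $\mathcal T_D$ and $\Theta$ be the suitable set of moduli of continuity given by (ii). If $(f_n)_{n\in\mathbb N}$ in $C$ converges to $f$ in $(\mathfrak{LC}_p,\mathcal T_D)$, $(F_n)_{n\in\mathbb N}$ in $\Theta\mathfrak C_p(\mathbb R^{N\times N})$ converges to $F$ in $(\Theta\mathfrak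 C_p(\mathbb R^{N\times N}),\mathcal T_\Theta)$, $(h_n)_{n\in\mathbb N}$ in $\Theta\mathfrak C_p$ converges to $h$ in $(\Theta\mathfrak C_p,\mathcal T_\Theta)$, and $(x_{0,n},y_{0,n})_{n\in\mathbb N}$ in $\mathbb R^N\times\mathbb R^N$ converges to $(x_0,y_0)\in\mathbb R^N\times\mathbb R^N$, then $$\big(x(\cdot,f_n,x_{0,n}),y(\cdot,f_n,F_n,h_n,x_{0,n},y_{0,n})\big)\to\big(x(\cdot,f,x_0),y(\cdot,f,F,h,x_0,y_0)\big)$$ as $n\to\infty$, uniformly in any $[T_1,T_2]\subset I_{f,x_0}$.
   Context: $B_j$ is the closed ball of radius $j$ centered at $0$ in $\mathbb R^N$. $L^p_{loc}$ is the set of functions $\mathbb R\to\mathbb R$ belonging to $L^p(I)$ for every compact interval $I$. For a space of functions $f:\mathbb R\times\mathbb R^N\to\mathbb R^M$, the symbol $(\mathbb R^M)$ is omitted when $M=N$. Consider for $f:\mathbb R\times\mathbb R^N\to\mathbb R^M$: (C1) $f$ is Borel measurable; (C2) for every compact $K\subset\mathbb R^N$ there is $m^K\in L^p_{loc}$ with $|f(t,x)|\le m^K(t)$ for a.e. $t$ and all $x\in K$. $\mathfrak{LC}_p(\mathbb R^M)$ is the set of $f$ satisfying (C1), (C2) and: for every compact $K\subset\mathbb R^N$ there is $l^K\in L^p_{loc}$ with $|f(t,x)-f(t,y)|\le l^K(t)|x-y|$ for a.e. $t$ and all $x,y\in K$. $\mathcal T_D$ is the topology on $\mathfrak{LC}_p$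 generated by the seminorms $\big[\int_I|f(t,x)|^pdt\big]^{1/p}$, $x\in D$, $I$ a compact interval with rational endpoints. The optimal $l$-bound of $f\in\mathfrak{LC}_p$ on $B_j$ is $l^j_f(t)=\sup_{x,y\in B_j,\,x\ne y}|f(t,x)-f(t,y)|/|x-y|$. $E\subset\mathfrak{LC}_p$ has $L^p_{loc}$-bounded $l$-bounds if $\sup_{f\in E}\int_{-r}^r(l^j_f(t))^p\,dt<\infty$ for every $j\in\mathbb N$ and $r>0$. A suitable set of moduli of continuity is a countable set of non-decreasing continuous functions $\Theta=\{\theta^I_j:[0,\infty)\to[0,\infty)\mid j\in\mathbb N,\ I=[q_1,q_2],\ q_1,q_2\in\mathbb Q\}$ with $\theta^I_j(0)=0$ and $\theta^{I_1}_{j_1}\le\theta^{I_2}_{j_2}$ whenever $I_1\subseteq I_2$, $j_1\le j_2$; $\mathcal K^I_j$ is the set of continuous functions $I\to B_j$ admitting $\theta^I_j$ as modulus of continuity. The modulus of continuity of the family $C^I_j$ is $\theta^I_j(s)=\sup\{|x(t)-x(t')|\;:\;x\in C^I_j,\ t,t'\text{ in the domain of }x,\ |t-t'|\le s\}$. $\Theta\mathfrak C_p(\mathbb R^M)$ is the set of $f$ satisfying (C1), (C2) and, for each $j$ and each $I$ with rational endpoints: if $x_n\to x$ uniformly with $x_n,x\in\mathcal K^I_j$, then $\int_I|f(t,x_n(t))-f(t,x(t))|^pdt\to0$. Functions in the same space differing only on a Lebesgue-null subset of $\mathbb R^{1+N}$ are identified. $\mathcal T_\Theta$ is the topology on $\Theta\mathfrak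 C_p(\mathbb R^M)$ generated by the seminorms $\sup_{x(\cdot)\in\mathcal K^I_j}\big[\int_I|f(t,x(t))|^pdt\big]^{1/p}$, $I$ with rational endpoints, $j\in\mathbb N$. For $f\in\mathfrak{LC}_p$, $x_0\in\mathbb R^N$, $x(\cdot,f,x_0)$ is the unique (Carathéodory, i.e. integral) solution of $\dot x=f(t,x)$, $x(0)=x_0$, and $I_{f,x_0}$ is its maximal interval of definition. $y(\cdot,f,F,h,x_0,y_0)$ is the solution on $I_{f,x_0}$ of $\dot y=F(t,x(t,f,x_0))\,y+h(t,x(t,f,x_0))$, $y(0)=y_0$. The uniform convergence statements include that, for $n$ large, the solutions for $f_n$ are defined on $[T_1,T_2]$. *)

theory Defs
  imports "HOL-Analysis.Analysis"
begin

text \<open>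
  Conventions. A function \<open>f : \<real> \<times> \<real>\<^sup>N \<rightarrow> \<real>\<^sup>M\<close> is a curried \<open>f t x\<close>; the target is a Euclidean
  space, which covers both \<open>\<real>\<^sup>M\<close> and \<open>\<real>\<^sup>N\<^sup>\<times>\<^sup>N\<close> (type \<open>real^'n^'n\<close>, whose norm is the Euclidean norm of
  the entries). Indices \<open>j \<in> \<nat>\<close> start at \<open>1\<close>. A function defined on a set is a total function whose
  values off that set are never used.

  Functions that agree almost everywhere are not identified; the spaces below consist of
  representatives. The topologies are generated by seminorms that do not distinguish
  representatives, so convergence and compactness are those of the quotient.

  Integrands are Borel up to a null set, hence integrals and ``almost everywhere'' refer to \<open>lborel\<close>, except in
  \<open>Lp_loc\<close>, whose members are allowed to be merely Lebesgue measurable.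
\<close>

definition Lp_loc :: "real \<Rightarrow> (real \<Rightarrow> real) set" where
  "Lp_loc p = {g. \<forall>a b. set_borel_measurable lebesgue {a..b} g \<and>
                        set_integrable lebesgue {a..b} (\<lambda>t. \<bar>g t\<bar> powr p)}"

definition C1 :: "(real \<Rightarrow> real^'n \<Rightarrow> 'b::euclidean_space) \<Rightarrow> bool" where
  "C1 f \<longleftrightarrow> (\<lambda>(t, x). f t x) \<in> borel_measurable borel"

definition C2 :: "real \<Rightarrow> (real \<Rightarrow> real^'n \<Rightarrow> 'b::euclidean_space) \<Rightarrow> bool" where
  "C2 p f \<longleftrightarrow> (\<forall>K. compact K \<longrightarrow>
     (\<exists>m \<in> Lp_loc p. AE t in lborel. \<forall>x\<in>K. norm (f t x) \<le> m t))"

definition LC :: "real \<Rightarrow> (real \<Rightarrow> real^'n \<Rightarrow> 'b::euclidean_space) set" where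
  "LC p = {f. C1 f \<and> C2 p f \<and>
     (\<forall>K. compact K \<longrightarrow>
       (\<exists>l \<in> Lp_loc p. AE t in lborel. \<forall>x\<in>K. \<forall>y\<in>K. norm (f t x - f t y) \<le> l t * norm (x - y)))}"

definition rat_intervals :: "real set set" where
  "rat_intervals = {I. \<exists>q1\<in>\<rat>. \<exists>q2\<in>\<rat>. q1 \<le> q2 \<and> I = {q1..q2}}"

definition seminorm_topology ::
  "(real \<Rightarrow> real^'n \<Rightarrow> 'b::euclidean_space) set \<Rightarrow>
   ((real \<Rightarrow> real^'n \<Rightarrow> 'b) \<Rightarrow> real) set \<Rightarrow> (real \<Rightarrow> real^'n \<Rightarrow> 'b) topology" where
  "seminorm_topology X P = topology_generated_by
     {{g \<in> X. q (\<lambda>t x. g t x - f t x) < e} | f q e. f \<in> X \<and> q \<in> P \<and> 0 < e}"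

definition topology_D ::
  "real \<Rightarrow> (real^'n) set \<Rightarrow> (real \<Rightarrow> real^'n \<Rightarrow> 'b::euclidean_space) topology" where
  "topology_D p D = seminorm_topology (LC p)
     {(\<lambda>f. (LINT t:I|lborel. norm (f t x) powr p) powr (1 / p)) | x I. x \<in> D \<and> I \<in> rat_intervals}"

text \<open>
  For \<open>f \<in> LC p\<close> and almost every \<open>t\<close> the set of difference quotients is bounded, so the real
  supremum is the true one outside a null set.
\<close>

definition opt_l_bound ::
  "(real \<Rightarrow> real^'n \<Rightarrow> 'b::euclidean_space) \<Rightarrow> nat \<Rightarrow> real \<Rightarrow> real" where
  "opt_l_bound f j t =
     (SUP (x, y) \<in> {(x, y). x \<in> cball 0 (real j) \<and> y \<in> cball 0 (real j) \<and> x \<noteq> y}.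
        norm (f t x - f t y) / norm (x - y))"

definition Lp_loc_bounded_l_bounds ::
  "real \<Rightarrow> (real \<Rightarrow> real^'n \<Rightarrow> 'b::euclidean_space) set \<Rightarrow> bool" where
  "Lp_loc_bounded_l_bounds p E \<longleftrightarrow> (\<forall>j\<ge>1. \<forall>r>0.
     (SUP f\<in>E. \<integral>\<^sup>+ t\<in>{-r..r}. ennreal (opt_l_bound f j t powr p) \<partial>lborel) < \<infinity>)"

text \<open>
  A set \<open>\<Theta>\<close> is given as its family of members, \<open>\<theta> j I\<close> for \<open>j \<ge> 1\<close> and \<open>I \<in> rat_intervals\<close>; it is
  automatically countable. Only the values on \<open>[0,\<infinity>)\<close> matter.
\<close>

definition suitable_moduli :: "(nat \<Rightarrow> real set \<Rightarrow> real \<Rightarrow> real) \<Rightarrow> bool" where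
  "suitable_moduli \<theta> \<longleftrightarrow>
     (\<forall>j\<ge>1. \<forall>I\<in>rat_intervals.
        (\<forall>s\<ge>0. 0 \<le> \<theta> j I s) \<and> mono_on {0..} (\<theta> j I) \<and> continuous_on {0..} (\<theta> j I) \<and>
        \<theta> j I 0 = 0) \<and>
     (\<forall>j1\<ge>1. \<forall>j2\<ge>1. \<forall>I1\<in>rat_intervals. \<forall>I2\<in>rat_intervals.
        I1 \<subseteq> I2 \<and> j1 \<le> j2 \<longrightarrow> (\<forall>s\<ge>0. \<theta> j1 I1 s \<le> \<theta> j2 I2 s))"

definition curves ::
  "(nat \<Rightarrow> real set \<Rightarrow> real \<Rightarrow> real) \<Rightarrow> nat \<Rightarrow> real set \<Rightarrow> (real \<Rightarrow> real^'n) set" where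
  "curves \<theta> j I = {x. continuous_on I x \<and> x ` I \<subseteq> cball 0 (real j) \<and>
     (\<forall>t\<in>I. \<forall>s\<in>I. norm (x t - x s) \<le> \<theta> j I \<bar>t - s\<bar>)}"

definition Theta_C ::
  "real \<Rightarrow> (nat \<Rightarrow> real set \<Rightarrow> real \<Rightarrow> real) \<Rightarrow> (real \<Rightarrow> real^'n \<Rightarrow> 'b::euclidean_space) set" where
  "Theta_C p \<theta> = {f. C1 f \<and> C2 p f \<and>
     (\<forall>j\<ge>1. \<forall>I\<in>rat_intervals. \<forall>xs x.
        (\<forall>n. xs n \<in> curves \<theta> j I) \<and> x \<in> curves \<theta> j I \<and> uniform_limit I xs x sequentially \<longrightarrow>
        (\<lambda>n::nat. LINT t:I|lborel. norm (f t (xs n t) - f t (x t)) powr p) \<longlonglongrightarrow> 0)}"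

definition topology_Theta ::
  "real \<Rightarrow> (nat \<Rightarrow> real set \<Rightarrow> real \<Rightarrow> real) \<Rightarrow>
   (real \<Rightarrow> real^'n \<Rightarrow> 'b::euclidean_space) topology" where
  "topology_Theta p \<theta> = seminorm_topology (Theta_C p \<theta>)
     {(\<lambda>f. SUP x \<in> curves \<theta> j I. (LINT t:I|lborel. norm (f t (x t)) powr p) powr (1 / p))
       | j I. 1 \<le> j \<and> I \<in> rat_intervals}"

text \<open>
  Integrability is required explicitly because the library integral of a non-integrable function
  is \<open>0\<close>. The interval integral is oriented, so \<open>s > t\<close> is covered.
\<close>

definition integral_solution ::
  "(real \<Rightarrow> real^'n \<Rightarrow> real^'n) \<Rightarrow> real set \<Rightarrow> (real \<Rightarrow> real^'n) \<Rightarrow> bool" where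
  "integral_solution g J z \<longleftrightarrow> (\<forall>s\<in>J. \<forall>t\<in>J.
     interval_lebesgue_integrable lborel (ereal s) (ereal t) (\<lambda>u. g u (z u)) \<and>
     z t = z s + (LBINT u=ereal s..ereal t. g u (z u)))"

definition ivp_solution ::
  "(real \<Rightarrow> real^'n \<Rightarrow> real^'n) \<Rightarrow> real^'n \<Rightarrow> real set \<Rightarrow> (real \<Rightarrow> real^'n) \<Rightarrow> bool" where
  "ivp_solution g z0 J z \<longleftrightarrow> is_interval J \<and> 0 \<in> J \<and> z 0 = z0 \<and> integral_solution g J z"

text \<open>
  Solutions of the same problem agree on common intervals for \<open>f \<in> LC p\<close>, so this union is itself an
  interval of definition, and no solution extends beyond it.
\<close>

definition max_interval :: "(real \<Rightarrow> real^'n \<Rightarrow> real^'n) \<Rightarrow> real^'n \<Rightarrow> real set" where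
  "max_interval f x0 = \<Union> {J. \<exists>z. ivp_solution f x0 J z}"

definition x_sol :: "(real \<Rightarrow> real^'n \<Rightarrow> real^'n) \<Rightarrow> real^'n \<Rightarrow> real \<Rightarrow> real^'n" where
  "x_sol f x0 t = (THE v. \<exists>z. ivp_solution f x0 (max_interval f x0) z \<and> z t = v)"

definition y_sol ::
  "(real \<Rightarrow> real^'n \<Rightarrow> real^'n) \<Rightarrow> (real \<Rightarrow> real^'n \<Rightarrow> real^'n^'n) \<Rightarrow> (real \<Rightarrow> real^'n \<Rightarrow> real^'n) \<Rightarrow>
   real^'n \<Rightarrow> real^'n \<Rightarrow> real \<Rightarrow> real^'n" where
  "y_sol f F h x0 y0 t = (THE v. \<exists>z.
     ivp_solution (\<lambda>s w. F s (x_sol f x0 s) *v w + h s (x_sol f x0 s)) y0 (max_interval f x0) z \<and>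
     z t = v)"

text \<open>A function \<open>x : J \<rightarrow> B\<^sub>j\<close> is recorded together with its domain, as the pair \<open>(J, x)\<close>.\<close>

definition solution_family ::
  "(real \<Rightarrow> real^'n \<Rightarrow> real^'n) set \<Rightarrow> nat \<Rightarrow> real set \<Rightarrow> (real set \<times> (real \<Rightarrow> real^'n)) set" where
  "solution_family C j I = {(J, x). is_interval J \<and> J \<subseteq> I \<and> x ` J \<subseteq> cball 0 (real j) \<and>
     (\<exists>f\<in>C. integral_solution f J x)}"

text \<open>
  The functions of the family have different domains inside a compact interval, and equicontinuity
  is the uniform one.
\<close>

definition equicontinuous_family :: "(real set \<times> (real \<Rightarrow> real^'n)) set \<Rightarrow> bool" where
  "equicontinuous_family S \<longleftrightarrow> (\<forall>\<epsilon>>0. \<exists>\<delta>>0. \<forall>(J, x)\<in>S. \<forall>t\<in>J. \<forall>t'\<in>J.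
     \<bar>t - t'\<bar> < \<delta> \<longrightarrow> norm (x t - x t') < \<epsilon>)"

text \<open>
  The set below always contains \<open>0\<close> (take \<open>t = t'\<close>) unless \<open>C\<close> is empty; inserting \<open>0\<close> only fixes
  the convention \<open>sup \<emptyset> = 0\<close> in that case.
\<close>

definition moduli ::
  "(real \<Rightarrow> real^'n \<Rightarrow> real^'n) set \<Rightarrow> nat \<Rightarrow> real set \<Rightarrow> real \<Rightarrow> real" where
  "moduli C j I s = Sup (insert 0
     {norm (x t - x t') | J x t t'.
        (J, x) \<in> solution_family C j I \<and> t \<in> J \<and> t' \<in> J \<and> \<bar>t - t'\<bar> \<le> s})"

end

theory Submission
  imports Defs
begin

text \<open>
  The seminorms of \<open>\<T>\<^sub>D\<close> see a function only at the points of \<open>D\<close>, whereas the differential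
  equation sees it along curves. The bridge is a pointwise estimate. Let \<open>h t\<close> be Lipschitz on the
  ball of radius \<open>j + 1\<close> with constant \<open>\<lambda> t\<close>, and let \<open>F\<close> be a finite set of points of \<open>D\<close> in that
  ball which comes within \<open>\<eta>\<close> of every point of the ball of radius \<open>j\<close>. Then
  \<open>norm (h t y) \<le> (\<Sum>d\<in>F. norm (h t d)) + \<eta> * \<lambda> t\<close> for all \<open>y\<close> in the smaller ball, hence
  (\<open>integral_along_curve_le_net\<close>) the integral of \<open>h\<close> along any curve in that ball is controlled by
  finitely many integrals at points of \<open>D\<close> and by \<open>\<eta>\<close> times the integral of \<open>\<lambda>\<close>. The bounded
  \<open>l\<close>-bounds make the last term small uniformly over \<open>E\<close>. All of this happens in \<open>L\<^sup>1\<close>: on a compact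
  interval the exponent \<open>p\<close> is disposed of by \<open>x \<le> \<delta> + \<delta>\<^sup>1\<^sup>-\<^sup>p x\<^sup>p\<close>.

  The estimate is applied twice. With \<open>h = f\<^sub>n - f\<close> it shows that \<open>f\<^sub>n\<close> tends to \<open>f\<close> in \<open>L\<^sup>1\<close> along
  every curve (\<open>topology_D_tendsto_along_curve\<close>). With \<open>h = f \<in> C\<close> it shows that the functions of a
  compact set are equiintegrable along curves (\<open>compact_equiintegrable_along_curves\<close>), because at a
  single point of \<open>D\<close> they are totally bounded in \<open>L\<^sup>1\<close>; this is the equicontinuity in (ii). The
  moduli in (ii) are continuous because the domains of the curves are intervals, which makes a
  modulus of continuity subadditive.

  For (i), the limit solution \<open>x\<close> stays in some ball on \<open>[T\<^sub>1, T\<^sub>2]\<close>. Composing \<open>f\<^sub>n\<close> with the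
  nearest-point projection onto a larger ball gives globally Lipschitz problems, which are solvable on
  the whole interval (\<open>integral_solution_exists\<close>). A Gronwall estimate with an \<open>L\<^sup>1\<close> kernel
  (\<open>integral_solution_stability\<close>) bounds the distance of their solutions to \<open>x\<close> by the distance of the
  initial values and the integral of \<open>f\<^sub>n - f\<close> along the single curve \<open>x\<close>. So these solutions converge
  uniformly to \<open>x\<close>, eventually remain in the ball, and then solve the original problems.

  For (iii), the curves \<open>x\<^sub>n\<close> have the moduli of (ii), so that the topology \<open>\<T>\<^sub>\<Theta>\<close> applies to them:
  the coefficients \<open>F\<^sub>n(\<cdot>, x\<^sub>n(\<cdot>))\<close> and \<open>h\<^sub>n(\<cdot>, x\<^sub>n(\<cdot>))\<close> converge in \<open>L\<^sup>1\<close>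
  (\<open>topology_Theta_tendsto_along_curves\<close>), and the same Gronwall estimate carries this over to the
  solutions of the linear equations.
\<close>

section \<open>Integrals over compact intervals\<close>

lemma interval_integrable_subinterval:
  fixes f :: "real \<Rightarrow> 'a::{banach, second_countable_topology}"
  assumes "set_integrable lborel {a..b} f" "s \<in> {a..b}" "t \<in> {a..b}"
  shows "interval_lebesgue_integrable lborel (ereal s) (ereal t) f"
  unfolding interval_lebesgue_integrable_def using assms
  by (auto intro!: set_integrable_subset[OF assms(1)] simp: einterval_eq)

lemma interval_integral_chain:
  fixes f :: "real \<Rightarrow> 'a::{banach, second_countable_topology}"
  assumes f: "set_integrable lborel {a..b} f" and "s \<in> {a..b}" "t \<in> {a..b}" "r \<in> {a..b}"
  shows "(LBINT u=ereal s..ereal t. f u) + (LBINT u=ereal t..ereal r. f u) =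
    (LBINT u=ereal s..ereal r. f u)"
proof (rule interval_integral_sum)
  have "interval_lebesgue_integrable lborel (ereal (min s (min t r))) (ereal (max s (max t r))) f"
    by (rule interval_integrable_subinterval[OF f]) (use assms in \<open>auto simp: min_def max_def\<close>)
  then show "interval_lebesgue_integrable lborel (min (ereal s) (min (ereal t) (ereal r)))
      (max (ereal s) (max (ereal t) (ereal r))) f"
    by (simp add: ereal_min ereal_max)
qed

lemma norm_interval_integral_le:
  fixes f :: "real \<Rightarrow> 'a::{banach, second_countable_topology}"
  assumes f: "set_integrable lborel {a..b} f" and h: "set_integrable lborel {a..b} h"
    and s: "s \<in> {a..b}" and t: "t \<in> {a..b}"
    and bd: "AE u in lborel. u \<in> {min s t..max s t} \<longrightarrow> norm (f u) \<le> h u"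
  shows "norm (LBINT u=ereal s..ereal t. f u) \<le> (LINT u:{min s t..max s t}|lborel. h u)"
proof -
  let ?S = "{min s t..max s t}"
  have sub: "?S \<subseteq> {a..b}" using s t by (auto simp: min_def max_def)
  have f': "set_integrable lborel ?S f" and h': "set_integrable lborel ?S h"
    using set_integrable_subset[OF f _ sub] set_integrable_subset[OF h _ sub] by auto
  have "norm (LBINT u=ereal s..ereal t. f u) = norm (LINT u:?S|lborel. f u)"
  proof (cases "s \<le> t")
    case True then show ?thesis by (simp add: interval_integral_Icc)
  next
    case False then show ?thesis
      by (subst interval_integral_endpoints_reverse) (simp add: interval_integral_Icc)
  qed
  also have "\<dots> \<le> (LINT u:?S|lborel. h u)"
    unfolding set_lebesgue_integral_def
  proof (rule order_trans[OF integral_norm_bound], rule integral_mono_AE)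
    show "integrable lborel (\<lambda>x. norm (indicator ?S x *\<^sub>R f x))"
      using f' unfolding set_integrable_def by (rule integrable_norm)
    show "integrable lborel (\<lambda>x. indicator ?S x *\<^sub>R h x)"
      using h' unfolding set_integrable_def .
    show "AE x in lborel. norm (indicator ?S x *\<^sub>R f x) \<le> indicator ?S x *\<^sub>R h x"
      using bd by eventually_elim (auto simp: indicator_def)
  qed
  finally show ?thesis .
qed

lemma continuous_on_primitive:
  fixes f :: "real \<Rightarrow> 'a::euclidean_space"
  assumes f: "set_integrable lborel {a..b} f" and c: "c \<in> {a..b}"
  shows "continuous_on {a..b} (\<lambda>t. LBINT u=ereal c..ereal t. f u)"
proof -
  have eq: "(LBINT u=ereal c..ereal t. f u) = (LBINT u=ereal c..ereal a. f u) + integral {a..t} f"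
    if t: "t \<in> {a..b}" for t
  proof -
    have "set_integrable lborel {a..t} f"
      by (rule set_integrable_subset[OF f]) (use t in auto)
    then have "(LBINT u=ereal a..ereal t. f u) = integral {a..t} f"
      using t by (intro interval_integral_eq_integral) auto
    moreover have "(LBINT u=ereal c..ereal a. f u) + (LBINT u=ereal a..ereal t. f u)
        = (LBINT u=ereal c..ereal t. f u)"
      by (rule interval_integral_chain[OF f c]) (use t in auto)
    ultimately show ?thesis by simp
  qed
  have "f integrable_on {a..b}" using f by (rule set_borel_integral_eq_integral)
  then have "continuous_on {a..b} (\<lambda>t. (LBINT u=ereal c..ereal a. f u) + integral {a..t} f)"
    by (intro continuous_intros indefinite_integral_continuous_1)
  then show ?thesis by (subst continuous_on_cong[OF refl eq])
qed

lemma set_integral_nonneg_on: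
  fixes f :: "real \<Rightarrow> real"
  assumes "\<And>u. u \<in> S \<Longrightarrow> 0 \<le> f u"
  shows "0 \<le> (LINT u:S|lborel. f u)"
  unfolding set_lebesgue_integral_def
  by (rule Bochner_Integration.integral_nonneg) (use assms in \<open>auto simp: indicator_def\<close>)

lemma set_integral_mono_set:
  fixes f :: "real \<Rightarrow> real"
  assumes f: "set_integrable lborel T f" and [measurable]: "S \<in> sets borel" and "S \<subseteq> T" and "\<And>u. u \<in> T \<Longrightarrow> 0 \<le> f u"
  shows "(LINT u:S|lborel. f u) \<le> (LINT u:T|lborel. f u)"
proof -
  have "set_integrable lborel S f" by (rule set_integrable_subset[OF f]) (use assms in auto)
  then show ?thesis
    using f assms unfolding set_lebesgue_integral_def set_integrable_def
    by (intro integral_mono) (auto simp: indicator_def)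
qed

lemma set_integral_point:
  fixes f :: "real \<Rightarrow> 'a::{banach, second_countable_topology}"
  shows "(LINT u:{a..a}|lborel. f u) = 0"
  using interval_integral_Icc[of a a f] by (simp only: interval_integral_endpoints_same order_refl)

lemma set_integral_split:
  fixes f :: "real \<Rightarrow> 'a::{banach, second_countable_topology}"
  assumes f: "set_integrable lborel {a..b} f" and "a \<le> s" "s \<le> t" "t \<le> b"
  shows "(LINT u:{s..t}|lborel. f u) = (LINT u:{a..t}|lborel. f u) - (LINT u:{a..s}|lborel. f u)"
  using interval_integral_chain[OF f, of a s t] assms by (simp add: interval_integral_Icc algebra_simps)

lemma primitive_of_nonneg:
  fixes l :: "real \<Rightarrow> real"
  assumes l: "set_integrable lborel {a..b} l" and pos: "\<And>u. 0 \<le> l u"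
  shows "continuous_on {a..b} (\<lambda>t. LINT u:{a..t}|lborel. l u)"
    and "mono_on {a..b} (\<lambda>t. LINT u:{a..t}|lborel. l u)"
proof -
  have "continuous_on {a..b} (\<lambda>t. LBINT u=ereal a..ereal t. l u)" if "a \<le> b"
    using that by (intro continuous_on_primitive[OF l]) auto
  then show "continuous_on {a..b} (\<lambda>t. LINT u:{a..t}|lborel. l u)"
    by (cases "a \<le> b") (auto simp: interval_integral_Icc cong: continuous_on_cong_simp)
  show "mono_on {a..b} (\<lambda>t. LINT u:{a..t}|lborel. l u)"
  proof (intro mono_onI set_integral_mono_set)
    fix r s assume "r \<in> {a..b}" "s \<in> {a..b}" "r \<le> s"
    then show "set_integrable lborel {a..s} l"
      by (intro set_integrable_subset[OF l]) auto
  qed (use pos in auto)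
qed

section \<open>A Gronwall estimate by halving the kernel\<close>

text \<open>
  Gronwall's inequality with the integrals abstracted away: \<open>L\<close> plays the role of a primitive of the
  Lipschitz kernel, and \<open>M * (L t - L s)\<close> that of the integral of the kernel times \<open>u\<close>. On an interval
  over which \<open>L\<close> grows by at most \<open>1/2\<close>, the maximum \<open>m\<close> of \<open>norm u\<close> satisfies
  \<open>m \<le> norm (u d) + e + m/2\<close> for each point \<open>d\<close> of it, so passing from one point to another costs a
  factor \<open>2\<close>. The interval is cut where \<open>L\<close> has grown by \<open>k/2\<close>; crossing the cut adds \<open>e\<close> once more,
  whence the factor \<open>4\<close> per step. The bound propagates in both directions of time from \<open>c\<close>.
\<close>

lemma gronwall_halving:
  fixes u :: "real \<Rightarrow> 'a::real_normed_vector" and L :: "real \<Rightarrow> real"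
  assumes "continuous_on {a..b} L" "mono_on {a..b} L" "continuous_on {a..b} u"
    and "\<And>s t M. a \<le> s \<Longrightarrow> s \<le> t \<Longrightarrow> t \<le> b \<Longrightarrow> (\<And>r. r \<in> {s..t} \<Longrightarrow> norm (u r) \<le> M) \<Longrightarrow>
      norm (u t - u s) \<le> e + M * (L t - L s)"
    and "0 \<le> e" "L b - L a \<le> real k / 2" "c \<in> {a..b}"
  shows "\<forall>t\<in>{a..b}. norm (u t) \<le> 4 ^ k * (norm (u c) + e)"
  using assms
proof (induction k arbitrary: a b c)
  case 0
  obtain B where B: "\<And>r. r \<in> {a..b} \<Longrightarrow> norm (u r) \<le> B"
    using compact_imp_bounded[OF compact_continuous_image[OF "0.prems"(3)]] unfolding bounded_iff
    by (metis compact_Icc image_eqI)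
  have L: "L r = L a" if "r \<in> {a..b}" for r
    using mono_onD[OF "0.prems"(2), of a r] mono_onD[OF "0.prems"(2), of r b] that "0.prems"(6) by auto
  have "norm (u t - u s) \<le> e" if "a \<le> s" "s \<le> t" "t \<le> b" for s t
    using "0.prems"(4)[OF that, of B] B L[of s] L[of t] that by auto
  then have *: "norm (u t - u c) \<le> e" if "t \<in> {a..b}" for t
    using that "0.prems"(7) by (metis atLeastAtMost_iff linear norm_minus_commute)
  show ?case
  proof
    fix t assume "t \<in> {a..b}"
    then show "norm (u t) \<le> 4 ^ 0 * (norm (u c) + e)"
      using *[of t] norm_triangle_sub[of "u t" "u c"] by simp
  qed
next
  case (Suc k)
  have ab: "a \<le> b" using Suc.prems by auto
  note L = mono_onD[OF Suc.prems(2)]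
  have short: "norm (u t) \<le> 2 * (norm (u d) + e)"
    if "a \<le> a'" "b' \<le> b" "L b' - L a' \<le> 1 / 2" "d \<in> {a'..b'}" "t \<in> {a'..b'}" for a' b' d t
  proof -
    have "continuous_on {a'..b'} (\<lambda>r. norm (u r))"
      using that by (intro continuous_on_norm continuous_on_subset[OF Suc.prems(3)]) auto
    moreover have ne: "{a'..b'} \<noteq> {}" using that(4) by auto
    ultimately obtain m where m: "m \<in> {a'..b'}" "\<And>r. r \<in> {a'..b'} \<Longrightarrow> norm (u r) \<le> norm (u m)"
      using continuous_attains_sup[of "{a'..b'}" "\<lambda>r. norm (u r)"] ne by (metis compact_Icc)
    have step: "norm (u y - u x) \<le> e + norm (u m) / 2" if "a' \<le> x" "x \<le> y" "y \<le> b'" for x y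
    proof -
      have "norm (u y - u x) \<le> e + norm (u m) * (L y - L x)"
        using that \<open>a \<le> a'\<close> \<open>b' \<le> b\<close> m(2) by (intro Suc.prems(4)) auto
      moreover have "L y - L x \<le> 1 / 2"
        using L[of a' x] L[of y b'] that \<open>a \<le> a'\<close> \<open>b' \<le> b\<close> \<open>L b' - L a' \<le> 1 / 2\<close> by auto
      then have "norm (u m) * (L y - L x) \<le> norm (u m) * (1 / 2)"
        by (intro mult_left_mono) auto
      ultimately show ?thesis by simp
    qed
    have "norm (u m - u d) \<le> e + norm (u m) / 2"
      using step[of d m] step[of m d] m(1) that(4) norm_minus_commute[of "u m" "u d"]
      by (cases "d \<le> m") auto
    then have "norm (u m) \<le> 2 * (norm (u d) + e)"
      using norm_triangle_sub[of "u m" "u d"] by simp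
    then show ?thesis using m(2)[OF that(5)] by simp
  qed
  obtain d where d: "d \<in> {a..b}" "L d - L a \<le> real k / 2" "L b - L d \<le> 1 / 2"
  proof (cases "L b - L a \<le> real k / 2")
    case True then show ?thesis using that[of b] ab by auto
  next
    case False
    then have "\<exists>x. a \<le> x \<and> x \<le> b \<and> L x = L a + real k / 2"
      using Suc.prems(1) ab by (intro IVT') auto
    then show ?thesis using Suc.prems(6) by (elim exE) (rule that, auto simp: field_simps)
  qed
  have IH: "norm (u t) \<le> 4 ^ k * (norm (u c') + e)" if "c' \<in> {a..d}" "t \<in> {a..d}" for c' t
  proof -
    have "\<forall>t\<in>{a..d}. norm (u t) \<le> 4 ^ k * (norm (u c') + e)"
    proof (rule Suc.IH)
      show "continuous_on {a..d} L" "continuous_on {a..d} u" "mono_on {a..d} L"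
        using d(1) by (auto intro: continuous_on_subset[OF Suc.prems(1)] continuous_on_subset[OF Suc.prems(3)]
          mono_on_subset[OF Suc.prems(2)])
      show "norm (u t - u s) \<le> e + M * (L t - L s)"
        if "a \<le> s" "s \<le> t" "t \<le> d" "\<And>r. r \<in> {s..t} \<Longrightarrow> norm (u r) \<le> M" for s t M
        using that d(1) by (intro Suc.prems(4)) auto
    qed (use d Suc.prems(5) that in auto)
    then show ?thesis using that by auto
  qed
  have one: "1 \<le> (4::real) ^ k" by simp
  have e: "0 \<le> e" by fact
  show ?case
  proof
    fix t assume t: "t \<in> {a..b}"
    let ?X = "norm (u c) + e"
    define Y where "Y = 4 ^ k * ?X"
    have X: "e \<le> ?X" "?X \<le> Y" "e \<le> Y"
    proof -
      show "e \<le> ?X" by simp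
      moreover show "?X \<le> Y" using e mult_right_mono[OF one, of ?X] by (simp add: Y_def)
      ultimately show "e \<le> Y" by (rule order_trans)
    qed
    have tot: "norm (u t) \<le> 4 * Y"
    proof (cases "c \<le> d")
      case True
      show ?thesis
      proof (cases "t \<le> d")
        case True
        then have "norm (u t) \<le> Y" unfolding Y_def using \<open>c \<le> d\<close> t Suc.prems(7) by (intro IH) auto
        then show ?thesis using X e by argo
      next
        case False
        then have "norm (u t) \<le> 2 * (norm (u d) + e)" using d t by (intro short[of d b]) auto
        moreover have "norm (u d) \<le> Y" unfolding Y_def using \<open>c \<le> d\<close> d Suc.prems(7) by (intro IH) auto
        ultimately show ?thesis using X by simp
      qed
    next
      case False
      then have A: "norm (u s) \<le> 2 * ?X" if "s \<in> {d..b}" for s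
        using d that Suc.prems(7) by (intro short[of d b]) auto
      show ?thesis
      proof (cases "t \<le> d")
        case True
        then have "norm (u t) \<le> 4 ^ k * (norm (u d) + e)" using t d by (intro IH) auto
        also have "\<dots> \<le> 4 ^ k * (4 * ?X)"
        proof (rule mult_left_mono)
          have "norm (u d) \<le> 2 * ?X" using A[of d] d by auto
          then show "norm (u d) + e \<le> 4 * ?X" using norm_ge_zero[of "u c"] e by argo
        qed simp
        also have "\<dots> = 4 * Y" by (simp add: Y_def algebra_simps)
        finally show ?thesis .
      next
        case False
        then have "norm (u t) \<le> 2 * ?X" using A t by auto
        then show ?thesis using X e by argo
      qed
    qed
    then show "norm (u t) \<le> 4 ^ Suc k * (norm (u c) + e)" by (simp add: Y_def)
  qed
qed

section \<open>Integral solutions\<close>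

lemma is_interval_min_max_subset:
  fixes J :: "real set"
  assumes "is_interval J" "s \<in> J" "t \<in> J"
  shows "{min s t..max s t} \<subseteq> J"
proof
  fix u assume "u \<in> {min s t..max s t}"
  then show "u \<in> J" using assms by (smt (verit) atLeastAtMost_iff is_interval_1 min_def max_def)
qed

lemma integral_solutionD:
  assumes "integral_solution g J z" "s \<in> J" "t \<in> J"
  shows "interval_lebesgue_integrable lborel (ereal s) (ereal t) (\<lambda>u. g u (z u))"
    and "z t = z s + (LBINT u=ereal s..ereal t. g u (z u))"
  using assms(1)[unfolded integral_solution_def, rule_format, OF assms(2,3)] by (rule conjunct1, rule conjunct2)

lemma integral_solution_subset:
  "integral_solution g J z \<Longrightarrow> J' \<subseteq> J \<Longrightarrow> integral_solution g J' z"
  by (simp add: integral_solution_def subset_eq)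

lemma integral_solution_cong:
  assumes sol: "integral_solution g J z" and J: "is_interval J"
    and eq: "\<And>u. u \<in> J \<Longrightarrow> w u = z u" "\<And>u. u \<in> J \<Longrightarrow> g' u (w u) = g u (z u)"
  shows "integral_solution g' J w"
  unfolding integral_solution_def
proof (intro ballI conjI)
  fix s t assume st: "s \<in> J" "t \<in> J"
  have eq': "g' u (w u) = g u (z u)" if "min s t \<le> u" "u \<le> max s t" for u
  proof (rule eq(2))
    show "u \<in> J" using is_interval_min_max_subset[OF J st] that by auto
  qed
  have "set_integrable lborel {x<..<y} (\<lambda>u. g' u (w u)) = set_integrable lborel {x<..<y} (\<lambda>u. g u (z u))"
    if "x \<in> {s, t}" "y \<in> {s, t}" for x y
    by (rule set_integrable_cong) (use that in \<open>auto intro!: eq'\<close>)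
  moreover have "interval_lebesgue_integrable lborel (ereal s) (ereal t) (\<lambda>u. g u (z u))"
    by (rule integral_solutionD(1)[OF sol st])
  ultimately show "interval_lebesgue_integrable lborel (ereal s) (ereal t) (\<lambda>u. g' u (w u))"
    unfolding interval_lebesgue_integrable_def einterval_eq by (simp split: if_splits)
  have "(LBINT u=ereal s..ereal t. g' u (w u)) = (LBINT u=ereal s..ereal t. g u (z u))"
    by (rule interval_integral_cong) (auto intro!: eq' simp flip: ereal_min ereal_max)
  then show "w t = w s + (LBINT u=ereal s..ereal t. g' u (w u))"
    using integral_solutionD(2)[OF sol st] eq(1) st by simp
qed

lemma integral_solution_integrable:
  assumes "integral_solution g {a..b} z"
  shows "set_integrable lborel {a..b} (\<lambda>u. g u (z u))"
proof (cases "a \<le> b")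
  case True
  then have "interval_lebesgue_integrable lborel (ereal a) (ereal b) (\<lambda>u. g u (z u))"
    by (intro integral_solutionD(1)[OF assms]) auto
  then have "set_integrable lborel {a<..<b} (\<lambda>u. g u (z u))"
    using True by (simp add: interval_lebesgue_integrable_def)
  moreover have "sym_diff {a<..<b} {a..b} \<subseteq> {a, b}" by auto
  ultimately show ?thesis
    using set_integrable_discrete_difference[of "{a, b}" "{a<..<b}" "{a..b}" lborel] by auto
qed auto

lemma integral_solutionI:
  assumes int: "set_integrable lborel {a..b} (\<lambda>u. g u (z u))" and c: "c \<in> {a..b}"
    and z: "\<And>t. t \<in> {a..b} \<Longrightarrow> z t = z c + (LBINT u=ereal c..ereal t. g u (z u))"
  shows "integral_solution g {a..b} z"
  unfolding integral_solution_def
proof (intro ballI conjI)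
  fix s t assume st: "s \<in> {a..b}" "t \<in> {a..b}"
  show "interval_lebesgue_integrable lborel (ereal s) (ereal t) (\<lambda>u. g u (z u))"
    by (rule interval_integrable_subinterval[OF int st])
  show "z t = z s + (LBINT u=ereal s..ereal t. g u (z u))"
    using z[OF st(1)] z[OF st(2)] interval_integral_chain[OF int c st] by simp
qed

lemma integral_solution_continuous:
  assumes "integral_solution g {a..b} z"
  shows "continuous_on {a..b} z"
proof (cases "a \<le> b")
  case True
  have "continuous_on {a..b} (\<lambda>t. z a + (LBINT u=ereal a..ereal t. g u (z u)))"
    using True by (intro continuous_intros continuous_on_primitive integral_solution_integrable assms) auto
  then show ?thesis
  proof (rule continuous_on_eq)
    fix t assume "t \<in> {a..b}"
    then show "z a + (LBINT u=ereal a..ereal t. g u (z u)) = z t"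
      using True by (intro integral_solutionD(2)[OF assms, symmetric]) auto
  qed
qed auto

lemma integral_solution_glue:
  assumes z: "integral_solution g {a..d} z" and w: "integral_solution g {d..b} w"
    and d: "a \<le> d" "d \<le> b" and eq: "z d = w d"
  shows "integral_solution g {a..b} (\<lambda>t. if t \<le> d then z t else w t)" (is "integral_solution g _ ?v")
proof -
  have zv: "integral_solution g {a..d} ?v"
    by (rule integral_solution_cong[OF z]) (auto simp: is_interval_cc)
  have wv: "integral_solution g {d..b} ?v"
    by (rule integral_solution_cong[OF w]) (use eq in \<open>auto simp: is_interval_cc\<close>)
  show ?thesis
  proof (rule integral_solutionI)
    have "{a..b} = {a..d} \<union> {d..b}" using d by auto
    then show "set_integrable lborel {a..b} (\<lambda>u. g u (?v u))"
      using set_integrable_Un[OF zv[THEN integral_solution_integrable] wv[THEN integral_solution_integrable]]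
      by simp
    show "d \<in> {a..b}" using d by auto
    fix t assume "t \<in> {a..b}"
    then consider "t \<in> {a..d}" | "t \<in> {d..b}" by fastforce
    then show "?v t = ?v d + (LBINT u=ereal d..ereal t. g u (?v u))"
    proof cases
      case 1
      then show ?thesis using d by (intro integral_solutionD(2)[OF zv]) auto
    next
      case 2
      then show ?thesis using d by (intro integral_solutionD(2)[OF wv]) auto
    qed
  qed
qed

lemma integral_solution_if_compact:
  assumes "is_interval J" and "\<And>a b. a \<le> b \<Longrightarrow> {a..b} \<subseteq> J \<Longrightarrow> integral_solution g {a..b} z"
  shows "integral_solution g J z"
proof -
  have "interval_lebesgue_integrable lborel (ereal s) (ereal t) (\<lambda>u. g u (z u)) \<and>
     z t = z s + (LBINT u=ereal s..ereal t. g u (z u))" if "s \<in> J" "t \<in> J" for s t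
  proof -
    have "{min s t..max s t} \<subseteq> J"
      by (rule is_interval_min_max_subset[OF assms(1) that])
    then have "integral_solution g {min s t..max s t} z" by (intro assms(2)) auto
    moreover have "s \<in> {min s t..max s t}" "t \<in> {min s t..max s t}" by auto
    ultimately show ?thesis by (intro conjI integral_solutionD[of g "{min s t..max s t}"])
  qed
  then show ?thesis unfolding integral_solution_def by (intro ballI)
qed

section \<open>Stability, uniqueness and existence\<close>

text \<open>
  Over \<open>[s, t]\<close> the difference of the solutions changes by at most the integral of \<open>g' - g\<close> along \<open>z\<close>
  plus the integral of \<open>l\<close> times the difference itself, which is the hypothesis of
  \<open>gronwall_halving\<close>. The Lipschitz estimate is required along the two given curves only; thus the
  lemma serves for locally Lipschitz right-hand sides, and uniqueness is its case \<open>g' = g\<close>.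
\<close>

lemma integral_solution_stability:
  fixes g g' :: "real \<Rightarrow> real^'n \<Rightarrow> real^'n"
  assumes z: "integral_solution g {a..b} z" and w: "integral_solution g' {a..b} w" and c: "c \<in> {a..b}"
    and l: "set_integrable lborel {a..b} l" "\<And>u. 0 \<le> l u"
    and lip: "AE u in lborel. u \<in> {a..b} \<longrightarrow> norm (g' u (w u) - g' u (z u)) \<le> l u * norm (w u - z u)"
    and g': "set_integrable lborel {a..b} (\<lambda>u. g' u (z u))"
    and e: "(LINT u:{a..b}|lborel. norm (g' u (z u) - g u (z u))) \<le> e"
    and k: "(LINT u:{a..b}|lborel. l u) \<le> real k / 2"
  shows "\<forall>t\<in>{a..b}. norm (w t - z t) \<le> 4 ^ k * (norm (w c - z c) + e)"
proof (rule gronwall_halving[where L = "\<lambda>t. LINT u:{a..t}|lborel. l u"])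
  have zi: "set_integrable lborel {a..b} (\<lambda>u. g u (z u))"
    and wi: "set_integrable lborel {a..b} (\<lambda>u. g' u (w u))"
    using z w by (auto intro: integral_solution_integrable)
  have di: "set_integrable lborel {a..b} (\<lambda>u. norm (g' u (z u) - g u (z u)))"
    using set_integrable_norm[OF set_integral_diff(1)[OF g' zi]] .
  show "0 \<le> e" using set_integral_nonneg_on[of "{a..b}" "\<lambda>u. norm (g' u (z u) - g u (z u))"] e by simp
  show "continuous_on {a..b} (\<lambda>t. LINT u:{a..t}|lborel. l u)"
    "mono_on {a..b} (\<lambda>t. LINT u:{a..t}|lborel. l u)"
    using primitive_of_nonneg[OF l] by auto
  show "continuous_on {a..b} (\<lambda>t. w t - z t)"
    using z w by (intro continuous_intros integral_solution_continuous)
  show "c \<in> {a..b}" by fact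
  show "(LINT u:{a..b}|lborel. l u) - (LINT u:{a..a}|lborel. l u) \<le> real k / 2"
    unfolding set_integral_point using k by simp
  fix s t M assume st: "a \<le> s" "s \<le> t" "t \<le> b" and M: "\<And>r. r \<in> {s..t} \<Longrightarrow> norm (w r - z r) \<le> M"
  have I: "set_integrable lborel {s..t} f" if "set_integrable lborel {a..b} f" for f :: "real \<Rightarrow> 'b::{banach,second_countable_topology}"
    by (rule set_integrable_subset[OF that]) (use st in auto)
  have s: "s \<in> {a..b}" and t: "t \<in> {a..b}" using st by auto
  have "(w t - z t) - (w s - z s) = (LBINT u=ereal s..ereal t. g' u (w u)) - (LBINT u=ereal s..ereal t. g u (z u))"
  proof -
    have "w t = w s + (LBINT u=ereal s..ereal t. g' u (w u))" "z t = z s + (LBINT u=ereal s..ereal t. g u (z u))"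
      using integral_solutionD(2)[OF w s t] integral_solutionD(2)[OF z s t] .
    then show ?thesis by simp
  qed
  also have "\<dots> = (LBINT u=ereal s..ereal t. g' u (w u) - g u (z u))"
    by (rule interval_lebesgue_integral_diff(2)[symmetric])
      (auto intro: interval_integrable_subinterval[OF wi s t] interval_integrable_subinterval[OF zi s t])
  finally have "norm ((w t - z t) - (w s - z s)) = norm (LBINT u=ereal s..ereal t. g' u (w u) - g u (z u))"
    by simp
  also have "\<dots> \<le> (LINT u:{min s t..max s t}|lborel. norm (g' u (z u) - g u (z u)) + M * l u)"
  proof (rule norm_interval_integral_le[OF _ _ s t])
    show "set_integrable lborel {a..b} (\<lambda>u. g' u (w u) - g u (z u))" using wi zi by auto
    show "set_integrable lborel {a..b} (\<lambda>u. norm (g' u (z u) - g u (z u)) + M * l u)"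
      using di l(1) by auto
    show "AE u in lborel. u \<in> {min s t..max s t} \<longrightarrow> norm (g' u (w u) - g u (z u))
        \<le> norm (g' u (z u) - g u (z u)) + M * l u"
      using lip
    proof eventually_elim
      case (elim u)
      show ?case
      proof
        assume "u \<in> {min s t..max s t}"
        then have u: "u \<in> {s..t}" using st by auto
        have "norm (g' u (w u) - g' u (z u)) \<le> l u * norm (w u - z u)" using elim u st by auto
        also have "\<dots> \<le> M * l u" using mult_left_mono[OF M[OF u] l(2)[of u]] by (simp add: mult.commute)
        finally show "norm (g' u (w u) - g u (z u)) \<le> norm (g' u (z u) - g u (z u)) + M * l u"
          using norm_triangle_ineq[of "g' u (z u) - g u (z u)" "g' u (w u) - g' u (z u)"] by simp
      qed
    qed
  qed
  also have "\<dots> = (LINT u:{s..t}|lborel. norm (g' u (z u) - g u (z u))) + M * (LINT u:{s..t}|lborel. l u)"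
    using st I[OF di] I[OF l(1)] by simp
  also have "\<dots> \<le> e + M * (LINT u:{s..t}|lborel. l u)"
    using order_trans[OF set_integral_mono_set[OF di, of "{s..t}"] e] st by auto
  also have "(LINT u:{s..t}|lborel. l u) = (LINT u:{a..t}|lborel. l u) - (LINT u:{a..s}|lborel. l u)"
    by (rule set_integral_split[OF l(1) st])
  finally show "norm ((w t - z t) - (w s - z s))
      \<le> e + M * ((LINT u:{a..t}|lborel. l u) - (LINT u:{a..s}|lborel. l u))" .
qed

text \<open>
  The Picard operator is a contraction with factor \<open>1/2\<close> when the kernel has total mass at most \<open>1/2\<close>.
  To have a complete space at hand, curves are bounded continuous functions on all of \<open>\<real>\<close>, and the
  operator freezes its result outside \<open>[a, b]\<close>.
\<close>

lemma picard_short_interval: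
  fixes g :: "real \<Rightarrow> real^'n \<Rightarrow> real^'n"
  assumes c: "c \<in> {a..b}" and l: "set_integrable lborel {a..b} l" "\<And>u. 0 \<le> l u"
    and lip: "AE u in lborel. u \<in> {a..b} \<longrightarrow> (\<forall>x y. norm (g u x - g u y) \<le> l u * norm (x - y))"
    and int: "\<And>z. continuous_on UNIV z \<Longrightarrow> set_integrable lborel {a..b} (\<lambda>u. g u (z u))"
    and small: "(LINT u:{a..b}|lborel. l u) \<le> 1 / 2"
  shows "\<exists>z. integral_solution g {a..b} z \<and> z c = z0"
proof -
  define cl where "cl t = max a (min b t)" for t :: real
  have cl: "cl t \<in> {a..b}" for t using c by (auto simp: cl_def)
  have cl_id: "cl t = t" if "t \<in> {a..b}" for t using that by (auto simp: cl_def)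
  have cl_cont: "continuous_on UNIV cl" unfolding cl_def by (intro continuous_intros)
  define G where "G \<phi> t = z0 + (LBINT u=ereal c..ereal (cl t). g u (apply_bcontfun \<phi> u))"
    for \<phi> :: "real \<Rightarrow>\<^sub>C (real^'n)" and t
  have int': "set_integrable lborel {a..b} (\<lambda>u. g u (apply_bcontfun \<phi> u))" for \<phi> :: "real \<Rightarrow>\<^sub>C (real^'n)"
    by (rule int) simp
  have prim: "continuous_on {a..b} (\<lambda>t. z0 + (LBINT u=ereal c..ereal t. g u (apply_bcontfun \<phi> u)))" for \<phi>
    by (intro continuous_intros continuous_on_primitive int' c)
  have G: "G \<phi> \<in> bcontfun" for \<phi>
    unfolding bcontfun_def
  proof (intro CollectI conjI)
    show "continuous_on UNIV (G \<phi>)"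
      unfolding G_def by (rule continuous_on_compose2[OF prim cl_cont]) (use cl in auto)
    have "bounded ((\<lambda>t. z0 + (LBINT u=ereal c..ereal t. g u (apply_bcontfun \<phi> u))) ` {a..b})"
      by (intro compact_imp_bounded compact_continuous_image prim compact_Icc)
    then show "bounded (range (G \<phi>))"
      by (rule bounded_subset) (use cl in \<open>auto simp: G_def\<close>)
  qed
  define T where "T \<phi> = Bcontfun (G \<phi>)" for \<phi>
  have T: "apply_bcontfun (T \<phi>) = G \<phi>" for \<phi> unfolding T_def by (rule Bcontfun_inverse[OF G])
  have "dist (T \<phi>) (T \<psi>) \<le> 1 / 2 * dist \<phi> \<psi>" for \<phi> \<psi>
  proof (rule dist_bound)
    fix t
    let ?S = "{min c (cl t)..max c (cl t)}"
    have sub: "?S \<subseteq> {a..b}" using c cl[of t] by auto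
    have "dist (G \<phi> t) (G \<psi> t) = norm (LBINT u=ereal c..ereal (cl t). g u (apply_bcontfun \<phi> u) - g u (apply_bcontfun \<psi> u))"
      unfolding G_def dist_norm
      by (subst interval_lebesgue_integral_diff(2)) (auto intro: interval_integrable_subinterval[OF int' c cl])
    also have "\<dots> \<le> (LINT u:?S|lborel. dist \<phi> \<psi> * l u)"
    proof (rule norm_interval_integral_le[OF _ _ c cl])
      show "set_integrable lborel {a..b} (\<lambda>u. g u (apply_bcontfun \<phi> u) - g u (apply_bcontfun \<psi> u))"
        using int' by auto
      show "set_integrable lborel {a..b} (\<lambda>u. dist \<phi> \<psi> * l u)" using l by auto
      show "AE u in lborel. u \<in> ?S \<longrightarrow>
          norm (g u (apply_bcontfun \<phi> u) - g u (apply_bcontfun \<psi> u)) \<le> dist \<phi> \<psi> * l u"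
        using lip
      proof eventually_elim
        case (elim u)
        show ?case
        proof
          assume "u \<in> ?S"
          then have "norm (g u (apply_bcontfun \<phi> u) - g u (apply_bcontfun \<psi> u))
              \<le> l u * norm (apply_bcontfun \<phi> u - apply_bcontfun \<psi> u)" using elim sub by auto
          also have "\<dots> \<le> l u * dist \<phi> \<psi>"
            using dist_bounded[of \<phi> u \<psi>] l(2) by (intro mult_left_mono) (auto simp: dist_norm)
          finally show "norm (g u (apply_bcontfun \<phi> u) - g u (apply_bcontfun \<psi> u)) \<le> dist \<phi> \<psi> * l u"
            by (simp add: mult.commute)
        qed
      qed
    qed
    also have "\<dots> = dist \<phi> \<psi> * (LINT u:?S|lborel. l u)" by simp
    also have "\<dots> \<le> dist \<phi> \<psi> * (1 / 2)"
    proof (intro mult_left_mono)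
      have "(LINT u:?S|lborel. l u) \<le> (LINT u:{a..b}|lborel. l u)"
        by (rule set_integral_mono_set[OF l(1) _ sub l(2)]) auto
      then show "(LINT u:?S|lborel. l u) \<le> 1 / 2" using small by linarith
    qed simp
    finally show "dist (apply_bcontfun (T \<phi>) t) (apply_bcontfun (T \<psi>) t) \<le> 1 / 2 * dist \<phi> \<psi>"
      unfolding T by simp
  qed
  then obtain \<phi> where \<phi>: "T \<phi> = \<phi>" using banach_fix_type[of "1/2" T] by auto
  have eq: "apply_bcontfun \<phi> t = z0 + (LBINT u=ereal c..ereal t. g u (apply_bcontfun \<phi> u))" if "t \<in> {a..b}" for t
    using fun_cong[OF T, of \<phi> t] \<phi> cl_id[OF that] by (simp add: G_def)
  have c0: "apply_bcontfun \<phi> c = z0" using eq[OF c] by simp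
  have "integral_solution g {a..b} (apply_bcontfun \<phi>)"
    by (rule integral_solutionI[where c = c]) (simp_all only: int' c c0 eq)
  then show ?thesis using c0 by blast
qed

text \<open>
  The interval is cut into pieces over which the kernel has mass at most \<open>1/2\<close>. The solution is first
  built on the side of the cut that contains \<open>c\<close>; its value at the cut is the initial value for the
  other side.
\<close>

lemma integral_solution_exists:
  fixes g :: "real \<Rightarrow> real^'n \<Rightarrow> real^'n"
  assumes c: "c \<in> {a..b}" and l: "set_integrable lborel {a..b} l" "\<And>u. 0 \<le> l u"
    and lip: "AE u in lborel. u \<in> {a..b} \<longrightarrow> (\<forall>x y. norm (g u x - g u y) \<le> l u * norm (x - y))"
    and int: "\<And>z. continuous_on UNIV z \<Longrightarrow> set_integrable lborel {a..b} (\<lambda>u. g u (z u))"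
  shows "\<exists>z. integral_solution g {a..b} z \<and> z c = z0"
proof -
  obtain k :: nat where "(LINT u:{a..b}|lborel. l u) \<le> real k / 2"
    using real_arch_simple[of "2 * (LINT u:{a..b}|lborel. l u)"] by (auto simp: field_simps)
  then show ?thesis
    using c l(1) lip int
  proof (induction k arbitrary: a b c z0)
    case 0
    then show ?case by (intro picard_short_interval[OF _ _ l(2)]) auto
  next
    case (Suc k)
    have ab: "a \<le> b" using Suc.prems by auto
    let ?L = "\<lambda>t. LINT u:{a..t}|lborel. l u"
    note Lc = primitive_of_nonneg[OF Suc.prems(3) l(2)]
    obtain d where d: "d \<in> {a..b}" "?L d \<le> real k / 2" "?L b - ?L d \<le> 1 / 2"
    proof (cases "?L b \<le> real k / 2")
      case True then show ?thesis using that[of b] ab by auto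
    next
      case False
      have "?L a = 0" by (rule set_integral_point)
      then have "\<exists>x. a \<le> x \<and> x \<le> b \<and> ?L x = real k / 2"
        using Lc(1) False ab by (intro IVT') auto
      then show ?thesis using Suc.prems(1) by (elim exE) (rule that, auto simp: field_simps)
    qed
    have int1: "set_integrable lborel {a'..b'} f"
      if "set_integrable lborel {a..b} f" "a \<le> a'" "b' \<le> b"
      for a' b' and f :: "real \<Rightarrow> 'b::{banach,second_countable_topology}"
      by (rule set_integrable_subset[OF that(1)]) (use that in auto)
    have lip1: "AE u in lborel. u \<in> {a'..b'} \<longrightarrow> (\<forall>x y. norm (g u x - g u y) \<le> l u * norm (x - y))"
      if "a \<le> a'" "b' \<le> b" for a' b'
      using Suc.prems(4) by eventually_elim (use that in auto)
    have left: "\<exists>z. integral_solution g {a..d} z \<and> z c' = v" if "c' \<in> {a..d}" for c' v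
    proof (rule Suc.IH[OF d(2) that])
      show "set_integrable lborel {a..d} l" using d by (intro int1[OF Suc.prems(3)]) auto
      show "AE u in lborel. u \<in> {a..d} \<longrightarrow> (\<forall>x y. norm (g u x - g u y) \<le> l u * norm (x - y))"
        using d by (intro lip1) auto
      show "set_integrable lborel {a..d} (\<lambda>u. g u (z u))" if "continuous_on UNIV z" for z
        using d by (intro int1[OF Suc.prems(5)[OF that]]) auto
    qed
    have right: "\<exists>z. integral_solution g {d..b} z \<and> z c' = v" if "c' \<in> {d..b}" for c' v
    proof (rule picard_short_interval[OF that _ l(2)])
      show "set_integrable lborel {d..b} l" using d by (intro int1[OF Suc.prems(3)]) auto
      show "AE u in lborel. u \<in> {d..b} \<longrightarrow> (\<forall>x y. norm (g u x - g u y) \<le> l u * norm (x - y))"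
        using d by (intro lip1) auto
      show "set_integrable lborel {d..b} (\<lambda>u. g u (z u))" if "continuous_on UNIV z" for z
        using d by (intro int1[OF Suc.prems(5)[OF that]]) auto
      show "(LINT u:{d..b}|lborel. l u) \<le> 1 / 2"
        using d set_integral_split[OF Suc.prems(3), of d b] by auto
    qed
    show ?case
    proof (cases "c \<le> d")
      case True
      then obtain z where z: "integral_solution g {a..d} z" "z c = z0" using left[of c z0] Suc.prems(2) by auto
      obtain w where w: "integral_solution g {d..b} w" "w d = z d" using right[of d "z d"] d by auto
      show ?thesis
        using integral_solution_glue[OF z(1) w(1)] d(1) z(2) w(2) True
        by (intro exI[of _ "\<lambda>t. if t \<le> d then z t else w t"]) auto
    next
      case False
      then obtain w where w: "integral_solution g {d..b} w" "w c = z0" using right[of c z0] Suc.prems(2) by auto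
      obtain z where z: "integral_solution g {a..d} z" "z d = w d" using left[of d "w d"] d by auto
      show ?thesis
        using integral_solution_glue[OF z(1) w(1)] d(1) z(2) w(2) False
        by (intro exI[of _ "\<lambda>t. if t \<le> d then z t else w t"]) auto
    qed
  qed
qed

section \<open>Maximal solutions\<close>

text \<open>
  The interval \<open>J\<close> is a parameter because the coefficients of the linear equation along a solution are
  integrable only over compact intervals inside the domain of that solution.
\<close>

definition locally_lipschitz_rhs :: "(real \<Rightarrow> real^'n \<Rightarrow> real^'n) \<Rightarrow> real set \<Rightarrow> bool" where
  "locally_lipschitz_rhs g J \<longleftrightarrow> (\<forall>a b R. {a..b} \<subseteq> J \<longrightarrow>
     (\<exists>l. set_integrable lborel {a..b} l \<and> (\<forall>u. 0 \<le> l u) \<and>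
       (AE u in lborel. u \<in> {a..b} \<longrightarrow>
         (\<forall>x\<in>cball 0 R. \<forall>y\<in>cball 0 R. norm (g u x - g u y) \<le> l u * norm (x - y)))))"

lemma locally_lipschitz_rhs_subset:
  "locally_lipschitz_rhs g J \<Longrightarrow> J' \<subseteq> J \<Longrightarrow> locally_lipschitz_rhs g J'"
  unfolding locally_lipschitz_rhs_def by (meson subset_trans)

lemma locally_lipschitz_rhsE:
  assumes "locally_lipschitz_rhs g J" "{a..b} \<subseteq> J"
  obtains l where "set_integrable lborel {a..b} l" "\<And>u. 0 \<le> l u"
    "AE u in lborel. u \<in> {a..b} \<longrightarrow>
      (\<forall>x\<in>cball 0 R. \<forall>y\<in>cball 0 R. norm (g u x - g u y) \<le> l u * norm (x - y))"
  using assms unfolding locally_lipschitz_rhs_def by blast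

lemma continuous_on_Icc_bounded:
  fixes z :: "real \<Rightarrow> 'a::real_normed_vector"
  assumes "continuous_on {a..b} z"
  obtains R where "\<And>t. t \<in> {a..b} \<Longrightarrow> norm (z t) \<le> R"
proof -
  have "bounded (z ` {a..b})" by (intro compact_imp_bounded compact_continuous_image assms compact_Icc)
  then obtain R where "\<forall>x\<in>z ` {a..b}. norm x \<le> R" unfolding bounded_iff by blast
  then show ?thesis using that[of R] by blast
qed

lemma integral_solution_unique:
  fixes g :: "real \<Rightarrow> real^'n \<Rightarrow> real^'n"
  assumes lip: "locally_lipschitz_rhs g J" and J: "is_interval J"
    and z: "integral_solution g J z" and w: "integral_solution g J w"
    and c: "c \<in> J" "z c = w c" and t: "t \<in> J"
  shows "w t = z t"
proof -
  let ?a = "min c t" and ?b = "max c t"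
  have sub: "{?a..?b} \<subseteq> J" by (rule is_interval_min_max_subset[OF J c(1) t])
  have z': "integral_solution g {?a..?b} z" and w': "integral_solution g {?a..?b} w"
    using z w sub by (auto intro: integral_solution_subset)
  obtain R1 where R1: "\<And>s. s \<in> {?a..?b} \<Longrightarrow> norm (z s) \<le> R1"
    using continuous_on_Icc_bounded[OF integral_solution_continuous[OF z']] by blast
  obtain R2 where R2: "\<And>s. s \<in> {?a..?b} \<Longrightarrow> norm (w s) \<le> R2"
    using continuous_on_Icc_bounded[OF integral_solution_continuous[OF w']] by blast
  \<comment> \<open>One ball containing both curves, on which the right-hand side has a kernel.\<close>
  define R where "R = max R1 R2"
  have R: "z s \<in> cball 0 R" "w s \<in> cball 0 R" if "s \<in> {?a..?b}" for s
    using R1[OF that] R2[OF that] by (auto simp: R_def)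
  obtain l where l: "set_integrable lborel {?a..?b} l" "\<And>u. 0 \<le> l u"
    and lip: "AE u in lborel. u \<in> {?a..?b} \<longrightarrow>
      (\<forall>x\<in>cball 0 R. \<forall>y\<in>cball 0 R. norm (g u x - g u y) \<le> l u * norm (x - y))"
    using locally_lipschitz_rhsE[OF lip sub] by blast
  obtain k :: nat where k: "(LINT u:{?a..?b}|lborel. l u) \<le> real k / 2"
    using real_arch_simple[of "2 * (LINT u:{?a..?b}|lborel. l u)"] by (auto simp: field_simps)
  have "\<forall>s\<in>{?a..?b}. norm (w s - z s) \<le> 4 ^ k * (norm (w c - z c) + 0)"
  proof (rule integral_solution_stability[OF z' w' _ l _ _ _ k])
    show "c \<in> {?a..?b}" by auto
    show "AE u in lborel. u \<in> {?a..?b} \<longrightarrow> norm (g u (w u) - g u (z u)) \<le> l u * norm (w u - z u)"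
      using lip by eventually_elim (use R in blast)
    show "set_integrable lborel {?a..?b} (\<lambda>u. g u (z u))" by (rule integral_solution_integrable[OF z'])
  qed simp
  moreover have "t \<in> {?a..?b}" by auto
  ultimately have "norm (w t - z t) \<le> 0" using c(2) by fastforce
  then show ?thesis by simp
qed

lemma ivp_solution_unique:
  assumes "locally_lipschitz_rhs g J" "ivp_solution g z0 J z" "ivp_solution g z0 J w" "t \<in> J"
  shows "w t = z t"
proof -
  have "is_interval J" "integral_solution g J z" "integral_solution g J w" "0 \<in> J" "z 0 = w 0"
    using assms(2,3) by (auto simp: ivp_solution_def)
  then show ?thesis using integral_solution_unique[OF assms(1)] assms(4) by blast
qed

lemma ivp_solution_the:
  assumes "locally_lipschitz_rhs g J" "ivp_solution g z0 J z" "t \<in> J"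
  shows "(THE v. \<exists>z. ivp_solution g z0 J z \<and> z t = v) = z t"
proof (rule the_equality)
  show "\<exists>w. ivp_solution g z0 J w \<and> w t = z t" using assms(2) by blast
  show "v = z t" if "\<exists>w. ivp_solution g z0 J w \<and> w t = v" for v
    using that ivp_solution_unique[OF assms(1,2) _ assms(3)] by blast
qed

lemma ivp_solution_cong:
  assumes sol: "ivp_solution g z0 J z" and eq: "\<And>t. t \<in> J \<Longrightarrow> w t = z t"
  shows "ivp_solution g z0 J w"
proof -
  have J: "is_interval J" and "0 \<in> J" "z 0 = z0" "integral_solution g J z"
    using sol by (auto simp: ivp_solution_def)
  moreover have "integral_solution g J w"
    by (rule integral_solution_cong[OF \<open>integral_solution g J z\<close> J]) (auto simp: eq)
  ultimately show ?thesis unfolding ivp_solution_def using eq by auto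
qed

lemma ivp_solution_subset:
  assumes "ivp_solution g z0 J z" "J' \<subseteq> J" "is_interval J'" "0 \<in> J'"
  shows "ivp_solution g z0 J' z"
  using assms integral_solution_subset[of g J z J'] unfolding ivp_solution_def by auto

text \<open>
  The value at \<open>t\<close> is that of any solution reaching \<open>t\<close>. On a compact interval around \<open>0\<close>, uniqueness
  identifies this function with the two solutions reaching the endpoints, glued at \<open>0\<close>.
\<close>

lemma ivp_solution_Union:
  fixes g :: "real \<Rightarrow> real^'n \<Rightarrow> real^'n"
  assumes lip: "locally_lipschitz_rhs g J0" and J0: "is_interval J0" "0 \<in> J0"
    and ex: "\<And>t. t \<in> J0 \<Longrightarrow> \<exists>J z. ivp_solution g z0 J z \<and> t \<in> J \<and> J \<subseteq> J0"
  shows "\<exists>z. ivp_solution g z0 J0 z"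
proof -
  obtain JJ zz where *: "ivp_solution g z0 (JJ t) (zz t)" "t \<in> JJ t" "JJ t \<subseteq> J0" if "t \<in> J0" for t
    using ex by metis
  define v where "v t = zz t t" for t
  have zz: "ivp_solution g z0 {min 0 t..max 0 t} (zz t)" if "t \<in> J0" for t
  proof (rule ivp_solution_subset[OF *(1)[OF that]])
    show "{min 0 t..max 0 t} \<subseteq> JJ t"
      using is_interval_min_max_subset[of "JJ t" 0 t] *(1,2)[OF that] by (auto simp: ivp_solution_def)
  qed (auto simp: is_interval_cc)
  have "integral_solution g {a..b} v" if ab: "a \<le> b" "{a..b} \<subseteq> J0" for a b
  proof -
    let ?a = "min 0 a" and ?b = "max 0 b"
    have mem: "?a \<in> J0" "?b \<in> J0" using ab J0 by (auto simp: min_def max_def)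
    have za: "ivp_solution g z0 {?a..0} (zz ?a)" and zb: "ivp_solution g z0 {0..?b} (zz ?b)"
      using zz[OF mem(1)] zz[OF mem(2)] by (simp_all add: min_absorb2 max_absorb1)
    let ?w = "\<lambda>t. if t \<le> 0 then zz ?a t else zz ?b t"
    have w: "integral_solution g {?a..?b} ?w"
      by (rule integral_solution_glue) (use za zb in \<open>auto simp: ivp_solution_def\<close>)
    have ab_sub: "{?a..?b} \<subseteq> J0"
      using is_interval_min_max_subset[OF J0(1) mem] by (auto simp: min_def max_def split: if_splits)
    have vw: "v t = ?w t" if t: "t \<in> {?a..?b}" for t
    proof -
      let ?S = "{min 0 t..max 0 t}"
      have tJ: "t \<in> J0" using t ab_sub by blast
      have S: "?S \<subseteq> {?a..?b}" using t by auto
      have "ivp_solution g z0 ?S ?w"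
        unfolding ivp_solution_def using integral_solution_subset[OF w S] za
        by (auto simp: is_interval_cc ivp_solution_def)
      moreover have "locally_lipschitz_rhs g ?S"
        using S ab_sub by (intro locally_lipschitz_rhs_subset[OF lip]) blast
      moreover have "t \<in> ?S" by auto
      ultimately show ?thesis
        unfolding v_def by (intro ivp_solution_unique[of g ?S z0 ?w "zz t" t] zz[OF tJ])
    qed
    have "integral_solution g {?a..?b} v"
      by (rule integral_solution_cong[OF w]) (auto simp only: vw is_interval_cc)
    then show ?thesis by (rule integral_solution_subset) auto
  qed
  then have "integral_solution g J0 v" by (rule integral_solution_if_compact[OF J0(1)])
  moreover have "v 0 = z0" using *(1)[OF J0(2)] by (auto simp: v_def ivp_solution_def)
  ultimately show ?thesis using J0 unfolding ivp_solution_def by auto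
qed

lemma ivp_solution_singleton: "ivp_solution g z0 {0} (\<lambda>_. z0)"
  unfolding ivp_solution_def integral_solution_def interval_lebesgue_integrable_def
  by (auto simp: is_interval_1)

lemma zero_in_max_interval: "0 \<in> max_interval f x0"
  unfolding max_interval_def using ivp_solution_singleton by blast

lemma is_interval_max_interval: "is_interval (max_interval f x0)"
proof -
  have J: "{min 0 a..max 0 a} \<subseteq> max_interval f x0" if a: "a \<in> max_interval f x0" for a
  proof -
    obtain J z where J: "ivp_solution f x0 J z" "a \<in> J" using a unfolding max_interval_def by blast
    then have "{min 0 a..max 0 a} \<subseteq> J" by (intro is_interval_min_max_subset) (auto simp: ivp_solution_def)
    moreover have "J \<subseteq> max_interval f x0" using J(1) unfolding max_interval_def by blast
    ultimately show ?thesis by blast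
  qed
  show ?thesis
    unfolding is_interval_1
  proof (intro ballI allI impI)
    fix a b x assume "a \<in> max_interval f x0" "b \<in> max_interval f x0" "a \<le> x \<and> x \<le> b"
    then show "x \<in> max_interval f x0" using J[of a] J[of b] by (cases "x \<le> 0") auto
  qed
qed

text \<open>
  All solutions merge into one on the maximal interval, so the definite description defining \<open>x_sol\<close>
  denotes its values.
\<close>

lemma ivp_solution_x_sol:
  assumes lip: "locally_lipschitz_rhs f UNIV"
  shows "ivp_solution f x0 (max_interval f x0) (x_sol f x0)"
proof -
  have lip': "locally_lipschitz_rhs f (max_interval f x0)"
    by (rule locally_lipschitz_rhs_subset[OF lip]) simp
  obtain z where z: "ivp_solution f x0 (max_interval f x0) z"
  proof (rule exE[OF ivp_solution_Union[OF lip' is_interval_max_interval zero_in_max_interval]])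
    fix t assume "t \<in> max_interval f x0"
    then show "\<exists>J z. ivp_solution f x0 J z \<and> t \<in> J \<and> J \<subseteq> max_interval f x0"
      unfolding max_interval_def by blast
  qed
  show ?thesis
    by (rule ivp_solution_cong[OF z]) (simp add: x_sol_def ivp_solution_the[OF lip' z])
qed

lemma x_sol_eq:
  assumes lip: "locally_lipschitz_rhs f UNIV" and z: "ivp_solution f x0 J z"
  shows "J \<subseteq> max_interval f x0" and "t \<in> J \<Longrightarrow> x_sol f x0 t = z t"
proof -
  show sub: "J \<subseteq> max_interval f x0" using z unfolding max_interval_def by blast
  have "ivp_solution f x0 J (x_sol f x0)"
    by (rule ivp_solution_subset[OF ivp_solution_x_sol[OF lip] sub]) (use z in \<open>auto simp: ivp_solution_def\<close>)
  then show "x_sol f x0 t = z t" if "t \<in> J"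
    using ivp_solution_unique[OF locally_lipschitz_rhs_subset[OF lip] z _ that] by auto
qed

section \<open>Local integrability along curves\<close>

lemma le_one_plus_powr:
  fixes x p :: real
  assumes "1 \<le> p" "0 \<le> x"
  shows "x \<le> 1 + x powr p"
proof (cases "x \<le> 1")
  case False
  then have "x powr 1 \<le> x powr p" using assms by (intro powr_mono) auto
  then show ?thesis using False by simp
qed (use powr_ge_zero[of x p] in linarith)

lemma add_powr_le:
  fixes x y p :: real
  assumes "1 \<le> p" "0 \<le> x" "0 \<le> y"
  shows "(x + y) powr p \<le> 2 powr p * (x powr p + y powr p)"
proof -
  have "(x + y) powr p \<le> (2 * max x y) powr p" using assms by (intro powr_mono2) auto
  also have "\<dots> = 2 powr p * max x y powr p" using assms by (simp add: powr_mult)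
  also have "\<dots> \<le> 2 powr p * (x powr p + y powr p)" by (intro mult_left_mono) (auto simp: max_def)
  finally show ?thesis .
qed

lemma set_integrable_lebesgue_const: "set_integrable lebesgue {a..b::real} (\<lambda>_. c::real)"
proof -
  have "integrable lebesgue (\<lambda>x. indicator {a..b} x *\<^sub>R c)"
    by (intro integrable_scaleR_left) (auto intro!: integrable_real_indicator emeasure_lborel_Icc_eq[THEN ord_eq_less_trans] simp: emeasure_lborel_Icc_eq)
  then show ?thesis unfolding set_integrable_def .
qed

lemma Lp_loc_add:
  assumes p: "1 \<le> p" and m: "m \<in> Lp_loc p" and m': "m' \<in> Lp_loc p"
  shows "(\<lambda>t. \<bar>m t\<bar> + \<bar>m' t\<bar>) \<in> Lp_loc p"
  unfolding Lp_loc_def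
proof (intro CollectI allI conjI)
  fix a b :: real
  have [measurable]: "(\<lambda>x. indicator {a..b} x *\<^sub>R m x) \<in> borel_measurable lebesgue"
    "(\<lambda>x. indicator {a..b} x *\<^sub>R m' x) \<in> borel_measurable lebesgue"
    using m m' by (auto simp: Lp_loc_def set_borel_measurable_def)
  have "(\<lambda>x. \<bar>indicator {a..b} x *\<^sub>R m x\<bar> + \<bar>indicator {a..b} x *\<^sub>R m' x\<bar>) \<in> borel_measurable lebesgue"
    by measurable
  also have "(\<lambda>x. \<bar>indicator {a..b} x *\<^sub>R m x\<bar> + \<bar>indicator {a..b} x *\<^sub>R m' x\<bar>)
      = (\<lambda>x. indicator {a..b} x *\<^sub>R (\<bar>m x\<bar> + \<bar>m' x\<bar>))"
    by (auto simp: indicator_def)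
  finally show meas: "set_borel_measurable lebesgue {a..b} (\<lambda>t. \<bar>m t\<bar> + \<bar>m' t\<bar>)"
    unfolding set_borel_measurable_def .
  then have [measurable]: "(\<lambda>x. indicator {a..b} x *\<^sub>R (\<bar>m x\<bar> + \<bar>m' x\<bar>)) \<in> borel_measurable lebesgue"
    unfolding set_borel_measurable_def .
  have "(\<lambda>x. \<bar>indicator {a..b} x *\<^sub>R (\<bar>m x\<bar> + \<bar>m' x\<bar>)\<bar> powr p) \<in> borel_measurable lebesgue"
    by measurable
  also have "(\<lambda>x. \<bar>indicator {a..b} x *\<^sub>R (\<bar>m x\<bar> + \<bar>m' x\<bar>)\<bar> powr p)
     = (\<lambda>x. indicator {a..b} x *\<^sub>R (\<bar>\<bar>m x\<bar> + \<bar>m' x\<bar>\<bar> powr p))"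
    by (auto simp: indicator_def)
  finally have meas': "set_borel_measurable lebesgue {a..b} (\<lambda>t. \<bar>\<bar>m t\<bar> + \<bar>m' t\<bar>\<bar> powr p)"
    unfolding set_borel_measurable_def .
  show "set_integrable lebesgue {a..b} (\<lambda>t. \<bar>\<bar>m t\<bar> + \<bar>m' t\<bar>\<bar> powr p)"
  proof (rule set_integrable_bound[OF _ meas'])
    show "set_integrable lebesgue {a..b} (\<lambda>t. 2 powr p * (\<bar>m t\<bar> powr p + \<bar>m' t\<bar> powr p))"
      using m m' by (intro set_integrable_mult_right set_integral_add(1)) (auto simp: Lp_loc_def)
    show "AE x in lebesgue. x \<in> {a..b} \<longrightarrow> norm (\<bar>\<bar>m x\<bar> + \<bar>m' x\<bar>\<bar> powr p)
        \<le> norm (2 powr p * (\<bar>m x\<bar> powr p + \<bar>m' x\<bar> powr p))"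
      using add_powr_le[OF p, of "\<bar>m _\<bar>" "\<bar>m' _\<bar>"] by (auto simp: abs_mult)
  qed
qed

text \<open>
  The dominating function is merely Lebesgue measurable, so domination works for \<open>lebesgue\<close>. Since \<open>\<phi>\<close>
  itself is Borel measurable, its integrability passes from the completion back to \<open>lborel\<close>.
\<close>

lemma set_integrable_lborel_if_Lp_bound:
  fixes \<phi> :: "real \<Rightarrow> 'b::{banach, second_countable_topology}"
  assumes p: "1 \<le> p" and m: "m \<in> Lp_loc p" and \<phi>: "set_borel_measurable lborel {a..b} \<phi>"
    and bd: "AE t in lborel. t \<in> {a..b} \<longrightarrow> norm (\<phi> t) \<le> m t"
  shows "set_integrable lborel {a..b} \<phi>" and "set_integrable lborel {a..b} (\<lambda>t. norm (\<phi> t) powr p)"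
proof -
  have meas: "(\<lambda>x. indicator {a..b} x *\<^sub>R \<phi> x) \<in> borel_measurable lborel"
    using \<phi> unfolding set_borel_measurable_def .
  have [measurable]: "(\<lambda>x. norm (indicator {a..b} x *\<^sub>R \<phi> x)) \<in> borel_measurable lborel"
    by (rule measurable_compose[OF meas borel_measurable_norm])
  have "(\<lambda>x. norm (indicator {a..b} x *\<^sub>R \<phi> x) powr p) \<in> borel_measurable lborel"
    by measurable
  also have "(\<lambda>x. norm (indicator {a..b} x *\<^sub>R \<phi> x) powr p)
     = (\<lambda>x. indicator {a..b} x *\<^sub>R (norm (\<phi> x) powr p))"
    by (auto simp: indicator_def)
  finally have meas': "(\<lambda>x. indicator {a..b} x *\<^sub>R (norm (\<phi> x) powr p)) \<in> borel_measurable lborel" .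
  have bd': "AE t in lebesgue. t \<in> {a..b} \<longrightarrow> norm (\<phi> t) \<le> m t"
    by (rule AE_completion[OF bd])
  have mp: "set_integrable lebesgue {a..b} (\<lambda>t. \<bar>m t\<bar> powr p)" using m by (simp add: Lp_loc_def)
  have "set_integrable lebesgue {a..b} \<phi>"
  proof (rule set_integrable_bound)
    show "set_integrable lebesgue {a..b} (\<lambda>t. 1 + \<bar>m t\<bar> powr p)"
      by (intro set_integral_add(1) mp set_integrable_lebesgue_const)
    show "set_borel_measurable lebesgue {a..b} \<phi>"
      unfolding set_borel_measurable_def by (rule measurable_completion[OF meas])
    show "AE x in lebesgue. x \<in> {a..b} \<longrightarrow> norm (\<phi> x) \<le> norm (1 + \<bar>m x\<bar> powr p)"
      using bd'
    proof eventually_elim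
      case (elim x)
      show ?case using elim le_one_plus_powr[OF p, of "\<bar>m x\<bar>"] by auto
    qed
  qed
  then show "set_integrable lborel {a..b} \<phi>"
    unfolding set_integrable_def by (simp only: integrable_completion[OF meas])
  have "set_integrable lebesgue {a..b} (\<lambda>t. norm (\<phi> t) powr p)"
  proof (rule set_integrable_bound[OF mp])
    show "set_borel_measurable lebesgue {a..b} (\<lambda>t. norm (\<phi> t) powr p)"
      unfolding set_borel_measurable_def by (rule measurable_completion[OF meas'])
    show "AE x in lebesgue. x \<in> {a..b} \<longrightarrow> norm (norm (\<phi> x) powr p) \<le> norm (\<bar>m x\<bar> powr p)"
      using bd'
    proof eventually_elim
      case (elim x)
      show ?case
      proof
        assume "x \<in> {a..b}"
        then have "norm (\<phi> x) powr p \<le> \<bar>m x\<bar> powr p" using elim p by (intro powr_mono2) auto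
        then show "norm (norm (\<phi> x) powr p) \<le> norm (\<bar>m x\<bar> powr p)" by simp
      qed
    qed
  qed
  then show "set_integrable lborel {a..b} (\<lambda>t. norm (\<phi> t) powr p)"
    unfolding set_integrable_def by (simp only: integrable_completion[OF meas'])
qed

lemma C1_measurable_along_curve:
  fixes f :: "real \<Rightarrow> real^'n \<Rightarrow> 'b::euclidean_space"
  assumes f: "C1 f" and z: "continuous_on {a..b} z"
  shows "set_borel_measurable lborel {a..b} (\<lambda>t. f t (z t))"
proof (cases "a \<le> b")
  case True
  \<comment> \<open>Clamping the argument extends the curve to a continuous function on the whole line.\<close>
  define c where "c t = max a (min b t)" for t
  have "continuous_on UNIV c" unfolding c_def by (intro continuous_intros)
  then have "continuous_on UNIV (\<lambda>t. (t, z (c t)))"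
    by (intro continuous_intros continuous_on_compose2[OF z]) (use True in \<open>auto simp: c_def\<close>)
  then have "(\<lambda>t. (t, z (c t))) \<in> borel \<rightarrow>\<^sub>M borel" by (rule borel_measurable_continuous_onI)
  then have "(\<lambda>t. (\<lambda>(t, x). f t x) (t, z (c t))) \<in> borel \<rightarrow>\<^sub>M borel"
    using f unfolding C1_def by (rule measurable_compose)
  then have "(\<lambda>t. indicator {a..b} t *\<^sub>R f t (z (c t))) \<in> borel_measurable borel" by simp
  also have "(\<lambda>t. indicator {a..b} t *\<^sub>R f t (z (c t))) = (\<lambda>t. indicator {a..b} t *\<^sub>R f t (z t))"
    by (rule ext) (auto simp: indicator_def c_def max_def min_def)
  finally show ?thesis unfolding set_borel_measurable_def by simp
qed (simp add: set_borel_measurable_def)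

lemma integrable_along_curve:
  fixes f :: "real \<Rightarrow> real^'n \<Rightarrow> 'b::euclidean_space"
  assumes p: "1 \<le> p" and f: "C1 f" "C2 p f" and z: "continuous_on {a..b} z"
  shows "set_integrable lborel {a..b} (\<lambda>t. f t (z t))"
    and "set_integrable lborel {a..b} (\<lambda>t. norm (f t (z t)) powr p)"
proof -
  have "compact (z ` {a..b})" by (intro compact_continuous_image z compact_Icc)
  then obtain m where m: "m \<in> Lp_loc p" "AE t in lborel. \<forall>x\<in>z ` {a..b}. norm (f t x) \<le> m t"
    using f(2) unfolding C2_def by blast
  have "AE t in lborel. t \<in> {a..b} \<longrightarrow> norm (f t (z t)) \<le> m t"
    using m(2) by eventually_elim auto
  note * = set_integrable_lborel_if_Lp_bound[OF p m(1) C1_measurable_along_curve[OF f(1) z] this]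
  show "set_integrable lborel {a..b} (\<lambda>t. f t (z t))"
    "set_integrable lborel {a..b} (\<lambda>t. norm (f t (z t)) powr p)" by (fact *)+
qed

lemma C1_diff: "C1 f \<Longrightarrow> C1 g \<Longrightarrow> C1 (\<lambda>t x. f t x - g t x)"
  unfolding C1_def by (drule (1) borel_measurable_diff) (simp add: case_prod_unfold)

lemma C2_diff:
  fixes f g :: "real \<Rightarrow> real^'n \<Rightarrow> 'b::euclidean_space"
  assumes p: "1 \<le> p" and "C2 p f" "C2 p g"
  shows "C2 p (\<lambda>t x. f t x - g t x)"
  unfolding C2_def
proof (intro allI impI)
  fix K :: "(real^'n) set" assume "compact K"
  then obtain m m' where m: "m \<in> Lp_loc p" "AE t in lborel. \<forall>x\<in>K. norm (f t x) \<le> m t"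
    and m': "m' \<in> Lp_loc p" "AE t in lborel. \<forall>x\<in>K. norm (g t x) \<le> m' t"
    using assms(2,3) unfolding C2_def by blast
  have "AE t in lborel. \<forall>x\<in>K. norm (f t x - g t x) \<le> \<bar>m t\<bar> + \<bar>m' t\<bar>"
    using m(2) m'(2)
  proof eventually_elim
    case (elim t)
    show ?case
    proof
      fix x assume "x \<in> K"
      then show "norm (f t x - g t x) \<le> \<bar>m t\<bar> + \<bar>m' t\<bar>"
        using elim norm_triangle_ineq4[of "f t x" "g t x"] by fastforce
    qed
  qed
  then show "\<exists>m\<in>Lp_loc p. AE t in lborel. \<forall>x\<in>K. norm (f t x - g t x) \<le> m t"
    by (intro bexI[of _ "\<lambda>t. \<bar>m t\<bar> + \<bar>m' t\<bar>"] Lp_loc_add[OF p m(1) m'(1)])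
qed

section \<open>Integrable Lipschitz bounds\<close>

text \<open>
  The optimal \<open>l\<close>-bound is a supremum over uncountably many difference quotients. Restricting it to a
  countable dense set of pairs makes it Borel measurable; the result is still a Lipschitz constant for
  almost every \<open>t\<close>, because \<open>f t\<close> is then continuous on the ball, and it lies below the optimal
  bound as well as below a bound in \<open>Lp_loc p\<close>.
\<close>

lemma measurable_lipschitz_bound:
  fixes f :: "real \<Rightarrow> real^'n \<Rightarrow> 'b::euclidean_space"
  assumes f: "f \<in> LC p" and j: "1 \<le> j"
  obtains lam l where "lam \<in> borel_measurable borel" "\<And>t. 0 \<le> lam t" "l \<in> Lp_loc p"
    "AE t in lborel. \<forall>x\<in>cball 0 (real j). \<forall>y\<in>cball 0 (real j). norm (f t x - f t y) \<le> lam t * norm (x - y)"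
    "AE t in lborel. lam t \<le> l t" "AE t in lborel. lam t \<le> opt_l_bound f j t"
proof -
  let ?B = "{(x, y). x \<in> cball (0::real^'n) (real j) \<and> y \<in> cball 0 (real j) \<and> x \<noteq> y}"
  let ?q = "\<lambda>t (x, y). norm (f t x - f t y) / norm (x - y)"
  have "\<exists>l\<in>Lp_loc p. AE t in lborel. \<forall>x\<in>cball 0 (real j). \<forall>y\<in>cball 0 (real j).
      norm (f t x - f t y) \<le> l t * norm (x - y)"
    using f compact_cball[of "0::real^'n" "real j"] by (simp only: LC_def mem_Collect_eq)
  then obtain l where l: "l \<in> Lp_loc p"
    and lip: "AE t in lborel. \<forall>x\<in>cball 0 (real j). \<forall>y\<in>cball 0 (real j). norm (f t x - f t y) \<le> l t * norm (x - y)"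
    by (elim bexE)
  obtain T where T: "countable T" "T \<subseteq> ?B" "?B \<subseteq> closure T" by (rule separable[of ?B])
  have fm[measurable]: "(\<lambda>t. f t x) \<in> borel_measurable borel" for x
  proof -
    have tx: "(\<lambda>t. (t, x)) \<in> borel \<rightarrow>\<^sub>M borel" by (intro borel_measurable_continuous_onI continuous_intros)
    have "(\<lambda>(t, x). f t x) \<in> borel \<rightarrow>\<^sub>M borel" using f by (simp add: LC_def C1_def)
    from measurable_compose[OF tx this] show ?thesis by simp
  qed
  obtain i :: "real^'n" where i: "i \<in> Basis" using nonempty_Basis by blast
  then have B: "(i, 0) \<in> ?B" using j nonzero_Basis[OF i] by auto
  \<comment> \<open>The supremum is taken in \<open>ennreal\<close>, where it is measurable even if the quotients are unbounded at
    some \<open>t\<close>.\<close>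
  define lam where "lam t = enn2real (SUP xy\<in>T. ennreal (?q t xy))" for t
  have bdd: "bdd_above (?q t ` ?B)"
    if "\<forall>x\<in>cball 0 (real j). \<forall>y\<in>cball 0 (real j). norm (f t x - f t y) \<le> l t * norm (x - y)" for t
    by (rule bdd_aboveI2[where M = "l t"]) (use that in \<open>auto simp: divide_le_eq\<close>)
  have ubd: "lam t \<le> c" if "\<And>xy. xy \<in> ?B \<Longrightarrow> ?q t xy \<le> c" for t c
  proof -
    have "0 \<le> ?q t (i, 0)" by simp
    also have "\<dots> \<le> c" by (rule that[OF B])
    finally have "0 \<le> c" .
    moreover have "(SUP xy\<in>T. ennreal (?q t xy)) \<le> ennreal c"
    proof (rule SUP_least)
      fix xy assume "xy \<in> T"
      then show "ennreal (?q t xy) \<le> ennreal c" using T(2) that by (intro ennreal_leI) blast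
    qed
    ultimately show ?thesis unfolding lam_def using enn2real_leI by blast
  qed
  show thesis
  proof (rule that[of lam l])
    have "(\<lambda>t. ennreal (?q t xy)) \<in> borel_measurable borel" for xy
      by (cases xy) simp
    then have "(\<lambda>t. SUP xy\<in>T. ennreal (?q t xy)) \<in> borel_measurable borel"
      by (intro borel_measurable_SUP T(1))
    then show "lam \<in> borel_measurable borel" unfolding lam_def[abs_def] by measurable
    show "0 \<le> lam t" for t by (simp add: lam_def)
    show "l \<in> Lp_loc p" by fact
    show "AE t in lborel. lam t \<le> l t"
      using lip
    proof eventually_elim
      case (elim t)
      show ?case by (rule ubd) (use elim in \<open>auto simp: divide_le_eq\<close>)
    qed
    show "AE t in lborel. lam t \<le> opt_l_bound f j t"
      using lip
    proof eventually_elim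
      case (elim t)
      show ?case
      proof (rule ubd)
        fix xy assume "xy \<in> ?B"
        then show "?q t xy \<le> opt_l_bound f j t"
          unfolding opt_l_bound_def by (rule cSUP_upper[OF _ bdd[OF elim]])
      qed
    qed
    show "AE t in lborel. \<forall>x\<in>cball 0 (real j). \<forall>y\<in>cball 0 (real j). norm (f t x - f t y) \<le> lam t * norm (x - y)"
      using lip
    proof eventually_elim
      case (elim t)
      have "(SUP xy\<in>T. ennreal (?q t xy)) \<le> ennreal (l t)"
        by (rule SUP_least) (use elim T(2) in \<open>auto intro!: ennreal_leI simp: divide_le_eq\<close>)
      then have fin: "(SUP xy\<in>T. ennreal (?q t xy)) < \<infinity>" by (simp add: le_less_trans)
      have onT: "norm (f t x - f t y) \<le> lam t * norm (x - y)" if "(x, y) \<in> T" for x y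
      proof -
        have "ennreal (?q t (x, y)) \<le> (SUP xy\<in>T. ennreal (?q t xy))" by (rule SUP_upper[OF that])
        also have "\<dots> = ennreal (lam t)" unfolding lam_def using fin by simp
        finally have "?q t (x, y) \<le> lam t" by (subst (asm) ennreal_le_iff) (auto simp: lam_def)
        moreover have "x \<noteq> y" using that T(2) by auto
        ultimately show ?thesis by (simp add: divide_le_eq)
      qed
      have "(l t)-lipschitz_on (cball 0 (real j)) (f t) \<or> l t < 0"
        using elim by (auto simp: lipschitz_on_def dist_norm)
      moreover have "\<not> l t < 0"
      proof
        assume neg: "l t < 0"
        have "norm (f t i - f t 0) \<le> l t * norm (i - 0)"
          using elim[rule_format, of i 0] B by auto
        also have "\<dots> < 0" using neg i by (simp add: mult_neg_pos)
        finally show False by simp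
      qed
      ultimately have cont: "continuous_on (cball 0 (real j)) (f t)"
        using lipschitz_on_continuous_on by blast
      show ?case
      proof (intro ballI)
        fix x y :: "real^'n" assume x: "x \<in> cball 0 (real j)" and y: "y \<in> cball 0 (real j)"
        show "norm (f t x - f t y) \<le> lam t * norm (x - y)"
        proof (cases "x = y")
          case False
          then have "(x, y) \<in> closure T" using T(3) x y by auto
          then obtain s where s: "\<And>n. s n \<in> T" "s \<longlonglongrightarrow> (x, y)" unfolding closure_sequential by blast
          have sx: "(\<lambda>n. fst (s n)) \<longlonglongrightarrow> x" and sy: "(\<lambda>n. snd (s n)) \<longlonglongrightarrow> y"
            using tendsto_fst[OF s(2)] tendsto_snd[OF s(2)] by auto
          have sB: "fst (s n) \<in> cball 0 (real j)" "snd (s n) \<in> cball 0 (real j)" for n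
            using s(1)[of n] T(2) by auto
          have "(\<lambda>n. f t (fst (s n))) \<longlonglongrightarrow> f t x" "(\<lambda>n. f t (snd (s n))) \<longlonglongrightarrow> f t y"
            by (rule continuous_on_tendsto_compose[OF cont]; use sx sy sB x y in auto)+
          then have "(\<lambda>n. norm (f t (fst (s n)) - f t (snd (s n)))) \<longlonglongrightarrow> norm (f t x - f t y)"
            by (intro tendsto_intros)
          moreover have "(\<lambda>n. lam t * norm (fst (s n) - snd (s n))) \<longlonglongrightarrow> lam t * norm (x - y)"
            by (intro tendsto_intros sx sy)
          ultimately show ?thesis
            by (rule LIMSEQ_le) (use onT s(1) in auto)
        qed simp
      qed
    qed
  qed
qed

lemma set_integrable_const_Icc: "set_integrable lborel {a..b::real} (\<lambda>_. c::real)"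
  by (intro borel_integrable_atLeastAtMost' continuous_intros)

text \<open>
  Integrability to the first power is what the Gronwall estimate consumes.
\<close>

definition lipschitz_kernel ::
  "(real \<Rightarrow> real^'n \<Rightarrow> 'b::euclidean_space) \<Rightarrow> nat \<Rightarrow> (real \<Rightarrow> real) \<Rightarrow> bool" where
  "lipschitz_kernel f j lam \<longleftrightarrow> (\<forall>t. 0 \<le> lam t) \<and> (\<forall>a b. set_integrable lborel {a..b} lam) \<and>
     (AE t in lborel. \<forall>x\<in>cball 0 (real j). \<forall>y\<in>cball 0 (real j).
       norm (f t x - f t y) \<le> lam t * norm (x - y))"

lemma lipschitz_kernelD:
  assumes "lipschitz_kernel f j lam"
  shows "0 \<le> lam t" "set_integrable lborel {a..b} lam"
    "AE t in lborel. \<forall>x\<in>cball 0 (real j). \<forall>y\<in>cball 0 (real j). norm (f t x - f t y) \<le> lam t * norm (x - y)"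
  using assms by (simp_all only: lipschitz_kernel_def)

lemma lipschitz_kernel_exists:
  fixes f :: "real \<Rightarrow> real^'n \<Rightarrow> 'b::euclidean_space"
  assumes p: "1 \<le> p" and f: "f \<in> LC p" and j: "1 \<le> j"
  shows "\<exists>lam. lipschitz_kernel f j lam \<and> (\<forall>a b. set_integrable lborel {a..b} (\<lambda>t. lam t powr p)) \<and>
    (AE t in lborel. lam t \<le> opt_l_bound f j t)"
proof (rule measurable_lipschitz_bound[OF f j])
  fix lam l :: "real \<Rightarrow> real"
  assume lam: "lam \<in> borel_measurable borel" "\<And>t. 0 \<le> lam t" and l: "l \<in> Lp_loc p" "AE t in lborel. lam t \<le> l t"
    and lip: "AE t in lborel. \<forall>x\<in>cball 0 (real j). \<forall>y\<in>cball 0 (real j). norm (f t x - f t y) \<le> lam t * norm (x - y)"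
    and opt: "AE t in lborel. lam t \<le> opt_l_bound f j t"
  have m: "set_borel_measurable lborel {a..b} lam" for a b
    unfolding set_borel_measurable_def using lam(1) by simp
  have bd: "AE t in lborel. t \<in> {a..b} \<longrightarrow> norm (lam t) \<le> l t" for a b
    using l(2) by eventually_elim (use lam(2) in auto)
  note I = set_integrable_lborel_if_Lp_bound[OF p l(1) m bd]
  have "lipschitz_kernel f j lam"
    unfolding lipschitz_kernel_def by (intro conjI allI lam(2) I(1) lip)
  moreover have "set_integrable lborel {a..b} (\<lambda>t. lam t powr p)" for a b
    using I(2)[of a b] lam(2) by simp
  ultimately show ?thesis by (intro exI[of _ lam] conjI allI opt)
qed

lemma locally_lipschitz_LC:
  fixes f :: "real \<Rightarrow> real^'n \<Rightarrow> real^'n"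
  assumes p: "1 \<le> p" and f: "f \<in> LC p"
  shows "locally_lipschitz_rhs f UNIV"
  unfolding locally_lipschitz_rhs_def
proof (intro allI impI)
  fix a b R :: real
  define j where "j = max 1 (nat \<lceil>R\<rceil>)"
  have j: "1 \<le> j" "R \<le> real j" by (auto simp: j_def le_max_iff_disj) linarith+
  obtain lam where lam: "lipschitz_kernel f j lam"
    using lipschitz_kernel_exists[OF p f j(1)] by (elim exE conjE)
  have sub: "cball 0 R \<subseteq> cball (0::real^'n) (real j)" using j(2) by auto
  have "AE u in lborel. u \<in> {a..b} \<longrightarrow>
      (\<forall>x\<in>cball 0 R. \<forall>y\<in>cball 0 R. norm (f u x - f u y) \<le> lam u * norm (x - y))"
    using lipschitz_kernelD(3)[OF lam]
  proof eventually_elim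
    case (elim u)
    show ?case using elim sub by (intro impI ballI) (meson subsetD)
  qed
  then show "\<exists>l. set_integrable lborel {a..b} l \<and> (\<forall>u. 0 \<le> l u) \<and>
       (AE u in lborel. u \<in> {a..b} \<longrightarrow>
         (\<forall>x\<in>cball 0 R. \<forall>y\<in>cball 0 R. norm (f u x - f u y) \<le> l u * norm (x - y)))"
    by (intro exI[of _ lam] conjI allI lipschitz_kernelD[OF lam])
qed

text \<open>
  The inequality \<open>x \<le> 1 + x powr p\<close> turns the uniform \<open>L\<^sup>p\<close> bound on \<open>[-r, r]\<close> into a uniform \<open>L\<^sup>1\<close>
  bound.
\<close>

lemma uniform_lipschitz_bound:
  fixes E :: "(real \<Rightarrow> real^'n \<Rightarrow> 'b::euclidean_space) set"
  assumes p: "1 \<le> p" and E: "E \<subseteq> LC p" "Lp_loc_bounded_l_bounds p E" and j: "1 \<le> j"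
  shows "\<exists>L\<ge>0. \<forall>f\<in>E. \<exists>lam. lipschitz_kernel f j lam \<and> (LINT t:{a..b}|lborel. lam t) \<le> L"
proof -
  define r where "r = 1 + max \<bar>a\<bar> \<bar>b\<bar>"
  have r: "0 < r" "{a..b} \<subseteq> {-r..r}" by (auto simp: r_def)
  define S where "S = (SUP f\<in>E. \<integral>\<^sup>+ t\<in>{-r..r}. ennreal (opt_l_bound f j t powr p) \<partial>lborel)"
  have S: "S < \<infinity>" using E(2)[unfolded Lp_loc_bounded_l_bounds_def, rule_format, OF j r(1)] unfolding S_def .
  show ?thesis
  proof (intro exI[of _ "2 * r + enn2real S"] conjI ballI)
    show "0 \<le> 2 * r + enn2real S" using r by simp
    fix f assume f: "f \<in> E"
    then have fL: "f \<in> LC p" using E by auto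
    obtain lam where ker: "lipschitz_kernel f j lam"
      and pint: "\<forall>a b. set_integrable lborel {a..b} (\<lambda>t. lam t powr p)"
      and opt: "AE t in lborel. lam t \<le> opt_l_bound f j t"
      using lipschitz_kernel_exists[OF p fL j] by (elim exE conjE)
    note lam = lipschitz_kernelD(1,2)[OF ker] pint[rule_format]
    have "ennreal (LINT t:{-r..r}|lborel. lam t powr p) = (\<integral>\<^sup>+ t. ennreal (indicator {-r..r} t *\<^sub>R (lam t powr p)) \<partial>lborel)"
      unfolding set_lebesgue_integral_def
      by (rule nn_integral_eq_integral[symmetric]) (use lam(3) in \<open>auto simp: set_integrable_def\<close>)
    also have "\<dots> \<le> (\<integral>\<^sup>+ t\<in>{-r..r}. ennreal (opt_l_bound f j t powr p) \<partial>lborel)"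
    proof (rule nn_integral_mono_AE)
      show "AE t in lborel. ennreal (indicator {-r..r} t *\<^sub>R (lam t powr p))
          \<le> ennreal (opt_l_bound f j t powr p) * indicator {-r..r} t"
        using opt
      proof eventually_elim
        case (elim t)
        then have "lam t powr p \<le> opt_l_bound f j t powr p"
          using lam(1) p by (intro powr_mono2) auto
        then show ?case by (auto simp: indicator_def intro!: ennreal_leI)
      qed
    qed
    also have "\<dots> \<le> S" unfolding S_def by (rule SUP_upper[OF f])
    finally have "ennreal (LINT t:{-r..r}|lborel. lam t powr p) \<le> S" .
    then have le: "(LINT t:{-r..r}|lborel. lam t powr p) \<le> enn2real S"
      using S by (metis enn2real_mono enn2real_ennreal infinity_ennreal_def powr_ge_zero set_integral_nonneg_on)
    have "(LINT t:{a..b}|lborel. lam t) \<le> (LINT t:{-r..r}|lborel. lam t)"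
      by (rule set_integral_mono_set[OF lam(2) _ r(2)]) (use lam(1) in auto)
    also have "\<dots> \<le> (LINT t:{-r..r}|lborel. 1 + lam t powr p)"
      by (rule set_integral_mono) (use lam le_one_plus_powr[OF p] in \<open>auto intro!: set_integral_add(1) set_integrable_const_Icc\<close>)
    also have "\<dots> = 2 * r + (LINT t:{-r..r}|lborel. lam t powr p)"
      using lam(3) r(1) by (subst set_integral_add(2)) (auto simp: set_integral_const set_integrable_const_Icc)
    also have "\<dots> \<le> 2 * r + enn2real S" using le by simp
    finally have "(LINT t:{a..b}|lborel. lam t) \<le> 2 * r + enn2real S" .
    then show "\<exists>lam. lipschitz_kernel f j lam \<and> (LINT t:{a..b}|lborel. lam t) \<le> 2 * r + enn2real S"
      by (intro exI[of _ lam] conjI ker)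
  qed
qed

section \<open>The seminorm topologies\<close>

lemma openin_seminorm_ball:
  assumes "f \<in> X" "q \<in> P" "0 < e"
  shows "openin (seminorm_topology X P) {g \<in> X. q (\<lambda>t x. g t x - f t x) < e}"
  unfolding seminorm_topology_def by (rule topology_generated_by_Basis) (use assms in blast)

lemma topspace_seminorm_subset: "topspace (seminorm_topology X P) \<subseteq> X"
  unfolding seminorm_topology_def topology_generated_by_topspace by blast

text \<open>
  The conclusion is an upper bound rather than convergence to \<open>0\<close>: for the functionals generating
  \<open>\<T>\<^sub>\<Theta>\<close>, a real supremum over an unbounded set could have any sign.
\<close>

lemma limitin_seminorm:
  assumes lim: "limitin (seminorm_topology X P) fs f sequentially"
  shows "f \<in> X"
    and "q \<in> P \<Longrightarrow> q (\<lambda>t x. 0) = 0 \<Longrightarrow> 0 < e \<Longrightarrow>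
      \<forall>\<^sub>F n in sequentially. q (\<lambda>t x. fs n t x - f t x) < e"
proof -
  show f: "f \<in> X" using limitin_topspace[OF lim] topspace_seminorm_subset by blast
  assume q: "q \<in> P" and q0: "q (\<lambda>t x. 0) = 0" and e: "0 < e"
  have "f \<in> {g \<in> X. q (\<lambda>t x. g t x - f t x) < e}" using f q0 e by simp
  with openin_seminorm_ball[where P = P and q = q, OF f q e]
  have "\<forall>\<^sub>F n in sequentially. fs n \<in> {g \<in> X. q (\<lambda>t x. g t x - f t x) < e}"
    by (intro conjunct2[OF lim[unfolded limitin_def], rule_format] conjI)
  then show "\<forall>\<^sub>F n in sequentially. q (\<lambda>t x. fs n t x - f t x) < e" by eventually_elim simp
qed

lemma compactin_seminorm_net:
  assumes C: "compactin (seminorm_topology X P) C" and q: "q \<in> P" "q (\<lambda>t x. 0) = 0" and e: "0 < e"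
  shows "\<exists>G. finite G \<and> G \<subseteq> C \<and> (\<forall>f\<in>C. \<exists>g\<in>G. q (\<lambda>t x. f t x - g t x) < e)"
proof -
  have CX: "C \<subseteq> X" using compactin_subset_topspace[OF C] topspace_seminorm_subset by blast
  let ?U = "\<lambda>g. {f \<in> X. q (\<lambda>t x. f t x - g t x) < e}"
  have "\<exists>\<F>. finite \<F> \<and> \<F> \<subseteq> ?U ` C \<and> C \<subseteq> \<Union>\<F>"
  proof (rule compactinD[OF C])
    show "openin (seminorm_topology X P) U" if "U \<in> ?U ` C" for U
      using that openin_seminorm_ball[OF _ q(1) e] CX by blast
    show "C \<subseteq> \<Union> (?U ` C)" using CX q(2) e by auto
  qed
  then obtain \<F> where F: "finite \<F>" "\<F> \<subseteq> ?U ` C" "C \<subseteq> \<Union>\<F>" by (elim exE conjE)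
  obtain G where "G \<subseteq> C" "finite G" "\<F> = ?U ` G"
    using finite_subset_image[OF F(1,2)] by (elim exE conjE)
  with F(3) have G: "finite G" "G \<subseteq> C" "C \<subseteq> \<Union> (?U ` G)" by simp_all
  show ?thesis
  proof (intro exI[of _ G] conjI G(1,2) ballI)
    fix f assume "f \<in> C"
    then show "\<exists>g\<in>G. q (\<lambda>t x. f t x - g t x) < e" using G(3) by auto
  qed
qed

section \<open>From \<open>L\<^sup>p\<close> to \<open>L\<^sup>1\<close> on compact intervals\<close>

text \<open>
  A replacement for Hoelder's inequality on a bounded interval: where \<open>norm (\<phi> t)\<close> exceeds \<open>\<delta>\<close>, it is at
  most \<open>\<delta> powr (1 - p) * norm (\<phi> t) powr p\<close>.
\<close>

lemma set_integral_norm_le_Lp: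
  fixes \<phi> :: "real \<Rightarrow> 'b::{banach, second_countable_topology}"
  assumes p: "1 \<le> p" and d: "0 < \<delta>" and "a \<le> b"
    and i: "set_integrable lborel {a..b} \<phi>" "set_integrable lborel {a..b} (\<lambda>t. norm (\<phi> t) powr p)"
  shows "(LINT t:{a..b}|lborel. norm (\<phi> t)) \<le> \<delta> * (b - a) + \<delta> powr (1 - p) * (LINT t:{a..b}|lborel. norm (\<phi> t) powr p)"
proof -
  have le: "x \<le> \<delta> + \<delta> powr (1 - p) * x powr p" if "0 \<le> x" for x
  proof (cases "x \<le> \<delta>")
    case True
    moreover have "0 \<le> \<delta> powr (1 - p) * x powr p" by simp
    ultimately show ?thesis by linarith
  next
    case False
    have "x = x powr (1 - p) * x powr p" using False d by (simp flip: powr_add)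
    also have "\<dots> \<le> \<delta> powr (1 - p) * x powr p"
      using False d p by (intro mult_right_mono powr_mono2') auto
    finally show ?thesis using d by linarith
  qed
  have "(LINT t:{a..b}|lborel. norm (\<phi> t)) \<le> (LINT t:{a..b}|lborel. \<delta> + \<delta> powr (1 - p) * norm (\<phi> t) powr p)"
    by (rule set_integral_mono) (use i le in \<open>auto intro!: set_integral_add(1) set_integrable_norm set_integrable_const_Icc\<close>)
  also have "\<dots> = \<delta> * (b - a) + \<delta> powr (1 - p) * (LINT t:{a..b}|lborel. norm (\<phi> t) powr p)"
    using i(2) \<open>a \<le> b\<close> by (subst set_integral_add(2)) (auto simp: set_integral_const set_integrable_const_Icc)
  finally show ?thesis .
qed

lemma Lp_bound_imp_L1_bound:
  assumes "1 \<le> p" "a \<le> b" "0 < e"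
  obtains \<eta> where "0 < \<eta>" "\<And>\<phi> :: real \<Rightarrow> 'b::{banach, second_countable_topology}.
    set_integrable lborel {a..b} \<phi> \<Longrightarrow> set_integrable lborel {a..b} (\<lambda>t. norm (\<phi> t) powr p) \<Longrightarrow>
    (LINT t:{a..b}|lborel. norm (\<phi> t) powr p) < \<eta> \<Longrightarrow> (LINT t:{a..b}|lborel. norm (\<phi> t)) < e"
proof -
  define \<delta> where "\<delta> = e / (2 * (b - a + 1))"
  have d: "0 < \<delta>" using assms by (auto simp: \<delta>_def)
  have half: "\<delta> * (b - a) \<le> e / 2" using assms by (simp add: \<delta>_def field_simps)
  show ?thesis
  proof (rule that[of "e / 2 / \<delta> powr (1 - p)"])
    show "0 < e / 2 / \<delta> powr (1 - p)" using d assms(3) by simp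
    fix \<phi> :: "real \<Rightarrow> 'b"
    assume i: "set_integrable lborel {a..b} \<phi>" "set_integrable lborel {a..b} (\<lambda>t. norm (\<phi> t) powr p)"
      and "(LINT t:{a..b}|lborel. norm (\<phi> t) powr p) < e / 2 / \<delta> powr (1 - p)"
    then have "\<delta> powr (1 - p) * (LINT t:{a..b}|lborel. norm (\<phi> t) powr p) < e / 2"
      using d by (simp add: pos_less_divide_eq mult.commute)
    then show "(LINT t:{a..b}|lborel. norm (\<phi> t)) < e"
      using set_integral_norm_le_Lp[OF assms(1) d assms(2) i] half by argo
  qed
qed

lemma Lp_tendsto_imp_L1_tendsto:
  fixes \<phi> :: "nat \<Rightarrow> real \<Rightarrow> 'b::{banach, second_countable_topology}"
  assumes p: "1 \<le> p" "a \<le> b"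
    and i: "\<And>n. set_integrable lborel {a..b} (\<phi> n)" "\<And>n. set_integrable lborel {a..b} (\<lambda>t. norm (\<phi> n t) powr p)"
    and lim: "(\<lambda>n. LINT t:{a..b}|lborel. norm (\<phi> n t) powr p) \<longlonglongrightarrow> 0"
  shows "(\<lambda>n. LINT t:{a..b}|lborel. norm (\<phi> n t)) \<longlonglongrightarrow> 0"
proof (rule order_tendstoI)
  fix e :: real assume "0 < e"
  then obtain \<eta> where \<eta>: "0 < \<eta>" "\<And>\<phi> :: real \<Rightarrow> 'b.
    set_integrable lborel {a..b} \<phi> \<Longrightarrow> set_integrable lborel {a..b} (\<lambda>t. norm (\<phi> t) powr p) \<Longrightarrow>
    (LINT t:{a..b}|lborel. norm (\<phi> t) powr p) < \<eta> \<Longrightarrow> (LINT t:{a..b}|lborel. norm (\<phi> t)) < e"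
    using Lp_bound_imp_L1_bound[OF p] by metis
  show "\<forall>\<^sub>F n in sequentially. (LINT t:{a..b}|lborel. norm (\<phi> n t)) < e"
    using order_tendstoD(2)[OF lim \<eta>(1)] by eventually_elim (intro \<eta>(2) i)
next
  fix e :: real assume "e < 0"
  then show "\<forall>\<^sub>F n in sequentially. e < (LINT t:{a..b}|lborel. norm (\<phi> n t))"
    by (intro always_eventually allI) (rule less_le_trans[OF _ set_integral_nonneg_on], auto)
qed

lemma rat_interval_superset:
  assumes "a \<le> b"
  obtains q1 q2 :: real where "{q1..q2} \<in> rat_intervals" "q1 \<le> a" "b \<le> q2" "q1 \<le> q2"
proof -
  obtain q1 where "q1 \<in> \<rat>" "a - 1 < q1" "q1 < a" using Rats_dense_in_real[of "a - 1" a] by auto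
  moreover obtain q2 where "q2 \<in> \<rat>" "b < q2" "q2 < b + 1" using Rats_dense_in_real[of b "b + 1"] by auto
  ultimately show ?thesis using assms by (intro that[of q1 q2]) (auto simp: rat_intervals_def)
qed

lemma powr_inverse_tendsto_zeroD:
  fixes a :: "nat \<Rightarrow> real"
  assumes "(\<lambda>n. a n powr (1 / p)) \<longlonglongrightarrow> 0" "\<And>n. 0 \<le> a n" "1 \<le> p"
  shows "a \<longlonglongrightarrow> 0"
proof -
  have "(\<lambda>n. (a n powr (1 / p)) powr p) \<longlonglongrightarrow> 0 powr p"
    using assms(3) by (intro tendsto_powr' assms(1) tendsto_const) auto
  then show ?thesis using assms(2,3) by (simp add: powr_powr)
qed

section \<open>Convergence along curves\<close>

lemma LC_D:
  assumes "f \<in> LC p" shows "C1 f" "C2 p f"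
  using assms by (simp_all add: LC_def)

lemma topology_D_tendsto_L1:
  fixes fs :: "nat \<Rightarrow> real \<Rightarrow> real^'n \<Rightarrow> 'b::euclidean_space"
  assumes p: "1 \<le> p" and fs: "\<And>n. fs n \<in> LC p" and lim: "limitin (topology_D p D) fs f sequentially"
    and d: "d \<in> D" and ab: "a \<le> b"
  shows "(\<lambda>n. LINT t:{a..b}|lborel. norm (fs n t d - f t d)) \<longlonglongrightarrow> 0"
proof -
  obtain q1 q2 where q: "{q1..q2} \<in> rat_intervals" "q1 \<le> a" "b \<le> q2" "q1 \<le> q2"
    by (rule rat_interval_superset[OF ab])
  note lim' = limitin_seminorm[OF lim[unfolded topology_D_def]]
  have f: "f \<in> LC p" by (rule lim'(1))
  have I: "set_integrable lborel {q1..q2} (\<lambda>t. fs n t d - f t d)"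
    "set_integrable lborel {q1..q2} (\<lambda>t. norm (fs n t d - f t d) powr p)" for n
    using integrable_along_curve[OF p C1_diff C2_diff[OF p], of "fs n" f q1 q2 "\<lambda>_. d"] LC_D[OF fs] LC_D[OF f]
    by auto
  have "(\<lambda>n. (LINT t:{q1..q2}|lborel. norm (fs n t d - f t d) powr p) powr (1 / p)) \<longlonglongrightarrow> 0"
  proof (rule order_tendstoI)
    fix e :: real assume "e < 0"
    then show "\<forall>\<^sub>F n in sequentially. e < (LINT t:{q1..q2}|lborel. norm (fs n t d - f t d) powr p) powr (1 / p)"
      by (intro always_eventually allI) (rule less_le_trans, assumption, simp)
  next
    fix e :: real assume e: "0 < e"
    show "\<forall>\<^sub>F n in sequentially. (LINT t:{q1..q2}|lborel. norm (fs n t d - f t d) powr p) powr (1 / p) < e"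
      by (rule lim'(2)[where q = "\<lambda>f. (LINT t:{q1..q2}|lborel. norm (f t d) powr p) powr (1 / p)", OF _ _ e])
        (use d q(1) in auto)
  qed
  then have "(\<lambda>n. LINT t:{q1..q2}|lborel. norm (fs n t d - f t d) powr p) \<longlonglongrightarrow> 0"
    by (rule powr_inverse_tendsto_zeroD[OF _ _ p]) (rule set_integral_nonneg_on, simp)
  then have "(\<lambda>n. LINT t:{q1..q2}|lborel. norm (fs n t d - f t d)) \<longlonglongrightarrow> 0"
    by (intro Lp_tendsto_imp_L1_tendsto[OF p q(4) I])
  then show ?thesis
  proof (rule tendsto_sandwich[OF _ _ tendsto_const, rotated 2])
    show "\<forall>\<^sub>F n in sequentially. 0 \<le> (LINT t:{a..b}|lborel. norm (fs n t d - f t d))"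
      by (intro always_eventually allI set_integral_nonneg_on) simp
    show "\<forall>\<^sub>F n in sequentially. (LINT t:{a..b}|lborel. norm (fs n t d - f t d))
        \<le> (LINT t:{q1..q2}|lborel. norm (fs n t d - f t d))"
      using q by (intro always_eventually allI set_integral_mono_set set_integrable_norm I) auto
  qed
qed

text \<open>
  The net is taken from the ball of radius \<open>j + 1\<close>, so that any point of \<open>D\<close> close to \<open>y\<close> may
  serve.
\<close>

lemma dense_finite_net:
  fixes D :: "(real^'n) set"
  assumes D: "closure D = UNIV" and e: "0 < e" "e \<le> 1"
  shows "\<exists>F. finite F \<and> F \<subseteq> D \<and> F \<subseteq> cball 0 (real (Suc j)) \<and> (\<forall>y\<in>cball 0 (real j). \<exists>d\<in>F. norm (y - d) \<le> e)"
proof -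
  let ?D = "D \<inter> cball 0 (real (Suc j))"
  have cov: "cball 0 (real j) \<subseteq> (\<Union>d\<in>?D. ball d e)"
  proof
    fix y :: "real^'n" assume y: "y \<in> cball 0 (real j)"
    have "y \<in> closure D" by (simp add: D)
    then obtain d where d: "d \<in> D" "dist d y < e" using e(1) unfolding closure_approachable by blast
    have "norm d \<le> norm y + dist d y" using norm_triangle_sub[of d y] by (simp add: dist_norm)
    then have "d \<in> cball 0 (real (Suc j))" using y d(2) e(2) by auto
    then show "y \<in> (\<Union>d\<in>?D. ball d e)" using d by auto
  qed
  obtain F where F: "F \<subseteq> ?D" "finite F" "cball 0 (real j) \<subseteq> (\<Union>d\<in>F. ball d e)"
    by (rule compactE_image[OF compact_cball _ cov]) auto
  show ?thesis
  proof (intro exI[of _ F] conjI ballI)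
    fix y :: "real^'n" assume "y \<in> cball 0 (real j)"
    then obtain d where "d \<in> F" "y \<in> ball d e" using F(3) by blast
    then show "\<exists>d\<in>F. norm (y - d) \<le> e" by (intro bexI[of _ d]) (auto simp: dist_norm norm_minus_commute)
  qed (use F in auto)
qed

lemma lipschitz_kernel_diff:
  fixes f g :: "real \<Rightarrow> real^'n \<Rightarrow> 'b::euclidean_space"
  assumes f: "lipschitz_kernel f j l" and g: "lipschitz_kernel g j m"
  shows "lipschitz_kernel (\<lambda>t x. f t x - g t x) j (\<lambda>t. l t + m t)"
  unfolding lipschitz_kernel_def
proof (intro conjI allI)
  show "0 \<le> l t + m t" for t using lipschitz_kernelD(1)[OF f] lipschitz_kernelD(1)[OF g] by simp
  show "set_integrable lborel {a..b} (\<lambda>t. l t + m t)" for a b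
    using lipschitz_kernelD(2)[OF f] lipschitz_kernelD(2)[OF g] by (rule set_integral_add(1))
  show "AE t in lborel. \<forall>x\<in>cball 0 (real j). \<forall>y\<in>cball 0 (real j).
      norm (f t x - g t x - (f t y - g t y)) \<le> (l t + m t) * norm (x - y)"
    using lipschitz_kernelD(3)[OF f] lipschitz_kernelD(3)[OF g]
  proof eventually_elim
    case (elim t)
    show ?case
    proof (intro ballI)
      fix x y :: "real^'n" assume xy: "x \<in> cball 0 (real j)" "y \<in> cball 0 (real j)"
      have "norm (f t x - g t x - (f t y - g t y)) = norm ((f t x - f t y) - (g t x - g t y))"
        by (simp add: algebra_simps)
      also have "\<dots> \<le> norm (f t x - f t y) + norm (g t x - g t y)" by (rule norm_triangle_ineq4)
      also have "\<dots> \<le> l t * norm (x - y) + m t * norm (x - y)"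
        using elim(1)[rule_format, OF xy] elim(2)[rule_format, OF xy] by (rule add_mono)
      finally show "norm (f t x - g t x - (f t y - g t y)) \<le> (l t + m t) * norm (x - y)"
        by (simp add: distrib_right)
    qed
  qed
qed

text \<open>
  The passage from points of \<open>D\<close> to curves: at each time the curve is within \<open>e\<close> of some point of the
  net, and the value there is bounded by the sum over the whole net. The bound is
  the same for all curves in the ball.
\<close>

lemma integral_along_curve_le_net:
  fixes h :: "real \<Rightarrow> real^'n \<Rightarrow> 'b::euclidean_space"
  assumes p: "1 \<le> p" and h: "C1 h" "C2 p h" and ker: "lipschitz_kernel h (Suc j) lam"
    and F: "finite F" "F \<subseteq> cball 0 (real (Suc j))" "\<forall>y\<in>cball 0 (real j). \<exists>d\<in>F. norm (y - d) \<le> e"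
    and z: "continuous_on {a..b} z" "z ` {a..b} \<subseteq> cball 0 (real j)"
  shows "(LINT t:{a..b}|lborel. norm (h t (z t)))
    \<le> (\<Sum>d\<in>F. LINT t:{a..b}|lborel. norm (h t d)) + e * (LINT t:{a..b}|lborel. lam t)"
proof -
  note hz = integrable_along_curve(1)[OF p h z(1)]
  have hd: "set_integrable lborel {a..b} (\<lambda>t. norm (h t d))" for d
    using set_integrable_norm[OF integrable_along_curve(1)[OF p h continuous_on_const]] .
  note lam = lipschitz_kernelD[OF ker]
  have sum_int: "set_integrable lborel {a..b} (\<lambda>t. \<Sum>d\<in>F. norm (h t d))"
    using hd unfolding set_integrable_def by (simp add: sum_distrib_left)
  have "(LINT t:{a..b}|lborel. norm (h t (z t))) \<le> (LINT t:{a..b}|lborel. (\<Sum>d\<in>F. norm (h t d)) + e * lam t)"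
  proof (rule set_integral_mono_AE)
    show "set_integrable lborel {a..b} (\<lambda>t. norm (h t (z t)))" by (rule set_integrable_norm[OF hz])
    show "set_integrable lborel {a..b} (\<lambda>t. (\<Sum>d\<in>F. norm (h t d)) + e * lam t)"
      by (intro set_integral_add(1) sum_int set_integrable_mult_right lam(2))
    show "AE t\<in>{a..b} in lborel. norm (h t (z t)) \<le> (\<Sum>d\<in>F. norm (h t d)) + e * lam t"
      using lam(3)
    proof eventually_elim
      case (elim t)
      show ?case
      proof
        assume "t \<in> {a..b}"
        then have zt: "z t \<in> cball 0 (real j)" using z(2) by blast
        then obtain d where d: "d \<in> F" "norm (z t - d) \<le> e" using F(3) by blast
        have "norm (h t (z t) - h t d) \<le> lam t * norm (z t - d)"
          using zt d(1) F(2) by (intro elim[rule_format]) auto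
        also have "\<dots> \<le> lam t * e" by (intro mult_left_mono d(2) lam(1))
        finally have "norm (h t (z t)) \<le> norm (h t d) + e * lam t"
          using norm_triangle_sub[of "h t (z t)" "h t d"] by (simp add: mult.commute)
        moreover have "norm (h t d) \<le> (\<Sum>d\<in>F. norm (h t d))"
          by (rule member_le_sum[OF d(1) _ F(1)]) simp
        ultimately show "norm (h t (z t)) \<le> (\<Sum>d\<in>F. norm (h t d)) + e * lam t" by linarith
      qed
    qed
  qed
  also have "\<dots> = (LINT t:{a..b}|lborel. (\<Sum>d\<in>F. norm (h t d))) + e * (LINT t:{a..b}|lborel. lam t)"
    using sum_int lam(2) by simp
  also have "(LINT t:{a..b}|lborel. (\<Sum>d\<in>F. norm (h t d))) = (\<Sum>d\<in>F. LINT t:{a..b}|lborel. norm (h t d))"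
    unfolding set_lebesgue_integral_def scaleR_sum_right
    by (rule Bochner_Integration.integral_sum) (use hd in \<open>auto simp: set_integrable_def\<close>)
  finally show ?thesis .
qed

text \<open>
  The net is fixed first, fine enough to make its error term small for all \<open>n\<close> at once; after that
  only finitely many sequences of integrals have to become small.
\<close>

lemma topology_D_tendsto_along_curve:
  fixes fs :: "nat \<Rightarrow> real \<Rightarrow> real^'n \<Rightarrow> 'b::euclidean_space"
  assumes p: "1 \<le> p" and D: "closure D = UNIV" and E: "E \<subseteq> LC p" "Lp_loc_bounded_l_bounds p E"
    and fs: "\<And>n. fs n \<in> E" and lim: "limitin (topology_D p D) fs f sequentially"
    and z: "continuous_on {a..b} z" "z ` {a..b} \<subseteq> cball 0 (real j)" and ab: "a \<le> b"
  shows "(\<lambda>n. LINT t:{a..b}|lborel. norm (fs n t (z t) - f t (z t))) \<longlonglongrightarrow> 0"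
proof (rule order_tendstoI)
  fix \<epsilon> :: real assume eps: "0 < \<epsilon>"
  have f: "f \<in> LC p" using limitin_seminorm(1)[OF lim[unfolded topology_D_def]] .
  have fsL: "fs n \<in> LC p" for n using fs E(1) by auto
  obtain L where L: "0 \<le> L"
    "\<forall>g\<in>E. \<exists>lam. lipschitz_kernel g (Suc j) lam \<and> (LINT t:{a..b}|lborel. lam t) \<le> L"
    using uniform_lipschitz_bound[OF p E, of "Suc j" a b] by auto
  obtain lf where lf: "lipschitz_kernel f (Suc j) lf" using lipschitz_kernel_exists[OF p f, of "Suc j"] by auto
  \<comment> \<open>Bounds the integrals of the kernels of all differences \<open>f\<^sub>n - f\<close>; the summand \<open>1\<close> makes it positive.\<close>
  define M where "M = L + (LINT t:{a..b}|lborel. lf t) + 1"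
  have M: "0 < M" unfolding M_def
    using L(1) set_integral_nonneg_on[of "{a..b}" lf] lipschitz_kernelD(1)[OF lf] by (simp add: add_nonneg_pos)
  define e where "e = min 1 (\<epsilon> / (2 * M))"
  have e: "0 < e" "e \<le> 1" using eps M by (auto simp: e_def)
  have "e * M \<le> \<epsilon> / (2 * M) * M" using M by (intro mult_right_mono) (auto simp: e_def)
  then have eM: "e * M \<le> \<epsilon> / 2" using M by simp
  obtain F where F: "finite F" "F \<subseteq> D" "F \<subseteq> cball 0 (real (Suc j))" "\<forall>y\<in>cball 0 (real j). \<exists>d\<in>F. norm (y - d) \<le> e"
    using dense_finite_net[OF D e, of j] by (elim exE conjE)
  have "(\<lambda>n. \<Sum>d\<in>F. LINT t:{a..b}|lborel. norm (fs n t d - f t d)) \<longlonglongrightarrow> (\<Sum>d\<in>F. 0)"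
    using F(2) by (intro tendsto_sum topology_D_tendsto_L1[OF p fsL lim _ ab]) auto
  then have "\<forall>\<^sub>F n in sequentially. (\<Sum>d\<in>F. LINT t:{a..b}|lborel. norm (fs n t d - f t d)) < \<epsilon> / 2"
    using eps by (intro order_tendstoD(2)[where y = 0]) auto
  then show "\<forall>\<^sub>F n in sequentially. (LINT t:{a..b}|lborel. norm (fs n t (z t) - f t (z t))) < \<epsilon>"
  proof eventually_elim
    case (elim n)
    obtain l where l: "lipschitz_kernel (fs n) (Suc j) l" "(LINT t:{a..b}|lborel. l t) \<le> L"
      using L(2) fs by blast
    have "(LINT t:{a..b}|lborel. norm (fs n t (z t) - f t (z t)))
      \<le> (\<Sum>d\<in>F. LINT t:{a..b}|lborel. norm (fs n t d - f t d)) + e * (LINT t:{a..b}|lborel. l t + lf t)"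
      by (rule integral_along_curve_le_net[OF p C1_diff C2_diff[OF p] lipschitz_kernel_diff[OF l(1) lf] F(1,3,4) z])
        (intro LC_D[OF fsL] LC_D[OF f])+
    moreover have "(LINT t:{a..b}|lborel. l t + lf t) \<le> M"
      using l(2) lipschitz_kernelD(2)[OF l(1)] lipschitz_kernelD(2)[OF lf] by (simp add: M_def)
    then have "e * (LINT t:{a..b}|lborel. l t + lf t) \<le> e * M" using e by (intro mult_left_mono) auto
    ultimately show ?case using elim eM by argo
  qed
next
  fix \<epsilon> :: real assume "\<epsilon> < 0"
  then show "\<forall>\<^sub>F n in sequentially. \<epsilon> < (LINT t:{a..b}|lborel. norm (fs n t (z t) - f t (z t)))"
    by (intro always_eventually allI) (rule less_le_trans[OF _ set_integral_nonneg_on], auto)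
qed

section \<open>Continuous dependence of the solutions\<close>

text \<open>
  The \<open>f\<^sub>n\<close> are truncated by the nearest-point projection onto a ball that contains \<open>x\<close> with a margin
  of \<open>1\<close>. The projection does not increase distances, so the kernels of \<open>f\<^sub>n\<close> on the ball become
  global ones, and the truncated problems have solutions on \<open>[a, b]\<close>. As soon as such a solution is
  within \<open>1\<close> of \<open>x\<close>, the truncation has no effect on it. Hence the domains of the original solutions
  reach over \<open>[a, b]\<close>, which is not known beforehand.
\<close>

lemma continuous_dependence_around_zero:
  fixes fs :: "nat \<Rightarrow> real \<Rightarrow> real^'n \<Rightarrow> real^'n"
  assumes p: "1 \<le> p" and D: "closure D = UNIV" and E: "E \<subseteq> LC p" "Lp_loc_bounded_l_bounds p E"
    and fs: "\<And>n. fs n \<in> E" and lim: "limitin (topology_D p D) fs f sequentially"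
    and x0: "x0s \<longlonglongrightarrow> x0" and T: "{a..b} \<subseteq> max_interval f x0" "a \<le> 0" "0 \<le> b"
  shows "(\<forall>\<^sub>F n in sequentially. {a..b} \<subseteq> max_interval (fs n) (x0s n)) \<and>
     uniform_limit {a..b} (\<lambda>n. x_sol (fs n) (x0s n)) (x_sol f x0) sequentially"
proof -
  have f: "f \<in> LC p" using limitin_seminorm(1)[OF lim[unfolded topology_D_def]] .
  have fsL: "fs n \<in> LC p" for n using fs E(1) by auto
  let ?x = "x_sol f x0"
  have ab: "a \<le> b" and zero: "0 \<in> {a..b}" using T by auto
  have x: "integral_solution f {a..b} ?x" and x_0: "?x 0 = x0"
    using ivp_solution_x_sol[OF locally_lipschitz_LC[OF p f], of x0] T(1)
    by (auto simp: ivp_solution_def intro: integral_solution_subset)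
  have xc: "continuous_on {a..b} ?x" by (rule integral_solution_continuous[OF x])
  obtain R where R: "\<And>t. t \<in> {a..b} \<Longrightarrow> norm (?x t) \<le> R" using continuous_on_Icc_bounded[OF xc] by blast
  define j where "j = Suc (nat \<lceil>\<bar>R\<bar>\<rceil>)"
  have j: "1 \<le> j" "R + 1 \<le> real j" unfolding j_def by linarith+
  have xn: "norm (?x u) \<le> real j" if "u \<in> {a..b}" for u using R[OF that] j(2) by linarith
  have xj: "?x ` {a..b} \<subseteq> cball 0 (real j)" using R j(2) by fastforce
  let ?P = "closest_point (cball (0::real^'n) (real j))"
  have P_in: "?P y \<in> cball 0 (real j)" for y by (rule closest_point_in_set) auto
  have P_lip: "norm (?P y - ?P w) \<le> norm (y - w)" for y w
    using closest_point_lipschitz[of "cball (0::real^'n) (real j)" y w] by (auto simp: dist_norm)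
  have P_cont: "continuous_on S ?P" for S by (rule continuous_on_closest_point) auto
  have P_id: "?P y = y" if "norm y \<le> real j" for y by (rule closest_point_self) (use that in auto)
  obtain L where L: "0 \<le> L"
    "\<forall>g\<in>E. \<exists>lam. lipschitz_kernel g j lam \<and> (LINT t:{a..b}|lborel. lam t) \<le> L"
    using uniform_lipschitz_bound[OF p E j(1), of a b] by blast
  obtain k :: nat where k: "L \<le> real k / 2"
    using real_arch_simple[of "2 * L"] by (auto simp: field_simps)
  define g where "g n t y = fs n t (?P y)" for n t y
  have g_int: "set_integrable lborel {a..b} (\<lambda>t. g n t (w t))" if "continuous_on {a..b} w" for n w
    unfolding g_def
    by (rule integrable_along_curve(1)[OF p LC_D[OF fsL]])
      (rule continuous_on_compose2[OF P_cont that subset_UNIV])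
  have "\<forall>n. \<exists>l. set_integrable lborel {a..b} l \<and> (\<forall>u. 0 \<le> l u) \<and> (LINT t:{a..b}|lborel. l t) \<le> L \<and>
      (AE u in lborel. u \<in> {a..b} \<longrightarrow> (\<forall>x y. norm (g n u x - g n u y) \<le> l u * norm (x - y)))"
  proof
    fix n
    obtain l where l: "lipschitz_kernel (fs n) j l" "(LINT t:{a..b}|lborel. l t) \<le> L"
      using L(2) fs by blast
    have "AE u in lborel. u \<in> {a..b} \<longrightarrow> (\<forall>x y. norm (g n u x - g n u y) \<le> l u * norm (x - y))"
      using lipschitz_kernelD(3)[OF l(1)]
    proof eventually_elim
      case (elim u)
      show ?case
      proof (intro impI allI)
        fix x y
        have "norm (g n u x - g n u y) \<le> l u * norm (?P x - ?P y)"
          unfolding g_def by (rule elim[rule_format, OF P_in P_in])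
        also have "\<dots> \<le> l u * norm (x - y)" by (intro mult_left_mono P_lip lipschitz_kernelD(1)[OF l(1)])
        finally show "norm (g n u x - g n u y) \<le> l u * norm (x - y)" .
      qed
    qed
    then show "\<exists>l. set_integrable lborel {a..b} l \<and> (\<forall>u. 0 \<le> l u) \<and> (LINT t:{a..b}|lborel. l t) \<le> L \<and>
      (AE u in lborel. u \<in> {a..b} \<longrightarrow> (\<forall>x y. norm (g n u x - g n u y) \<le> l u * norm (x - y)))"
      using l lipschitz_kernelD(1,2)[OF l(1)] by (intro exI[of _ l] conjI allI)
  qed
  from choice[OF this] obtain l where l': "\<forall>n. set_integrable lborel {a..b} (l n) \<and> (\<forall>u. 0 \<le> l n u) \<and>
      (LINT t:{a..b}|lborel. l n t) \<le> L \<and>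
      (AE u in lborel. u \<in> {a..b} \<longrightarrow> (\<forall>x y. norm (g n u x - g n u y) \<le> l n u * norm (x - y)))"
    by (elim exE)
  have l: "\<And>n. set_integrable lborel {a..b} (l n)" "\<And>n u. 0 \<le> l n u"
    "\<And>n. (LINT t:{a..b}|lborel. l n t) \<le> L"
    "\<And>n. AE u in lborel. u \<in> {a..b} \<longrightarrow> (\<forall>x y. norm (g n u x - g n u y) \<le> l n u * norm (x - y))"
    using l' by (simp_all only:)
  have "\<forall>n. \<exists>z. integral_solution (g n) {a..b} z \<and> z 0 = x0s n"
    by (intro allI integral_solution_exists[OF zero l(1) l(2) l(4)])
      (rule g_int, erule continuous_on_subset, simp)
  from choice[OF this] obtain z where z': "\<forall>n. integral_solution (g n) {a..b} (z n) \<and> z n 0 = x0s n"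
    by (elim exE)
  then have z: "integral_solution (g n) {a..b} (z n)" "z n 0 = x0s n" for n by simp_all
  define e where "e n = (LINT u:{a..b}|lborel. norm (fs n u (?x u) - f u (?x u)))" for n
  have e0: "e \<longlonglongrightarrow> 0"
    unfolding e_def by (rule topology_D_tendsto_along_curve[OF p D E fs lim xc xj ab])
  define B where "B n = 4 ^ k * (norm (x0s n - x0) + e n)" for n
  have "B \<longlonglongrightarrow> 4 ^ k * (norm (x0 - x0) + 0)"
    unfolding B_def by (intro tendsto_intros x0 e0)
  then have B0: "B \<longlonglongrightarrow> 0" by simp
  have close: "norm (z n t - ?x t) \<le> B n" if "t \<in> {a..b}" for n t
  proof -
    have "\<forall>t\<in>{a..b}. norm (z n t - ?x t) \<le> 4 ^ k * (norm (z n 0 - ?x 0) + e n)"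
    proof (rule integral_solution_stability[OF x z(1) zero l(1) l(2)])
      show "AE u in lborel. u \<in> {a..b} \<longrightarrow> norm (g n u (z n u) - g n u (?x u)) \<le> l n u * norm (z n u - ?x u)"
        using l(4)[of n] by eventually_elim blast
      show "set_integrable lborel {a..b} (\<lambda>u. g n u (?x u))" by (rule g_int[OF xc])
      show "(LINT u:{a..b}|lborel. norm (g n u (?x u) - f u (?x u))) \<le> e n"
        unfolding e_def
        by (rule eq_refl, rule set_lebesgue_integral_cong) (auto simp: g_def P_id xn)
      show "(LINT u:{a..b}|lborel. l n u) \<le> real k / 2" using l(3)[of n] k by linarith
    qed
    then show ?thesis using that by (simp add: B_def z(2) x_0)
  qed
  have sol: "ivp_solution (fs n) (x0s n) {a..b} (z n)" if n: "B n < 1" for n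
  proof -
    have zj: "norm (z n t) \<le> real j" if "t \<in> {a..b}" for t
      using close[OF that, of n] R[OF that] n j(2) norm_triangle_sub[of "z n t" "?x t"] by linarith
    have "integral_solution (fs n) {a..b} (z n)"
      by (rule integral_solution_cong[OF z(1)]) (auto simp: is_interval_cc g_def P_id zj)
    then show ?thesis unfolding ivp_solution_def using zero z(2) by (auto simp: is_interval_cc)
  qed
  have ev: "\<forall>\<^sub>F n in sequentially. B n < c" if "0 < c" for c by (rule order_tendstoD(2)[OF B0 that])
  show ?thesis
  proof
    show "\<forall>\<^sub>F n in sequentially. {a..b} \<subseteq> max_interval (fs n) (x0s n)"
      using ev[OF zero_less_one]
      by eventually_elim (rule x_sol_eq(1)[OF locally_lipschitz_LC[OF p fsL] sol])
    show "uniform_limit {a..b} (\<lambda>n. x_sol (fs n) (x0s n)) ?x sequentially"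
    proof (rule uniform_limitI)
      fix c :: real assume "0 < c"
      show "\<forall>\<^sub>F n in sequentially. \<forall>t\<in>{a..b}. dist (x_sol (fs n) (x0s n) t) (?x t) < c"
        using ev[OF zero_less_one] ev[OF \<open>0 < c\<close>]
      proof eventually_elim
        case (elim n)
        show ?case
        proof
          fix t assume t: "t \<in> {a..b}"
          have "x_sol (fs n) (x0s n) t = z n t"
            by (rule x_sol_eq(2)[OF locally_lipschitz_LC[OF p fsL] sol[OF elim(1)] t])
          then show "dist (x_sol (fs n) (x0s n) t) (?x t) < c"
            using close[OF t, of n] elim(2) by (simp add: dist_norm)
        qed
      qed
    qed
  qed
qed

lemma max_interval_hull:
  assumes T: "{a..b} \<subseteq> max_interval f x0" "a \<le> b"
  shows "{min 0 a..max 0 b} \<subseteq> max_interval f x0"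
proof -
  have "min 0 a \<in> max_interval f x0" "max 0 b \<in> max_interval f x0"
    using T zero_in_max_interval[of f x0] by (auto simp: min_def max_def)
  from is_interval_min_max_subset[OF is_interval_max_interval this]
  show ?thesis by (simp add: min_absorb1 max_absorb2)
qed

theorem continuous_dependence:
  fixes fs :: "nat \<Rightarrow> real \<Rightarrow> real^'n \<Rightarrow> real^'n"
  assumes p: "1 \<le> p" and D: "closure D = UNIV" and E: "E \<subseteq> LC p" "Lp_loc_bounded_l_bounds p E"
    and fs: "\<And>n. fs n \<in> E" and lim: "limitin (topology_D p D) fs f sequentially"
    and x0: "x0s \<longlonglongrightarrow> x0" and T: "{a..b} \<subseteq> max_interval f x0"
  shows "\<forall>\<^sub>F n in sequentially. {a..b} \<subseteq> max_interval (fs n) (x0s n)"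
    and "uniform_limit {a..b} (\<lambda>n. x_sol (fs n) (x0s n)) (x_sol f x0) sequentially"
proof -
  have "(\<forall>\<^sub>F n in sequentially. {a..b} \<subseteq> max_interval (fs n) (x0s n)) \<and>
    uniform_limit {a..b} (\<lambda>n. x_sol (fs n) (x0s n)) (x_sol f x0) sequentially"
  proof (cases "a \<le> b")
    case True
    let ?a = "min 0 a" and ?b = "max 0 b"
    have sub: "{?a..?b} \<subseteq> max_interval f x0" by (rule max_interval_hull[OF T True])
    have ab: "{a..b} \<subseteq> {?a..?b}" by auto
    have *: "(\<forall>\<^sub>F n in sequentially. {?a..?b} \<subseteq> max_interval (fs n) (x0s n)) \<and>
      uniform_limit {?a..?b} (\<lambda>n. x_sol (fs n) (x0s n)) (x_sol f x0) sequentially"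
      by (rule continuous_dependence_around_zero[OF p D E fs lim x0 sub]) auto
    show ?thesis
    proof
      show "\<forall>\<^sub>F n in sequentially. {a..b} \<subseteq> max_interval (fs n) (x0s n)"
        using conjunct1[OF *] by eventually_elim (rule order_trans[OF ab])
      show "uniform_limit {a..b} (\<lambda>n. x_sol (fs n) (x0s n)) (x_sol f x0) sequentially"
        by (rule uniform_limit_on_subset[OF conjunct2[OF *] ab])
    qed
  qed (simp add: uniform_limit_iff)
  then show "\<forall>\<^sub>F n in sequentially. {a..b} \<subseteq> max_interval (fs n) (x0s n)"
    and "uniform_limit {a..b} (\<lambda>n. x_sol (fs n) (x0s n)) (x_sol f x0) sequentially" by simp_all
qed

section \<open>Equicontinuity of the solutions of a compact family\<close>

lemma finite_uniform_threshold:
  fixes P :: "'a \<Rightarrow> real \<Rightarrow> bool"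
  assumes "finite G" and "\<And>g. g \<in> G \<Longrightarrow> \<exists>\<delta>>0. \<forall>r<\<delta>. P g r"
  shows "\<exists>\<delta>>0. \<forall>g\<in>G. \<forall>r<\<delta>. P g r"
  using assms
proof (induction G rule: finite_induct)
  case empty
  show ?case by (intro exI[of _ 1]) auto
next
  case (insert g G)
  obtain \<delta> where "0 < \<delta>" "\<forall>r<\<delta>. P g r" using insert.prems[of g] by auto
  moreover obtain \<delta>' where "0 < \<delta>'" "\<forall>g\<in>G. \<forall>r<\<delta>'. P g r" using insert.IH insert.prems by auto
  ultimately show ?case by (intro exI[of _ "min \<delta> \<delta>'"]) auto
qed

text \<open>
  Uniform continuity of the primitive. The length \<open>r\<close> is a parameter, so that the thresholds for
  finitely many functions can be combined by \<open>finite_uniform_threshold\<close>.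
\<close>

lemma integral_short_interval:
  fixes \<phi> :: "real \<Rightarrow> real"
  assumes \<phi>: "set_integrable lborel {a..b} \<phi>" and e: "0 < e"
  shows "\<exists>\<delta>>0. \<forall>r<\<delta>. \<forall>s. a \<le> s \<and> 0 \<le> r \<and> s + r \<le> b \<longrightarrow> (LINT u:{s..s+r}|lborel. \<phi> u) < e"
proof (cases "a \<le> b")
  case True
  let ?L = "\<lambda>t. LINT u:{a..t}|lborel. \<phi> u"
  have "continuous_on {a..b} (\<lambda>t. LBINT u=ereal a..ereal t. \<phi> u)"
    using True by (intro continuous_on_primitive[OF \<phi>]) auto
  then have "continuous_on {a..b} ?L"
    by (rule continuous_on_eq) (simp add: interval_integral_Icc)
  then have "uniformly_continuous_on {a..b} ?L" by (intro compact_uniformly_continuous compact_Icc)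
  then obtain \<delta> where d: "0 < \<delta>" "\<And>x y. x \<in> {a..b} \<Longrightarrow> y \<in> {a..b} \<Longrightarrow> dist y x < \<delta> \<Longrightarrow> dist (?L y) (?L x) < e"
    using e unfolding uniformly_continuous_on_def by metis
  show ?thesis
  proof (intro exI[of _ \<delta>] conjI allI impI d(1))
    fix r s assume r: "r < \<delta>" and s: "a \<le> s \<and> 0 \<le> r \<and> s + r \<le> b"
    have "(LINT u:{s..s+r}|lborel. \<phi> u) = ?L (s + r) - ?L s"
      by (rule set_integral_split[OF \<phi>]) (use s in auto)
    also have "\<dots> < e" using d(2)[of s "s + r"] r s by (auto simp: dist_real_def)
    finally show "(LINT u:{s..s+r}|lborel. \<phi> u) < e" .
  qed
next
  case False
  then show ?thesis by (intro exI[of _ 1]) auto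
qed

text \<open>
  Compactness yields finitely many \<open>g \<in> C\<close> such that every \<open>f(\<cdot>, d)\<close> with \<open>f \<in> C\<close> is \<open>L\<^sup>1\<close>-close to some
  \<open>g(\<cdot>, d)\<close>, and finitely many integrable functions are equiintegrable.
\<close>

lemma compact_slice_equiintegrable:
  fixes C :: "(real \<Rightarrow> real^'n \<Rightarrow> 'b::euclidean_space) set"
  assumes p: "1 \<le> p" and C: "C \<subseteq> LC p" "compactin (topology_D p D) C" and d: "d \<in> D"
    and ab: "a \<le> b" and e: "0 < e"
  shows "\<exists>\<delta>>0. \<forall>r<\<delta>. \<forall>f\<in>C. \<forall>s. a \<le> s \<and> 0 \<le> r \<and> s + r \<le> b \<longrightarrow> (LINT u:{s..s+r}|lborel. norm (f u d)) < e"
proof -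
  obtain q1 q2 where q: "{q1..q2} \<in> rat_intervals" "q1 \<le> a" "b \<le> q2" "q1 \<le> q2"
    by (rule rat_interval_superset[OF ab])
  let ?q = "\<lambda>f :: real \<Rightarrow> real^'n \<Rightarrow> 'b. (LINT t:{q1..q2}|lborel. norm (f t d) powr p) powr (1 / p)"
  obtain \<eta> where \<eta>: "0 < \<eta>" "\<And>\<phi> :: real \<Rightarrow> 'b.
    set_integrable lborel {q1..q2} \<phi> \<Longrightarrow> set_integrable lborel {q1..q2} (\<lambda>t. norm (\<phi> t) powr p) \<Longrightarrow>
    (LINT t:{q1..q2}|lborel. norm (\<phi> t) powr p) < \<eta> \<Longrightarrow> (LINT t:{q1..q2}|lborel. norm (\<phi> t)) < e / 2"
    using Lp_bound_imp_L1_bound[OF p q(4), of "e / 2"] e by (metis half_gt_zero)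
  have \<eta>p: "0 < \<eta> powr (1 / p)" using \<eta>(1) by simp
  have "\<exists>G. finite G \<and> G \<subseteq> C \<and> (\<forall>f\<in>C. \<exists>g\<in>G. ?q (\<lambda>t x. f t x - g t x) < \<eta> powr (1 / p))"
  proof (rule compactin_seminorm_net[OF C(2)[unfolded topology_D_def] _ _ \<eta>p, of ?q])
    show "?q \<in> {(\<lambda>f. (LINT t:I|lborel. norm (f t x) powr p) powr (1 / p)) | x I. x \<in> D \<and> I \<in> rat_intervals}"
      using d q(1) by blast
    show "?q (\<lambda>t x. 0) = 0" by simp
  qed
  then obtain G where G: "finite G" "G \<subseteq> C" "\<forall>f\<in>C. \<exists>g\<in>G. ?q (\<lambda>t x. f t x - g t x) < \<eta> powr (1 / p)"
    by (elim exE conjE)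
  have I: "set_integrable lborel {q1..q2} (\<lambda>t. f t d - g t d)"
    "set_integrable lborel {q1..q2} (\<lambda>t. norm (f t d - g t d) powr p)" if "f \<in> C" "g \<in> C" for f g
    using integrable_along_curve[OF p C1_diff C2_diff[OF p], of f g q1 q2 "\<lambda>_. d"] LC_D[of f p] LC_D[of g p] that C(1)
    by auto
  have J: "set_integrable lborel {q1..q2} (\<lambda>t. norm (f t d))" if "f \<in> C" for f
  proof -
    have f: "f \<in> LC p" using that C(1) by auto
    show ?thesis
      by (rule set_integrable_norm[OF integrable_along_curve(1)[OF p LC_D[OF f] continuous_on_const]])
  qed
  have near: "\<exists>g\<in>G. (LINT t:{q1..q2}|lborel. norm (f t d - g t d)) < e / 2" if f: "f \<in> C" for f
  proof -
    obtain g where g: "g \<in> G" "?q (\<lambda>t x. f t x - g t x) < \<eta> powr (1 / p)" using G(3) f by blast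
    have "(LINT t:{q1..q2}|lborel. norm (f t d - g t d) powr p) < \<eta>"
    proof (rule ccontr)
      assume "\<not> ?thesis"
      then have "\<eta> powr (1 / p) \<le> ?q (\<lambda>t x. f t x - g t x)" using \<eta>(1) p by (intro powr_mono2) auto
      then show False using g(2) by simp
    qed
    then show ?thesis using g(1) G(2) f by (intro bexI[of _ g] \<eta>(2) I) auto
  qed
  have "\<exists>\<delta>>0. \<forall>g\<in>G. \<forall>r<\<delta>. \<forall>s. a \<le> s \<and> 0 \<le> r \<and> s + r \<le> b \<longrightarrow> (LINT u:{s..s+r}|lborel. norm (g u d)) < e / 2"
  proof (rule finite_uniform_threshold[OF G(1)])
    fix g assume "g \<in> G"
    then have "set_integrable lborel {a..b} (\<lambda>t. norm (g t d))"
      using q G(2) by (intro set_integrable_subset[OF J]) auto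
    then show "\<exists>\<delta>>0. \<forall>r<\<delta>. \<forall>s. a \<le> s \<and> 0 \<le> r \<and> s + r \<le> b \<longrightarrow> (LINT u:{s..s+r}|lborel. norm (g u d)) < e / 2"
      using e by (intro integral_short_interval) auto
  qed
  then obtain \<delta> where \<delta>: "0 < \<delta>" "\<forall>g\<in>G. \<forall>r<\<delta>. \<forall>s. a \<le> s \<and> 0 \<le> r \<and> s + r \<le> b \<longrightarrow>
      (LINT u:{s..s+r}|lborel. norm (g u d)) < e / 2" by (elim exE conjE)
  show ?thesis
  proof (intro exI[of _ \<delta>] conjI allI impI ballI \<delta>(1))
    fix r s f assume r: "r < \<delta>" and f: "f \<in> C" and s: "a \<le> s \<and> 0 \<le> r \<and> s + r \<le> b"
    obtain g where g: "g \<in> G" "(LINT t:{q1..q2}|lborel. norm (f t d - g t d)) < e / 2" using near[OF f] by blast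
    have gC: "g \<in> C" using g G(2) by auto
    have sub: "{s..s+r} \<subseteq> {q1..q2}" using s q by auto
    have D': "set_integrable lborel {s..s+r} (\<lambda>t. norm (f t d - g t d))"
      using sub by (intro set_integrable_subset[OF set_integrable_norm[OF I(1)[OF f gC]]]) auto
    have g': "set_integrable lborel {s..s+r} (\<lambda>t. norm (g t d))" and f': "set_integrable lborel {s..s+r} (\<lambda>t. norm (f t d))"
      using sub by (auto intro: set_integrable_subset[OF J[OF gC]] set_integrable_subset[OF J[OF f]])
    have "(LINT u:{s..s+r}|lborel. norm (f u d)) \<le> (LINT u:{s..s+r}|lborel. norm (f u d - g u d) + norm (g u d))"
      by (rule set_integral_mono[OF f' set_integral_add(1)[OF D' g']])
        (metis add.commute norm_triangle_sub)
    also have "\<dots> = (LINT u:{s..s+r}|lborel. norm (f u d - g u d)) + (LINT u:{s..s+r}|lborel. norm (g u d))"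
      by (rule set_integral_add(2)[OF D' g'])
    also have "\<dots> < e / 2 + e / 2"
    proof (rule add_strict_mono)
      have "(LINT u:{s..s+r}|lborel. norm (f u d - g u d)) \<le> (LINT u:{q1..q2}|lborel. norm (f u d - g u d))"
        by (rule set_integral_mono_set[OF set_integrable_norm[OF I(1)[OF f gC]] _ sub]) auto
      then show "(LINT u:{s..s+r}|lborel. norm (f u d - g u d)) < e / 2" using g(2) by linarith
      show "(LINT u:{s..s+r}|lborel. norm (g u d)) < e / 2" using \<delta>(2) g(1) r s by auto
    qed
    finally show "(LINT u:{s..s+r}|lborel. norm (f u d)) < e" by simp
  qed
qed

text \<open>
  A bound on the integrals of the Lipschitz kernels says nothing about their integrals over short
  intervals when \<open>p = 1\<close>. The kernel term is therefore made small by the mesh \<open>\<eta>\<close> of the net, and only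
  the values at the net points by the shortness of the interval.
\<close>

lemma compact_equiintegrable_along_curves:
  fixes C :: "(real \<Rightarrow> real^'n \<Rightarrow> 'b::euclidean_space) set"
  assumes p: "1 \<le> p" and D: "closure D = UNIV" and E: "E \<subseteq> LC p" "Lp_loc_bounded_l_bounds p E"
    and C: "C \<subseteq> E" "compactin (topology_D p D) C" and ab: "a \<le> b" and e: "0 < \<epsilon>"
  shows "\<exists>\<delta>>0. \<forall>f\<in>C. \<forall>s t z. a \<le> s \<and> s \<le> t \<and> t \<le> b \<and> t - s < \<delta> \<and> continuous_on {s..t} z \<and>
    z ` {s..t} \<subseteq> cball 0 (real j) \<longrightarrow> (LINT u:{s..t}|lborel. norm (f u (z u))) < \<epsilon>"
proof -
  have CL: "C \<subseteq> LC p" using C E by auto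
  obtain L where L: "0 \<le> L"
    "\<forall>g\<in>E. \<exists>lam. lipschitz_kernel g (Suc j) lam \<and> (LINT t:{a..b}|lborel. lam t) \<le> L"
    using uniform_lipschitz_bound[OF p E, of "Suc j" a b] by auto
  define M where "M = L + 1"
  have M: "0 < M" using L(1) by (simp add: M_def)
  define \<eta> where "\<eta> = min 1 (\<epsilon> / (2 * M))"
  have \<eta>: "0 < \<eta>" "\<eta> \<le> 1" using e M by (auto simp: \<eta>_def)
  have "\<eta> * M \<le> \<epsilon> / (2 * M) * M" using M by (intro mult_right_mono) (auto simp: \<eta>_def)
  then have "\<eta> * M \<le> \<epsilon> / 2" using M by simp
  moreover have "\<eta> * L \<le> \<eta> * M" using \<eta>(1) by (intro mult_left_mono) (auto simp: M_def)
  ultimately have \<eta>L: "\<eta> * L \<le> \<epsilon> / 2" by linarith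
  obtain F where F: "finite F" "F \<subseteq> D" "F \<subseteq> cball 0 (real (Suc j))" "\<forall>y\<in>cball 0 (real j). \<exists>d\<in>F. norm (y - d) \<le> \<eta>"
    using dense_finite_net[OF D \<eta>, of j] by (elim exE conjE)
  have "(0::real^'n) \<in> cball 0 (real j)" by simp
  then have Fne: "F \<noteq> {}" using F(4) by blast
  \<comment> \<open>The sum over the net must stay below \<open>\<epsilon>/2\<close>.\<close>
  define \<epsilon>' where "\<epsilon>' = \<epsilon> / (2 * real (card F))"
  have cF: "0 < real (card F)" using F(1) Fne by (simp add: card_gt_0_iff)
  have e': "0 < \<epsilon>'" using cF e by (simp add: \<epsilon>'_def)
  have "\<exists>\<delta>>0. \<forall>d\<in>F. \<forall>r<\<delta>. \<forall>f\<in>C. \<forall>s. a \<le> s \<and> 0 \<le> r \<and> s + r \<le> b \<longrightarrow> (LINT u:{s..s+r}|lborel. norm (f u d)) < \<epsilon>'"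
  proof (rule finite_uniform_threshold[OF F(1)])
    fix d assume "d \<in> F"
    then have "d \<in> D" using F(2) by auto
    then show "\<exists>\<delta>>0. \<forall>r<\<delta>. \<forall>f\<in>C. \<forall>s. a \<le> s \<and> 0 \<le> r \<and> s + r \<le> b \<longrightarrow> (LINT u:{s..s+r}|lborel. norm (f u d)) < \<epsilon>'"
      by (rule compact_slice_equiintegrable[OF p CL C(2) _ ab e'])
  qed
  then obtain \<delta> where \<delta>: "0 < \<delta>" "\<forall>d\<in>F. \<forall>r<\<delta>. \<forall>f\<in>C. \<forall>s. a \<le> s \<and> 0 \<le> r \<and> s + r \<le> b \<longrightarrow>
      (LINT u:{s..s+r}|lborel. norm (f u d)) < \<epsilon>'" by (elim exE conjE)
  show ?thesis
  proof (intro exI[of _ \<delta>] conjI allI impI ballI \<delta>(1))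
    fix f :: "real \<Rightarrow> real^'n \<Rightarrow> 'b" and s t :: real and z :: "real \<Rightarrow> real^'n"
    assume f: "f \<in> C" and st: "a \<le> s \<and> s \<le> t \<and> t \<le> b \<and> t - s < \<delta> \<and> continuous_on {s..t} z \<and>
      z ` {s..t} \<subseteq> cball 0 (real j)"
    have fL: "f \<in> LC p" using f CL by auto
    obtain l where l: "lipschitz_kernel f (Suc j) l" "(LINT t:{a..b}|lborel. l t) \<le> L"
      using L(2) f C(1) by blast
    have "(LINT u:{s..t}|lborel. norm (f u (z u)))
      \<le> (\<Sum>d\<in>F. LINT u:{s..t}|lborel. norm (f u d)) + \<eta> * (LINT u:{s..t}|lborel. l u)"
      using st by (intro integral_along_curve_le_net[OF p LC_D[OF fL] l(1) F(1,3,4)]) auto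
    also have "\<dots> < real (card F) * \<epsilon>' + \<eta> * L"
    proof (rule add_less_le_mono)
      have "(LINT u:{s..t}|lborel. norm (f u d)) < \<epsilon>'" if "d \<in> F" for d
        using \<delta>(2)[rule_format, of d "t - s" f s] that f st by auto
      then have "(\<Sum>d\<in>F. LINT u:{s..t}|lborel. norm (f u d)) < (\<Sum>d\<in>F. \<epsilon>')"
        by (intro sum_strict_mono F(1) Fne)
      then show "(\<Sum>d\<in>F. LINT u:{s..t}|lborel. norm (f u d)) < real (card F) * \<epsilon>'" by simp
      have "(LINT u:{s..t}|lborel. l u) \<le> (LINT u:{a..b}|lborel. l u)"
        using st by (intro set_integral_mono_set lipschitz_kernelD(1,2)[OF l(1)]) auto
      then show "\<eta> * (LINT u:{s..t}|lborel. l u) \<le> \<eta> * L"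
        using l(2) \<eta>(1) by (intro mult_left_mono) auto
    qed
    also have "real (card F) * \<epsilon>' = \<epsilon> / 2" using cF by (simp add: \<epsilon>'_def)
    finally show "(LINT u:{s..t}|lborel. norm (f u (z u))) < \<epsilon>" using \<eta>L by linarith
  qed
qed

lemma solution_family_equicontinuous:
  fixes C :: "(real \<Rightarrow> real^'n \<Rightarrow> real^'n) set"
  assumes p: "1 \<le> p" and D: "closure D = UNIV" and E: "E \<subseteq> LC p" "Lp_loc_bounded_l_bounds p E"
    and C: "C \<subseteq> E" "compactin (topology_D p D) C" and I: "I \<in> rat_intervals"
  shows "equicontinuous_family (solution_family C j I)"
  unfolding equicontinuous_family_def
proof (intro allI impI)
  fix \<epsilon> :: real assume e: "0 < \<epsilon>"
  obtain a b where I: "I = {a..b}" "a \<le> b" using I unfolding rat_intervals_def by auto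
  obtain \<delta> where \<delta>: "0 < \<delta>" "\<forall>f\<in>C. \<forall>s t z. a \<le> s \<and> s \<le> t \<and> t \<le> b \<and> t - s < \<delta> \<and> continuous_on {s..t} z \<and>
    z ` {s..t} \<subseteq> cball 0 (real j) \<longrightarrow> (LINT u:{s..t}|lborel. norm (f u (z u))) < \<epsilon>"
    using compact_equiintegrable_along_curves[OF p D E C I(2) e, of j] by (elim exE conjE)
  have main: "norm (x t - x t') < \<epsilon>"
    if x: "(J, x) \<in> solution_family C j I" and t: "t \<in> J" "t' \<in> J" "\<bar>t - t'\<bar> < \<delta>" for J x t t'
  proof -
    have J: "is_interval J" "J \<subseteq> {a..b}" "x ` J \<subseteq> cball 0 (real j)"
      using x I(1) by (auto simp: solution_family_def)
    have "\<exists>f\<in>C. integral_solution f J x" using x by (simp add: solution_family_def)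
    then obtain f where f: "f \<in> C" "integral_solution f J x" by (elim bexE)
    let ?s = "min t' t" and ?t = "max t' t"
    have sub: "{?s..?t} \<subseteq> J" by (rule is_interval_min_max_subset[OF J(1) t(2,1)])
    have sol: "integral_solution f {?s..?t} x" by (rule integral_solution_subset[OF f(2) sub])
    note int = integral_solution_integrable[OF sol]
    have "x t = x t' + (LBINT u=ereal t'..ereal t. f u (x u))"
      by (rule integral_solutionD(2)[OF f(2) t(2,1)])
    then have "norm (x t - x t') = norm (LBINT u=ereal t'..ereal t. f u (x u))" by (metis add_diff_cancel_left')
    also have "\<dots> \<le> (LINT u:{?s..?t}|lborel. norm (f u (x u)))"
      by (rule norm_interval_integral_le[OF int set_integrable_norm[OF int]]) auto
    also have "\<dots> < \<epsilon>"
    proof (rule \<delta>(2)[rule_format, OF f(1)], intro conjI)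
      have "?s \<in> J" "?t \<in> J" using sub by auto
      then show "a \<le> ?s" "?t \<le> b" using J(2) by auto
      show "continuous_on {?s..?t} x" by (rule integral_solution_continuous[OF sol])
      show "x ` {?s..?t} \<subseteq> cball 0 (real j)" using sub J(3) by blast
    qed (use t(3) in auto)
    finally show ?thesis .
  qed
  show "\<exists>\<delta>>0. \<forall>(J, x)\<in>solution_family C j I. \<forall>t\<in>J. \<forall>t'\<in>J. \<bar>t - t'\<bar> < \<delta> \<longrightarrow> norm (x t - x t') < \<epsilon>"
    by (intro exI[of _ \<delta>] conjI \<delta>(1)) (auto intro: main)
qed

definition increments :: "(real \<Rightarrow> real^'n \<Rightarrow> real^'n) set \<Rightarrow> nat \<Rightarrow> real set \<Rightarrow> real \<Rightarrow> real set" where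
  "increments C j I s = insert 0 {norm (x t - x t') | J x t t'.
     (J, x) \<in> solution_family C j I \<and> t \<in> J \<and> t' \<in> J \<and> \<bar>t - t'\<bar> \<le> s}"

lemma moduli_eq: "moduli C j I s = Sup (increments C j I s)"
  by (simp add: moduli_def increments_def)

lemma bdd_above_increments: "bdd_above (increments C j I s)"
proof (rule bdd_aboveI)
  fix v assume "v \<in> increments C j I s"
  then consider "v = 0" | J x t t' where "v = norm (x t - x t')" "(J, x) \<in> solution_family C j I" "t \<in> J" "t' \<in> J"
    unfolding increments_def by blast
  then show "v \<le> 2 * real j"
  proof cases
    case 2
    then have "norm (x t) \<le> real j" "norm (x t') \<le> real j" unfolding solution_family_def by auto
    then show ?thesis using 2(1) norm_triangle_ineq4[of "x t" "x t'"] by linarith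
  qed simp
qed

lemma moduli_upper:
  assumes "(J, x) \<in> solution_family C j I" "t \<in> J" "t' \<in> J" "\<bar>t - t'\<bar> \<le> s"
  shows "norm (x t - x t') \<le> moduli C j I s"
  unfolding moduli_eq by (rule cSup_upper[OF _ bdd_above_increments]) (use assms in \<open>unfold increments_def, blast\<close>)

lemma moduli_nonneg: "0 \<le> moduli C j I s"
  unfolding moduli_eq by (rule cSup_upper[OF _ bdd_above_increments]) (simp add: increments_def)

lemma moduli_least:
  assumes "0 \<le> c" and "\<And>J x t t'. (J, x) \<in> solution_family C j I \<Longrightarrow> t \<in> J \<Longrightarrow> t' \<in> J \<Longrightarrow>
    \<bar>t - t'\<bar> \<le> s \<Longrightarrow> norm (x t - x t') \<le> c"
  shows "moduli C j I s \<le> c"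
  unfolding moduli_eq by (rule cSup_least) (use assms in \<open>auto simp: increments_def\<close>)

lemma moduli_mono:
  assumes "I1 \<subseteq> I2" "j1 \<le> j2" "s \<le> r"
  shows "moduli C j1 I1 s \<le> moduli C j2 I2 r"
proof (rule moduli_least[OF moduli_nonneg])
  fix J x t t' assume x: "(J, x) \<in> solution_family C j1 I1" and t: "t \<in> J" "t' \<in> J" "\<bar>t - t'\<bar> \<le> s"
  have "(J, x) \<in> solution_family C j2 I2"
    using x assms by (fastforce simp: solution_family_def)
  then show "norm (x t - x t') \<le> moduli C j2 I2 r" using t assms(3) by (intro moduli_upper) auto
qed

text \<open>
  The domain of each curve is an interval, so two of its points at distance at most \<open>s + r\<close> are joined
  through a third one at distance at most \<open>s\<close> from the first and \<open>r\<close> from the second.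
\<close>

lemma moduli_subadditive:
  assumes "0 \<le> s" "0 \<le> r"
  shows "moduli C j I (s + r) \<le> moduli C j I s + moduli C j I r"
proof (rule moduli_least)
  show "0 \<le> moduli C j I s + moduli C j I r" by (intro add_nonneg_nonneg moduli_nonneg)
  have ordered: "norm (x t - x t') \<le> moduli C j I s + moduli C j I r"
    if x: "(J, x) \<in> solution_family C j I" and t: "t \<in> J" "t' \<in> J" "t - t' \<le> s + r" "t' \<le> t" for J x t t'
  proof -
    let ?u = "min t (t' + s)"
    have "is_interval J" using x by (simp add: solution_family_def)
    then have "{min t' t..max t' t} \<subseteq> J" by (intro is_interval_min_max_subset t)
    then have u: "?u \<in> J" using t assms by auto
    have "norm (x t - x t') \<le> norm (x ?u - x t') + norm (x t - x ?u)"
      using norm_triangle_ineq[of "x ?u - x t'" "x t - x ?u"] by simp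
    also have "\<dots> \<le> moduli C j I s + moduli C j I r"
      using t assms by (intro add_mono moduli_upper[OF x] u) auto
    finally show ?thesis .
  qed
  fix J x t t' assume x: "(J, x) \<in> solution_family C j I" and t: "t \<in> J" "t' \<in> J" "\<bar>t - t'\<bar> \<le> s + r"
  show "norm (x t - x t') \<le> moduli C j I s + moduli C j I r"
    using ordered[OF x t(1,2)] ordered[OF x t(2,1)] t(3) norm_minus_commute[of "x t" "x t'"]
    by (cases "t' \<le> t") auto
qed

text \<open>
  Subadditivity bounds the oscillation of a modulus by its own values near \<open>0\<close>, and these are small by
  equicontinuity.
\<close>

lemma moduli_continuous:
  assumes eq: "equicontinuous_family (solution_family C j I)"
  shows "continuous_on {0..} (moduli C j I)"
proof (rule uniformly_continuous_imp_continuous, unfold uniformly_continuous_on_def, intro allI impI)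
  fix e :: real assume e: "0 < e"
  then obtain \<delta> where \<delta>: "0 < \<delta>" "\<forall>(J, x)\<in>solution_family C j I. \<forall>t\<in>J. \<forall>t'\<in>J. \<bar>t - t'\<bar> < \<delta> \<longrightarrow> norm (x t - x t') < e / 2"
    using eq half_gt_zero[OF e] unfolding equicontinuous_family_def by blast
  have small: "moduli C j I r < e" if "r < \<delta>" for r
  proof -
    have "moduli C j I r \<le> e / 2"
    proof (rule moduli_least)
      fix J x t t' assume x: "(J, x) \<in> solution_family C j I" and t: "t \<in> J" "t' \<in> J" "\<bar>t - t'\<bar> \<le> r"
      then have "norm (x t - x t') < e / 2" using \<delta>(2) that by fastforce
      then show "norm (x t - x t') \<le> e / 2" by simp
    qed (use e in simp)
    then show ?thesis using e by simp
  qed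
  have step: "\<bar>moduli C j I s - moduli C j I r\<bar> < e" if "0 \<le> r" "r \<le> s" "s - r < \<delta>" for r s
    using moduli_subadditive[of r "s - r" C j I] moduli_mono[of I I j j r s C] small[of "s - r"] that by simp
  show "\<exists>\<delta>>0. \<forall>x\<in>{0..}. \<forall>x'\<in>{0..}. dist x' x < \<delta> \<longrightarrow> dist (moduli C j I x') (moduli C j I x) < e"
  proof (intro exI[of _ \<delta>] conjI ballI impI \<delta>(1))
    fix x x' :: real assume x: "x \<in> {0..}" "x' \<in> {0..}" "dist x' x < \<delta>"
    then show "dist (moduli C j I x') (moduli C j I x) < e"
      using step[of x x'] step[of x' x] by (cases "x \<le> x'") (auto simp: dist_real_def abs_minus_commute)
  qed
qed

theorem moduli_suitable:
  assumes "\<And>j I. 1 \<le> j \<Longrightarrow> I \<in> rat_intervals \<Longrightarrow> equicontinuous_family (solution_family C j I)"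
  shows "suitable_moduli (moduli C)"
proof -
  have z: "moduli C j I 0 = 0" for j I
    by (rule antisym[OF moduli_least moduli_nonneg]) auto
  show ?thesis
    unfolding suitable_moduli_def
    by (intro conjI ballI allI impI mono_onI moduli_nonneg moduli_continuous assms z moduli_mono) auto
qed

section \<open>Convergence in the topology given by moduli of continuity\<close>

lemma curvesD:
  assumes "x \<in> curves \<theta> j I"
  shows "continuous_on I x" "x ` I \<subseteq> cball 0 (real j)"
  using assms by (simp_all only: curves_def mem_Collect_eq)

lemma Theta_C_D:
  assumes "f \<in> Theta_C p \<theta>" shows "C1 f" "C2 p f"
  using assms by (simp_all add: Theta_C_def)

text \<open>
  Makes the real supremum in the seminorms of \<open>\<T>\<^sub>\<Theta>\<close> a true one, so that it bounds the value at each
  single curve.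
\<close>

lemma bdd_above_Theta_seminorm:
  fixes g :: "real \<Rightarrow> real^'n \<Rightarrow> 'b::euclidean_space"
  assumes p: "1 \<le> p" and g: "C1 g" "C2 p g"
  shows "bdd_above ((\<lambda>x. (LINT t:{a..b}|lborel. norm (g t (x t)) powr p) powr (1 / p)) ` curves \<theta> j {a..b})"
proof -
  have "\<exists>m\<in>Lp_loc p. AE t in lborel. \<forall>x\<in>cball 0 (real j). norm (g t x) \<le> m t"
    using g(2) compact_cball[of "0::real^'n" "real j"] unfolding C2_def by (elim allE impE) assumption+
  then obtain m where m: "m \<in> Lp_loc p" "AE t in lborel. \<forall>x\<in>cball 0 (real j). norm (g t x) \<le> m t"
    by (elim bexE)
  let ?M = "LINT t:{a..b}|lebesgue. \<bar>m t\<bar> powr p"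
  show ?thesis
  proof (rule bdd_aboveI2)
    fix x :: "real \<Rightarrow> real^'n" assume "x \<in> curves \<theta> j {a..b}"
    note x = curvesD[OF this]
    note int = integrable_along_curve(2)[OF p g x(1)]
    have meas: "(\<lambda>t. indicator {a..b} t *\<^sub>R (norm (g t (x t)) powr p)) \<in> borel_measurable lborel"
      using int unfolding set_integrable_def by (rule borel_measurable_integrable)
    have "(LINT t:{a..b}|lborel. norm (g t (x t)) powr p) = (LINT t:{a..b}|lebesgue. norm (g t (x t)) powr p)"
      unfolding set_lebesgue_integral_def by (rule integral_completion[OF meas, symmetric])
    also have "\<dots> \<le> ?M"
    proof (rule set_integral_mono_AE)
      show "set_integrable lebesgue {a..b} (\<lambda>t. norm (g t (x t)) powr p)"
        using int unfolding set_integrable_def by (simp only: integrable_completion[OF meas])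
      show "set_integrable lebesgue {a..b} (\<lambda>t. \<bar>m t\<bar> powr p)" using m(1) by (simp add: Lp_loc_def)
      show "AE t\<in>{a..b} in lebesgue. norm (g t (x t)) powr p \<le> \<bar>m t\<bar> powr p"
        using AE_completion[OF m(2)]
      proof eventually_elim
        case (elim t)
        show ?case
        proof
          assume "t \<in> {a..b}"
          then have "norm (g t (x t)) \<le> m t" using elim x(2) by blast
          then show "norm (g t (x t)) powr p \<le> \<bar>m t\<bar> powr p" using p by (intro powr_mono2) auto
        qed
      qed
    qed
    finally show "(LINT t:{a..b}|lborel. norm (g t (x t)) powr p) powr (1 / p) \<le> ?M powr (1 / p)"
      using p by (intro powr_mono2) (auto intro: set_integral_nonneg_on)
  qed
qed

lemma integrable_curve_difference:
  fixes f :: "real \<Rightarrow> real^'n \<Rightarrow> 'b::euclidean_space"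
  assumes p: "1 \<le> p" and f: "C1 f" "C2 p f" and x: "continuous_on {a..b} x" and y: "continuous_on {a..b} y"
  shows "set_integrable lborel {a..b} (\<lambda>t. f t (x t) - f t (y t))"
    and "set_integrable lborel {a..b} (\<lambda>t. norm (f t (x t) - f t (y t)) powr p)"
proof -
  have "compact (x ` {a..b} \<union> y ` {a..b})" by (intro compact_Un compact_continuous_image x y compact_Icc)
  then have "\<exists>m\<in>Lp_loc p. AE t in lborel. \<forall>v\<in>x ` {a..b} \<union> y ` {a..b}. norm (f t v) \<le> m t"
    using f(2) unfolding C2_def by (elim allE impE) assumption+
  then obtain m where m: "m \<in> Lp_loc p" "AE t in lborel. \<forall>v\<in>x ` {a..b} \<union> y ` {a..b}. norm (f t v) \<le> m t"
    by (elim bexE)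
  have bd: "AE t in lborel. t \<in> {a..b} \<longrightarrow> norm (f t (x t) - f t (y t)) \<le> \<bar>m t\<bar> + \<bar>m t\<bar>"
    using m(2)
  proof eventually_elim
    case (elim t)
    show ?case
    proof
      assume "t \<in> {a..b}"
      then have "norm (f t (x t)) \<le> m t" "norm (f t (y t)) \<le> m t" using elim by auto
      then show "norm (f t (x t) - f t (y t)) \<le> \<bar>m t\<bar> + \<bar>m t\<bar>"
        using norm_triangle_ineq4[of "f t (x t)" "f t (y t)"] by linarith
    qed
  qed
  have int: "set_integrable lborel {a..b} (\<lambda>t. f t (x t) - f t (y t))"
    by (intro set_integral_diff(1) integrable_along_curve(1)[OF p f] x y)
  then have "set_borel_measurable lborel {a..b} (\<lambda>t. f t (x t) - f t (y t))"
    unfolding set_integrable_def set_borel_measurable_def by (rule borel_measurable_integrable)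
  from set_integrable_lborel_if_Lp_bound(2)[OF p Lp_loc_add[OF p m(1) m(1)] this bd]
  show "set_integrable lborel {a..b} (\<lambda>t. norm (f t (x t) - f t (y t)) powr p)" .
  show "set_integrable lborel {a..b} (\<lambda>t. f t (x t) - f t (y t))" by (rule int)
qed

text \<open>
  Split \<open>F\<^sub>n(x\<^sub>n) - F(x)\<close> into \<open>(F\<^sub>n - F)(x\<^sub>n)\<close>, which the seminorm controls uniformly over the curves,
  and \<open>F(x\<^sub>n) - F(x)\<close>, which tends to \<open>0\<close> by the continuity built into \<open>Theta_C\<close>.
\<close>

lemma topology_Theta_tendsto_along_curves:
  fixes Fs :: "nat \<Rightarrow> real \<Rightarrow> real^'n \<Rightarrow> 'b::euclidean_space"
  assumes p: "1 \<le> p" and Fs: "\<And>n. Fs n \<in> Theta_C p \<theta>"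
    and lim: "limitin (topology_Theta p \<theta>) Fs F sequentially"
    and j: "1 \<le> j" and I: "{a..b} \<in> rat_intervals" "a \<le> b"
    and xs: "\<And>n. xs n \<in> curves \<theta> j {a..b}" and x: "x \<in> curves \<theta> j {a..b}"
    and ul: "uniform_limit {a..b} xs x sequentially"
  shows "(\<lambda>n. LINT t:{a..b}|lborel. norm (Fs n t (xs n t) - F t (x t))) \<longlonglongrightarrow> 0"
proof -
  note lim' = limitin_seminorm[OF lim[unfolded topology_Theta_def]]
  have F: "F \<in> Theta_C p \<theta>" by (rule lim'(1))
  let ?N = "\<lambda>g :: real \<Rightarrow> real^'n \<Rightarrow> 'b. \<lambda>x. (LINT t:{a..b}|lborel. norm (g t (x t)) powr p) powr (1 / p)"
  let ?q = "\<lambda>g. SUP x\<in>curves \<theta> j {a..b}. ?N g x"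
  define g where "g n t x = Fs n t x - F t x" for n t x
  have g: "C1 (g n)" "C2 p (g n)" for n
    unfolding g_def[abs_def] by (intro C1_diff C2_diff p Theta_C_D[OF Fs] Theta_C_D[OF F])+
  have q0: "?q (\<lambda>t x. 0) = 0" using x by (subst cSUP_const) auto
  have "(\<lambda>n. ?N (g n) (xs n)) \<longlonglongrightarrow> 0"
  proof (rule order_tendstoI)
    fix e :: real assume "e < 0"
    then show "\<forall>\<^sub>F n in sequentially. e < ?N (g n) (xs n)"
      by (intro always_eventually allI) (rule less_le_trans, assumption, simp)
  next
    fix e :: real assume e: "0 < e"
    have "\<forall>\<^sub>F n in sequentially. ?q (\<lambda>t x. Fs n t x - F t x) < e"
      by (rule lim'(2)[where q = ?q, OF _ q0 e]) (use j I(1) in blast)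
    then show "\<forall>\<^sub>F n in sequentially. ?N (g n) (xs n) < e"
    proof eventually_elim
      case (elim n)
      have "?N (g n) (xs n) \<le> ?q (g n)"
        by (rule cSUP_upper[OF xs bdd_above_Theta_seminorm[OF p g]])
      also have "\<dots> < e" using elim unfolding g_def[abs_def] .
      finally show ?case .
    qed
  qed
  then have "(\<lambda>n. LINT t:{a..b}|lborel. norm (g n t (xs n t)) powr p) \<longlonglongrightarrow> 0"
    by (rule powr_inverse_tendsto_zeroD[OF _ _ p]) (rule set_integral_nonneg_on, simp)
  then have lim1: "(\<lambda>n. LINT t:{a..b}|lborel. norm (g n t (xs n t))) \<longlonglongrightarrow> 0"
    by (intro Lp_tendsto_imp_L1_tendsto[OF p I(2)] integrable_along_curve[OF p g] curvesD(1)[OF xs])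
  have "(\<lambda>n. LINT t:{a..b}|lborel. norm (F t (xs n t) - F t (x t)) powr p) \<longlonglongrightarrow> 0"
  proof -
    have "\<forall>j\<ge>1. \<forall>I\<in>rat_intervals. \<forall>xs x.
        (\<forall>n. xs n \<in> curves \<theta> j I) \<and> x \<in> curves \<theta> j I \<and> uniform_limit I xs x sequentially \<longrightarrow>
        (\<lambda>n::nat. LINT t:I|lborel. norm (F t (xs n t) - F t (x t)) powr p) \<longlonglongrightarrow> 0"
      using F unfolding Theta_C_def mem_Collect_eq by (elim conjE)
    then show ?thesis by (elim allE[of _ j] impE[OF _ j] ballE[of _ _ "{a..b}"]) (use xs x ul I in auto)
  qed
  then have lim2: "(\<lambda>n. LINT t:{a..b}|lborel. norm (F t (xs n t) - F t (x t))) \<longlonglongrightarrow> 0"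
    by (intro Lp_tendsto_imp_L1_tendsto[OF p I(2)] integrable_curve_difference[OF p Theta_C_D[OF F]]
      curvesD(1)[OF xs] curvesD(1)[OF x])
  show ?thesis
  proof (rule tendsto_sandwich[OF _ _ tendsto_const])
    show "\<forall>\<^sub>F n in sequentially. 0 \<le> (LINT t:{a..b}|lborel. norm (Fs n t (xs n t) - F t (x t)))"
      by (intro always_eventually allI set_integral_nonneg_on) simp
    show "(\<lambda>n. (LINT t:{a..b}|lborel. norm (g n t (xs n t))) + (LINT t:{a..b}|lborel. norm (F t (xs n t) - F t (x t)))) \<longlonglongrightarrow> 0"
      using tendsto_add[OF lim1 lim2] by simp
    show "\<forall>\<^sub>F n in sequentially. (LINT t:{a..b}|lborel. norm (Fs n t (xs n t) - F t (x t)))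
      \<le> (LINT t:{a..b}|lborel. norm (g n t (xs n t))) + (LINT t:{a..b}|lborel. norm (F t (xs n t) - F t (x t)))"
    proof (intro always_eventually allI)
      fix n
      have i1: "set_integrable lborel {a..b} (\<lambda>t. norm (g n t (xs n t)))"
        by (intro set_integrable_norm integrable_along_curve(1)[OF p g] curvesD(1)[OF xs])
      have i2: "set_integrable lborel {a..b} (\<lambda>t. norm (F t (xs n t) - F t (x t)))"
        by (intro set_integrable_norm integrable_curve_difference[OF p Theta_C_D[OF F]] curvesD(1)[OF xs] curvesD(1)[OF x])
      have i3: "set_integrable lborel {a..b} (\<lambda>t. norm (Fs n t (xs n t) - F t (x t)))"
        by (intro set_integrable_norm set_integral_diff(1) integrable_along_curve(1)[OF p Theta_C_D[OF F]]
          integrable_along_curve(1)[OF p Theta_C_D[OF Fs]] curvesD(1)[OF xs] curvesD(1)[OF x])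
      have "norm (Fs n t (xs n t) - F t (x t)) \<le> norm (g n t (xs n t)) + norm (F t (xs n t) - F t (x t))" for t
        using norm_triangle_ineq[of "g n t (xs n t)" "F t (xs n t) - F t (x t)"] by (simp add: g_def)
      then have "(LINT t:{a..b}|lborel. norm (Fs n t (xs n t) - F t (x t)))
        \<le> (LINT t:{a..b}|lborel. norm (g n t (xs n t)) + norm (F t (xs n t) - F t (x t)))"
        by (intro set_integral_mono[OF i3 set_integral_add(1)[OF i1 i2]])
      then show "(LINT t:{a..b}|lborel. norm (Fs n t (xs n t) - F t (x t)))
        \<le> (LINT t:{a..b}|lborel. norm (g n t (xs n t))) + (LINT t:{a..b}|lborel. norm (F t (xs n t) - F t (x t)))"
        using set_integral_add(2)[OF i1 i2] by linarith
    qed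
  qed
qed

section \<open>The linear equation along a solution\<close>

lemma norm_matrix_vector_mult_le:
  fixes A :: "real^'n^'m" and v :: "real^'n"
  shows "norm (A *v v) \<le> norm A * norm v"
proof -
  have "norm (A *v v) \<le> L2_set (\<lambda>i. norm (A $ i) * norm v) UNIV"
    unfolding norm_vec_def[of "A *v v"]
    by (rule L2_set_mono) (auto simp: matrix_vector_mul_component Cauchy_Schwarz_ineq2)
  also have "\<dots> = norm A * norm v"
    by (simp add: norm_vec_def[of A] L2_set_left_distrib)
  finally show ?thesis .
qed

lemma bounded_bilinear_matrix_vector_mult:
  "bounded_bilinear ((*v) :: real^'n^'m \<Rightarrow> real^'n \<Rightarrow> real^'m)"
proof
  show "\<exists>K. \<forall>A v. norm ((A :: real^'n^'m) *v v) \<le> norm A * norm v * K"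
    by (intro exI[of _ 1]) (simp add: norm_matrix_vector_mult_le)
qed (simp_all add: matrix_vector_mult_add_rdistrib matrix_vector_right_distrib vec_eq_iff
  matrix_vector_mul_component inner_add_left)

lemma linear_rhs_integrable:
  fixes A :: "real \<Rightarrow> real^'n^'n" and \<beta> z :: "real \<Rightarrow> real^'n"
  assumes A: "set_integrable lborel {a..b} A" and \<beta>: "set_integrable lborel {a..b} \<beta>"
    and z: "continuous_on {a..b} z"
  shows "set_integrable lborel {a..b} (\<lambda>u. A u *v z u + \<beta> u)"
proof (rule set_integral_add(1)[OF _ \<beta>])
  obtain R where R: "\<And>t. t \<in> {a..b} \<Longrightarrow> norm (z t) \<le> R"
    using continuous_on_Icc_bounded[OF z] by blast
  have Am: "(\<lambda>u. indicator {a..b} u *\<^sub>R A u) \<in> borel_measurable lborel"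
    using A unfolding set_integrable_def by (rule borel_measurable_integrable)
  have "set_integrable lborel {a..b} z" using z by (rule borel_integrable_atLeastAtMost')
  then have zm: "(\<lambda>u. indicator {a..b} u *\<^sub>R z u) \<in> borel_measurable lborel"
    unfolding set_integrable_def by (rule borel_measurable_integrable)
  have "(\<lambda>u. (indicator {a..b} u *\<^sub>R A u) *v (indicator {a..b} u *\<^sub>R z u)) \<in> borel_measurable lborel"
    by (rule borel_measurable_continuous_Pair[OF Am zm])
      (rule bounded_bilinear.continuous_on[OF bounded_bilinear_matrix_vector_mult]; intro continuous_intros)
  also have "(\<lambda>u. (indicator {a..b} u *\<^sub>R A u) *v (indicator {a..b} u *\<^sub>R z u))
      = (\<lambda>u. indicator {a..b} u *\<^sub>R (A u *v z u))"
    by (auto simp: indicator_def)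
  finally have meas: "set_borel_measurable lborel {a..b} (\<lambda>u. A u *v z u)"
    unfolding set_borel_measurable_def .
  show "set_integrable lborel {a..b} (\<lambda>u. A u *v z u)"
  proof (rule set_integrable_bound[OF _ meas])
    show "set_integrable lborel {a..b} (\<lambda>u. R * norm (A u))"
      by (intro set_integrable_mult_right set_integrable_norm A)
    show "AE u in lborel. u \<in> {a..b} \<longrightarrow> norm (A u *v z u) \<le> norm (R * norm (A u))"
    proof (intro AE_I2 impI)
      fix u assume "u \<in> {a..b}"
      then have "norm (A u) * norm (z u) \<le> norm (A u) * R" by (intro mult_left_mono R) auto
      then show "norm (A u *v z u) \<le> norm (R * norm (A u))"
        using norm_matrix_vector_mult_le[of "A u" "z u"] by (simp add: mult.commute)
    qed
  qed
qed

lemma linear_rhs_lipschitz: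
  fixes A :: "real^'n^'n"
  shows "norm (A *v x + c - (A *v y + c)) \<le> norm A * norm (x - y)"
  using norm_matrix_vector_mult_le[of A "x - y"] by (simp add: matrix_vector_mult_diff_distrib)

lemma locally_lipschitz_linear_rhs:
  fixes A :: "real \<Rightarrow> real^'n^'n" and \<beta> :: "real \<Rightarrow> real^'n"
  assumes "\<And>a b. {a..b} \<subseteq> J \<Longrightarrow> set_integrable lborel {a..b} A"
  shows "locally_lipschitz_rhs (\<lambda>u w. A u *v w + \<beta> u) J"
  unfolding locally_lipschitz_rhs_def
  by (intro allI impI exI[of _ "\<lambda>u. norm (A u)"] conjI set_integrable_norm assms norm_ge_zero AE_I2 ballI
    linear_rhs_lipschitz)

lemma linear_ivp_solution_exists:
  fixes A :: "real \<Rightarrow> real^'n^'n" and \<beta> :: "real \<Rightarrow> real^'n"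
  assumes A: "\<And>a b. {a..b} \<subseteq> J \<Longrightarrow> set_integrable lborel {a..b} A"
    and \<beta>: "\<And>a b. {a..b} \<subseteq> J \<Longrightarrow> set_integrable lborel {a..b} \<beta>"
    and J: "is_interval J" "0 \<in> J"
  shows "\<exists>z. ivp_solution (\<lambda>u w. A u *v w + \<beta> u) y0 J z"
proof (rule ivp_solution_Union[OF locally_lipschitz_linear_rhs[OF A] J])
  fix t assume "t \<in> J"
  then have S: "{min 0 t..max 0 t} \<subseteq> J" by (rule is_interval_min_max_subset[OF J])
  have "\<exists>z. integral_solution (\<lambda>u w. A u *v w + \<beta> u) {min 0 t..max 0 t} z \<and> z 0 = y0"
  proof (rule integral_solution_exists[where l = "\<lambda>u. norm (A u)"])
    show "set_integrable lborel {min 0 t..max 0 t} (\<lambda>u. norm (A u))" by (intro set_integrable_norm A S)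
    show "set_integrable lborel {min 0 t..max 0 t} (\<lambda>u. A u *v z u + \<beta> u)" if "continuous_on UNIV z" for z
      by (rule linear_rhs_integrable[OF A[OF S] \<beta>[OF S] continuous_on_subset[OF that subset_UNIV]])
  qed (auto simp only: linear_rhs_lipschitz intro!: AE_I2, auto)
  then obtain z where "integral_solution (\<lambda>u w. A u *v w + \<beta> u) {min 0 t..max 0 t} z" "z 0 = y0"
    by (elim exE conjE)
  then have "ivp_solution (\<lambda>u w. A u *v w + \<beta> u) y0 {min 0 t..max 0 t} z"
    unfolding ivp_solution_def by (auto simp: is_interval_cc)
  then show "\<exists>I z. ivp_solution (\<lambda>u w. A u *v w + \<beta> u) y0 I z \<and> t \<in> I \<and> I \<subseteq> J"
    using S by (intro exI[of _ "{min 0 t..max 0 t}"] exI[of _ z]) auto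
qed

lemma ivp_solution_y_sol:
  fixes f :: "real \<Rightarrow> real^'n \<Rightarrow> real^'n"
  assumes p: "1 \<le> p" and f: "f \<in> LC p" and F: "C1 F" "C2 p F" and h: "C1 h" "C2 p h"
  shows "ivp_solution (\<lambda>s w. F s (x_sol f x0 s) *v w + h s (x_sol f x0 s)) y0 (max_interval f x0)
    (y_sol f F h x0 y0)"
proof -
  let ?J = "max_interval f x0" and ?x = "x_sol f x0"
  have xc: "continuous_on {a..b} ?x" if "{a..b} \<subseteq> ?J" for a b
    using ivp_solution_x_sol[OF locally_lipschitz_LC[OF p f], of x0] that
    by (auto simp: ivp_solution_def intro!: integral_solution_continuous intro: integral_solution_subset)
  have A: "set_integrable lborel {a..b} (\<lambda>s. F s (?x s))" and \<beta>: "set_integrable lborel {a..b} (\<lambda>s. h s (?x s))"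
    if "{a..b} \<subseteq> ?J" for a b
    by (rule integrable_along_curve(1)[OF p F xc[OF that]], rule integrable_along_curve(1)[OF p h xc[OF that]])
  have "\<exists>z. ivp_solution (\<lambda>s w. F s (?x s) *v w + h s (?x s)) y0 ?J z"
    by (rule linear_ivp_solution_exists[OF _ _ is_interval_max_interval zero_in_max_interval]) (erule A, erule \<beta>)
  then obtain z where z: "ivp_solution (\<lambda>s w. F s (?x s) *v w + h s (?x s)) y0 ?J z" by (elim exE)
  show ?thesis
    by (rule ivp_solution_cong[OF z])
      (simp add: y_sol_def ivp_solution_the[OF locally_lipschitz_linear_rhs[OF A] z])
qed

text \<open>
  The stability estimate for linear equations: the kernel is the norm of the new coefficient matrix,
  and the right-hand sides are compared along the old solution, which is bounded by \<open>R\<close>.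
\<close>

lemma linear_solution_difference:
  fixes A A' :: "real \<Rightarrow> real^'n^'n" and \<beta> \<beta>' :: "real \<Rightarrow> real^'n"
  assumes y: "integral_solution (\<lambda>u w. A u *v w + \<beta> u) {a..b} y"
    and y': "integral_solution (\<lambda>u w. A' u *v w + \<beta>' u) {a..b} y'" and c: "c \<in> {a..b}"
    and A: "set_integrable lborel {a..b} A" "set_integrable lborel {a..b} A'"
    and \<beta>: "set_integrable lborel {a..b} \<beta>" "set_integrable lborel {a..b} \<beta>'"
    and R: "\<And>t. t \<in> {a..b} \<Longrightarrow> norm (y t) \<le> R"
    and k: "(LINT u:{a..b}|lborel. norm (A' u)) \<le> real k / 2"
  shows "\<forall>t\<in>{a..b}. norm (y' t - y t) \<le> 4 ^ k * (norm (y' c - y c) +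
    (R * (LINT u:{a..b}|lborel. norm (A' u - A u)) + (LINT u:{a..b}|lborel. norm (\<beta>' u - \<beta> u))))"
proof (rule integral_solution_stability[OF y y' c _ _ _ _ _ k])
  note yc = integral_solution_continuous[OF y]
  show "set_integrable lborel {a..b} (\<lambda>u. norm (A' u))" by (rule set_integrable_norm[OF A(2)])
  show i': "set_integrable lborel {a..b} (\<lambda>u. A' u *v y u + \<beta>' u)"
    by (rule linear_rhs_integrable[OF A(2) \<beta>(2) yc])
  note i = linear_rhs_integrable[OF A(1) \<beta>(1) yc]
  have iA: "set_integrable lborel {a..b} (\<lambda>u. R * norm (A' u - A u))"
    by (intro set_integrable_mult_right set_integrable_norm set_integral_diff(1) A)
  have i\<beta>: "set_integrable lborel {a..b} (\<lambda>u. norm (\<beta>' u - \<beta> u))"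
    by (intro set_integrable_norm set_integral_diff(1) \<beta>)
  have le: "norm (A' u *v y u + \<beta>' u - (A u *v y u + \<beta> u)) \<le> R * norm (A' u - A u) + norm (\<beta>' u - \<beta> u)"
    if u: "u \<in> {a..b}" for u
  proof -
    have "norm (A' u *v y u + \<beta>' u - (A u *v y u + \<beta> u)) = norm ((A' u - A u) *v y u + (\<beta>' u - \<beta> u))"
      by (simp add: matrix_vector_mult_diff_rdistrib algebra_simps)
    also have "\<dots> \<le> norm (A' u - A u) * norm (y u) + norm (\<beta>' u - \<beta> u)"
      by (rule order_trans[OF norm_triangle_ineq]) (simp add: norm_matrix_vector_mult_le)
    also have "\<dots> \<le> R * norm (A' u - A u) + norm (\<beta>' u - \<beta> u)"
      using mult_left_mono[OF R[OF u], of "norm (A' u - A u)"] by (simp add: mult.commute)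
    finally show ?thesis .
  qed
  have "(LINT u:{a..b}|lborel. norm (A' u *v y u + \<beta>' u - (A u *v y u + \<beta> u)))
    \<le> (LINT u:{a..b}|lborel. R * norm (A' u - A u) + norm (\<beta>' u - \<beta> u))"
    by (rule set_integral_mono[OF set_integrable_norm[OF set_integral_diff(1)[OF i' i]]
          set_integral_add(1)[OF iA i\<beta>] le])
  also have "\<dots> = R * (LINT u:{a..b}|lborel. norm (A' u - A u)) + (LINT u:{a..b}|lborel. norm (\<beta>' u - \<beta> u))"
    unfolding set_integral_add(2)[OF iA i\<beta>] by simp
  finally show "(LINT u:{a..b}|lborel. norm (A' u *v y u + \<beta>' u - (A u *v y u + \<beta> u)))
    \<le> R * (LINT u:{a..b}|lborel. norm (A' u - A u)) + (LINT u:{a..b}|lborel. norm (\<beta>' u - \<beta> u))" .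
qed (auto simp only: linear_rhs_lipschitz norm_ge_zero intro!: AE_I2)

section \<open>Continuous dependence of the linearised solutions\<close>

lemma uniform_limit_Pair:
  assumes "uniform_limit S f f0 F" "uniform_limit S g g0 F"
  shows "uniform_limit S (\<lambda>n t. (f n t, g n t)) (\<lambda>t. (f0 t, g0 t)) F"
proof (rule uniform_limitI)
  fix e :: real assume "0 < e"
  then have e: "0 < e / 2" by simp
  show "\<forall>\<^sub>F n in F. \<forall>t\<in>S. dist (f n t, g n t) (f0 t, g0 t) < e"
    using uniform_limitD[OF assms(1) e] uniform_limitD[OF assms(2) e]
  proof eventually_elim
    case (elim n)
    show ?case
    proof
      fix t assume "t \<in> S"
      then have "dist (f n t) (f0 t) + dist (g n t) (g0 t) < e" using elim by fastforce
      moreover have "dist (f n t, g n t) (f0 t, g0 t) \<le> dist (f n t) (f0 t) + dist (g n t) (g0 t)"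
        unfolding dist_Pair_Pair by (rule sqrt_sum_squares_le_sum) auto
      ultimately show "dist (f n t, g n t) (f0 t, g0 t) < e" by simp
    qed
  qed
qed

text \<open>
  The seminorms of \<open>\<T>\<^sub>\<Theta>\<close> live on intervals with rational endpoints, which a given \<open>[a, b]\<close> need not
  have. A solution on \<open>[a, b]\<close> is continued by its values at the endpoints; this does not enlarge its
  increments, so it keeps the modulus of the family.
\<close>

lemma clamped_solution_in_curves:
  assumes x: "integral_solution f {a..b} x" and f: "f \<in> C" and ab: "a \<le> b" "{a..b} \<subseteq> I"
    and bd: "x ` {a..b} \<subseteq> cball 0 (real j)"
  shows "(\<lambda>t. x (max a (min b t))) \<in> curves (moduli C) j I"
  unfolding curves_def
proof (intro CollectI conjI ballI)
  have cl: "max a (min b t) \<in> {a..b}" for t using ab(1) by auto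
  show "continuous_on I (\<lambda>t. x (max a (min b t)))"
    by (intro continuous_on_compose2[OF integral_solution_continuous[OF x]] continuous_intros) (use cl in blast)
  show "(\<lambda>t. x (max a (min b t))) ` I \<subseteq> cball 0 (real j)" using bd cl by blast
  have fam: "({a..b}, x) \<in> solution_family C j I"
    unfolding solution_family_def using x f ab bd by (auto simp: is_interval_cc)
  show "norm (x (max a (min b t)) - x (max a (min b s))) \<le> moduli C j I \<bar>t - s\<bar>" for t s
    by (rule moduli_upper[OF fam cl cl]) (auto simp: min_def max_def)
qed

text \<open>
  Used for the limit solution: its right-hand side need not belong to \<open>C\<close>, hence it inherits the
  modulus by passing to the limit.
\<close>

lemma curves_limit:
  fixes x :: "real \<Rightarrow> real^'n"
  assumes "\<forall>\<^sub>F n in sequentially. xs n \<in> curves \<theta> j I" and ul: "uniform_limit I xs x sequentially"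
  shows "x \<in> curves \<theta> j I"
  unfolding curves_def
proof (intro CollectI conjI ballI)
  have lim: "(\<lambda>n. xs n t) \<longlonglongrightarrow> x t" if "t \<in> I" for t by (rule tendsto_uniform_limitI[OF ul that])
  have "\<forall>\<^sub>F n in sequentially. continuous_on I (xs n)"
    using assms(1) by eventually_elim (rule curvesD)
  then show "continuous_on I x" by (rule uniform_limit_theorem[OF _ ul]) simp
  show "x ` I \<subseteq> cball 0 (real j)"
  proof (rule image_subsetI)
    fix t assume t: "t \<in> I"
    have "\<forall>\<^sub>F n in sequentially. xs n t \<in> cball 0 (real j)"
      using assms(1) by eventually_elim (use curvesD(2) t in blast)
    then show "x t \<in> cball 0 (real j)"
      by (rule Lim_in_closed_set[OF closed_cball _ sequentially_bot lim[OF t]])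
  qed
  fix t s assume ts: "t \<in> I" "s \<in> I"
  show "norm (x t - x s) \<le> \<theta> j I \<bar>t - s\<bar>"
  proof (rule tendsto_upperbound)
    show "(\<lambda>n. norm (xs n t - xs n s)) \<longlonglongrightarrow> norm (x t - x s)" by (intro tendsto_intros lim ts)
    show "\<forall>\<^sub>F n in sequentially. norm (xs n t - xs n s) \<le> \<theta> j I \<bar>t - s\<bar>"
      using assms(1) by eventually_elim (use ts in \<open>simp add: curves_def\<close>)
  qed simp
qed

text \<open>
  The clamped solutions converge uniformly and belong to the curves of the moduli from (ii), so the
  coefficients of the linear equations converge in \<open>L\<^sup>1\<close>; then \<open>linear_solution_difference\<close> applies
  with one \<open>k\<close> for all large \<open>n\<close>.
\<close>

lemma linearised_dependence_around_zero:
  fixes fs :: "nat \<Rightarrow> real \<Rightarrow> real^'n \<Rightarrow> real^'n"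
    and Fs :: "nat \<Rightarrow> real \<Rightarrow> real^'n \<Rightarrow> real^'n^'n" and hs :: "nat \<Rightarrow> real \<Rightarrow> real^'n \<Rightarrow> real^'n"
  assumes p: "1 \<le> p" and D: "closure D = UNIV" and E: "E \<subseteq> LC p" "Lp_loc_bounded_l_bounds p E"
    and C: "C \<subseteq> E" and fs: "\<And>n. fs n \<in> C" and lim: "limitin (topology_D p D) fs f sequentially"
    and Fs: "\<And>n. Fs n \<in> Theta_C p (moduli C)" and Flim: "limitin (topology_Theta p (moduli C)) Fs F sequentially"
    and hs: "\<And>n. hs n \<in> Theta_C p (moduli C)" and hlim: "limitin (topology_Theta p (moduli C)) hs h sequentially"
    and x0: "x0s \<longlonglongrightarrow> x0" and y0: "y0s \<longlonglongrightarrow> y0"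
    and T: "{a..b} \<subseteq> max_interval f x0" "a \<le> 0" "0 \<le> b"
  shows "uniform_limit {a..b} (\<lambda>n. y_sol (fs n) (Fs n) (hs n) (x0s n) (y0s n)) (y_sol f F h x0 y0) sequentially"
proof -
  have f: "f \<in> LC p" using limitin_seminorm(1)[OF lim[unfolded topology_D_def]] .
  have F: "F \<in> Theta_C p (moduli C)" using limitin_seminorm(1)[OF Flim[unfolded topology_Theta_def]] .
  have h: "h \<in> Theta_C p (moduli C)" using limitin_seminorm(1)[OF hlim[unfolded topology_Theta_def]] .
  have fsE: "fs n \<in> E" and fsL: "fs n \<in> LC p" for n using fs C E(1) by auto
  have ab: "a \<le> b" and zero: "0 \<in> {a..b}" using T by auto
  define x where "x = x_sol f x0"
  define xn where "xn n = x_sol (fs n) (x0s n)" for n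
  define y where "y = y_sol f F h x0 y0"
  define yn where "yn n = y_sol (fs n) (Fs n) (hs n) (x0s n) (y0s n)" for n
  have ev_max: "\<forall>\<^sub>F n in sequentially. {a..b} \<subseteq> max_interval (fs n) (x0s n)"
    and ul: "uniform_limit {a..b} xn x sequentially"
    using continuous_dependence[OF p D E fsE lim x0 T(1)] by (simp_all only: x_def xn_def[abs_def])
  have x: "integral_solution f {a..b} x"
    using ivp_solution_x_sol[OF locally_lipschitz_LC[OF p f], of x0] T(1)
    unfolding ivp_solution_def x_def by (elim conjE) (rule integral_solution_subset)
  have xn_sol: "integral_solution (fs n) {a..b} (xn n)" if "{a..b} \<subseteq> max_interval (fs n) (x0s n)" for n
    using ivp_solution_x_sol[OF locally_lipschitz_LC[OF p fsL], of n "x0s n"] that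
    unfolding ivp_solution_def xn_def by (elim conjE) (rule integral_solution_subset)
  have y: "integral_solution (\<lambda>u w. F u (x u) *v w + h u (x u)) {a..b} y" "y 0 = y0"
    using ivp_solution_y_sol[OF p f Theta_C_D[OF F] Theta_C_D[OF h], of x0 y0] integral_solution_subset[OF _ T(1)]
    unfolding ivp_solution_def x_def y_def by blast+
  have yn_sol: "integral_solution (\<lambda>u w. Fs n u (xn n u) *v w + hs n u (xn n u)) {a..b} (yn n) \<and> yn n 0 = y0s n"
    if "{a..b} \<subseteq> max_interval (fs n) (x0s n)" for n
    using ivp_solution_y_sol[OF p fsL[of n] Theta_C_D[OF Fs[of n]] Theta_C_D[OF hs[of n]], of "x0s n" "y0s n"]
      integral_solution_subset[OF _ that]
    unfolding ivp_solution_def xn_def yn_def by blast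
  have xc: "continuous_on {a..b} x" by (rule integral_solution_continuous[OF x])
  obtain R where R: "\<And>t. t \<in> {a..b} \<Longrightarrow> norm (x t) \<le> R" using continuous_on_Icc_bounded[OF xc] by blast
  obtain Ry where Ry: "\<And>t. t \<in> {a..b} \<Longrightarrow> norm (y t) \<le> Ry"
    using continuous_on_Icc_bounded[OF integral_solution_continuous[OF y(1)]] by blast
  define j where "j = Suc (nat \<lceil>\<bar>R\<bar>\<rceil>)"
  have j: "1 \<le> j" "R + 1 \<le> real j" unfolding j_def by linarith+
  obtain q1 q2 where q: "{q1..q2} \<in> rat_intervals" "q1 \<le> a" "b \<le> q2" "q1 \<le> q2"
    by (rule rat_interval_superset[OF ab])
  have sub: "{a..b} \<subseteq> {q1..q2}" using q by auto
  define good where "good n \<longleftrightarrow> {a..b} \<subseteq> max_interval (fs n) (x0s n) \<and> (\<forall>t\<in>{a..b}. dist (xn n t) (x t) < 1)" for n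
  have ev_good: "\<forall>\<^sub>F n in sequentially. good n"
    using ev_max uniform_limitD[OF ul zero_less_one] unfolding good_def by eventually_elim simp
  define X where "X t = x (max a (min b t))" for t
  \<comment> \<open>\<open>Theta_C\<close> speaks of sequences all of whose members are admissible curves, so the finitely many
    \<open>n\<close> whose solution does not reach over \<open>[a, b]\<close> or leaves the ball are replaced by the limit.\<close>
  define Xs where "Xs n = (if good n then (\<lambda>t. xn n (max a (min b t))) else X)" for n
  have cl: "max a (min b t) \<in> {a..b}" for t using ab by auto
  have X_eq: "X t = x t" if "t \<in> {a..b}" for t using that by (auto simp: X_def)
  have Xs_eq: "Xs n t = xn n t" if "good n" "t \<in> {a..b}" for n t using that by (auto simp: Xs_def)
  have Xs_good: "Xs n \<in> curves (moduli C) j {q1..q2}" if n: "good n" for n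
  proof -
    have "xn n ` {a..b} \<subseteq> cball 0 (real j)"
    proof (rule image_subsetI)
      fix t assume t: "t \<in> {a..b}"
      then have "norm (xn n t - x t) < 1" using n by (simp add: good_def dist_norm)
      then show "xn n t \<in> cball 0 (real j)"
        using R[OF t] j(2) norm_triangle_sub[of "xn n t" "x t"] by simp
    qed
    then have "(\<lambda>t. xn n (max a (min b t))) \<in> curves (moduli C) j {q1..q2}"
      using n by (intro clamped_solution_in_curves[OF xn_sol fs ab sub]) (simp_all add: good_def)
    then show ?thesis using n by (simp add: Xs_def)
  qed
  have Xul: "uniform_limit {q1..q2} Xs X sequentially"
  proof (rule uniform_limitI)
    fix e :: real assume "0 < e"
    then show "\<forall>\<^sub>F n in sequentially. \<forall>t\<in>{q1..q2}. dist (Xs n t) (X t) < e"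
      using uniform_limitD[OF ul \<open>0 < e\<close>]
    proof (elim eventually_mono)
      fix n assume "\<forall>t\<in>{a..b}. dist (xn n t) (x t) < e"
      then show "\<forall>t\<in>{q1..q2}. dist (Xs n t) (X t) < e"
        using cl \<open>0 < e\<close> by (simp add: Xs_def X_def)
    qed
  qed
  have "\<forall>\<^sub>F n in sequentially. Xs n \<in> curves (moduli C) j {q1..q2}"
    using ev_good by eventually_elim (rule Xs_good)
  then have X: "X \<in> curves (moduli C) j {q1..q2}" by (rule curves_limit[OF _ Xul])
  have Xs: "Xs n \<in> curves (moduli C) j {q1..q2}" for n
    using Xs_good[of n] X by (cases "good n") (auto simp: Xs_def)
  define \<alpha> where "\<alpha> n = (LINT u:{q1..q2}|lborel. norm (Fs n u (Xs n u) - F u (X u)))" for n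
  define \<eta> where "\<eta> n = (LINT u:{q1..q2}|lborel. norm (hs n u (Xs n u) - h u (X u)))" for n
  have \<alpha>0: "\<alpha> \<longlonglongrightarrow> 0" unfolding \<alpha>_def
    by (rule topology_Theta_tendsto_along_curves[OF p Fs Flim j(1) q(1,4) Xs X Xul])
  have \<eta>0: "\<eta> \<longlonglongrightarrow> 0" unfolding \<eta>_def
    by (rule topology_Theta_tendsto_along_curves[OF p hs hlim j(1) q(1,4) Xs X Xul])
  have iF: "set_integrable lborel {a..b} (\<lambda>u. F u (x u))" and ih: "set_integrable lborel {a..b} (\<lambda>u. h u (x u))"
    by (rule integrable_along_curve(1)[OF p Theta_C_D[OF F] xc], rule integrable_along_curve(1)[OF p Theta_C_D[OF h] xc])
  have along: "set_integrable lborel {a..b} (\<lambda>u. G u (xn n u)) \<and>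
      (LINT u:{a..b}|lborel. norm (G u (xn n u) - g u (x u)))
      \<le> (LINT u:{q1..q2}|lborel. norm (G u (Xs n u) - g u (X u)))"
    if n: "good n" and G: "G \<in> Theta_C p (moduli C)" and g: "g \<in> Theta_C p (moduli C)"
    for n and G g :: "real \<Rightarrow> real^'n \<Rightarrow> 'c::euclidean_space"
  proof
    have "continuous_on {a..b} (xn n)"
      using n by (intro integral_solution_continuous[OF xn_sol]) (simp add: good_def)
    then show "set_integrable lborel {a..b} (\<lambda>u. G u (xn n u))"
      by (rule integrable_along_curve(1)[OF p Theta_C_D[OF G]])
    have "(LINT u:{a..b}|lborel. norm (G u (xn n u) - g u (x u))) = (LINT u:{a..b}|lborel. norm (G u (Xs n u) - g u (X u)))"
      by (rule set_lebesgue_integral_cong) (auto simp: Xs_eq[OF n] X_eq)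
    also have "\<dots> \<le> (LINT u:{q1..q2}|lborel. norm (G u (Xs n u) - g u (X u)))"
      by (rule set_integral_mono_set[OF _ _ sub])
        (intro set_integrable_norm set_integral_diff(1) integrable_along_curve(1)[OF p Theta_C_D[OF G]]
          integrable_along_curve(1)[OF p Theta_C_D[OF g]] curvesD(1)[OF Xs] curvesD(1)[OF X], simp_all)
    finally show "(LINT u:{a..b}|lborel. norm (G u (xn n u) - g u (x u)))
      \<le> (LINT u:{q1..q2}|lborel. norm (G u (Xs n u) - g u (X u)))" .
  qed
  \<comment> \<open>The summand \<open>1\<close> leaves room for the coefficient matrices of large index \<open>n\<close>.\<close>
  obtain k :: nat where k: "(LINT u:{a..b}|lborel. norm (F u (x u))) + 1 \<le> real k / 2"
    using real_arch_simple[of "2 * ((LINT u:{a..b}|lborel. norm (F u (x u))) + 1)"] by (auto simp: field_simps)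
  have Ry0: "0 \<le> Ry" using Ry[OF zero] norm_ge_zero[of "y 0"] by linarith
  define B where "B n = 4 ^ k * (norm (y0s n - y0) + (Ry * \<alpha> n + \<eta> n))" for n
  have "B \<longlonglongrightarrow> 4 ^ k * (norm (y0 - y0) + (Ry * 0 + 0))"
    unfolding B_def by (intro tendsto_intros y0 \<alpha>0 \<eta>0)
  then have B0: "B \<longlonglongrightarrow> 0" by simp
  have close: "\<forall>t\<in>{a..b}. norm (yn n t - y t) \<le> B n" if n: "good n" "\<alpha> n < 1" for n
  proof -
    note FA = along[OF n(1) Fs[of n] F] and hA = along[OF n(1) hs[of n] h]
    have iFn: "set_integrable lborel {a..b} (\<lambda>u. Fs n u (xn n u))" using FA by simp
    have ihn: "set_integrable lborel {a..b} (\<lambda>u. hs n u (xn n u))" using hA by simp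
    have max: "{a..b} \<subseteq> max_interval (fs n) (x0s n)" using n(1) by (simp add: good_def)
    note ys = yn_sol[OF max]
    have "(LINT u:{a..b}|lborel. norm (Fs n u (xn n u)))
      \<le> (LINT u:{a..b}|lborel. norm (F u (x u)) + norm (Fs n u (xn n u) - F u (x u)))"
      by (rule set_integral_mono[OF set_integrable_norm[OF iFn]
        set_integral_add(1)[OF set_integrable_norm[OF iF] set_integrable_norm[OF set_integral_diff(1)[OF iFn iF]]]])
        (rule norm_triangle_sub)
    also have "\<dots> = (LINT u:{a..b}|lborel. norm (F u (x u))) + (LINT u:{a..b}|lborel. norm (Fs n u (xn n u) - F u (x u)))"
      by (rule set_integral_add(2)[OF set_integrable_norm[OF iF] set_integrable_norm[OF set_integral_diff(1)[OF iFn iF]]])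
    also have "\<dots> \<le> real k / 2" using FA n(2) k unfolding \<alpha>_def by linarith
    finally have kn: "(LINT u:{a..b}|lborel. norm (Fs n u (xn n u))) \<le> real k / 2" .
    have "\<forall>t\<in>{a..b}. norm (yn n t - y t) \<le> 4 ^ k * (norm (yn n 0 - y 0) +
      (Ry * (LINT u:{a..b}|lborel. norm (Fs n u (xn n u) - F u (x u))) +
        (LINT u:{a..b}|lborel. norm (hs n u (xn n u) - h u (x u)))))"
      by (rule linear_solution_difference[OF y(1) conjunct1[OF ys] zero iF iFn ih ihn Ry kn])
    moreover have "4 ^ k * (norm (yn n 0 - y 0) +
      (Ry * (LINT u:{a..b}|lborel. norm (Fs n u (xn n u) - F u (x u))) +
        (LINT u:{a..b}|lborel. norm (hs n u (xn n u) - h u (x u))))) \<le> B n"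
      unfolding B_def y(2) conjunct2[OF ys] \<alpha>_def \<eta>_def
      using FA hA Ry0 by (intro mult_left_mono add_mono order_refl) auto
    ultimately show ?thesis by fastforce
  qed
  have "uniform_limit {a..b} yn y sequentially"
  proof (rule uniform_limitI)
    fix e :: real assume e: "0 < e"
    show "\<forall>\<^sub>F n in sequentially. \<forall>t\<in>{a..b}. dist (yn n t) (y t) < e"
      using ev_good order_tendstoD(2)[OF \<alpha>0 zero_less_one] order_tendstoD(2)[OF B0 e]
    proof eventually_elim
      case (elim n)
      show ?case using close[OF elim(1,2)] elim(3) by (fastforce simp: dist_norm)
    qed
  qed
  then show ?thesis by (simp only: y_def yn_def[abs_def])
qed

theorem linearised_dependence:
  fixes fs :: "nat \<Rightarrow> real \<Rightarrow> real^'n \<Rightarrow> real^'n"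
    and Fs :: "nat \<Rightarrow> real \<Rightarrow> real^'n \<Rightarrow> real^'n^'n" and hs :: "nat \<Rightarrow> real \<Rightarrow> real^'n \<Rightarrow> real^'n"
  assumes p: "1 \<le> p" and D: "closure D = UNIV" and E: "E \<subseteq> LC p" "Lp_loc_bounded_l_bounds p E"
    and C: "C \<subseteq> E" and fs: "\<And>n. fs n \<in> C" and lim: "limitin (topology_D p D) fs f sequentially"
    and Fs: "\<And>n. Fs n \<in> Theta_C p (moduli C)" and Flim: "limitin (topology_Theta p (moduli C)) Fs F sequentially"
    and hs: "\<And>n. hs n \<in> Theta_C p (moduli C)" and hlim: "limitin (topology_Theta p (moduli C)) hs h sequentially"
    and x0: "x0s \<longlonglongrightarrow> x0" and y0: "y0s \<longlonglongrightarrow> y0" and T: "{a..b} \<subseteq> max_interval f x0"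
  shows "uniform_limit {a..b} (\<lambda>n. y_sol (fs n) (Fs n) (hs n) (x0s n) (y0s n)) (y_sol f F h x0 y0) sequentially"
proof (cases "a \<le> b")
  case True
  have "uniform_limit {min 0 a..max 0 b} (\<lambda>n. y_sol (fs n) (Fs n) (hs n) (x0s n) (y0s n)) (y_sol f F h x0 y0) sequentially"
    by (rule linearised_dependence_around_zero[OF p D E C fs lim Fs Flim hs hlim x0 y0 max_interval_hull[OF T True]]) auto
  then show ?thesis by (rule uniform_limit_on_subset) auto
qed (simp add: uniform_limit_iff)

theorem theorem5p8:
  fixes p :: real
    and D :: "(real^'n) set"
    and E :: "(real \<Rightarrow> real^'n \<Rightarrow> real^'n) set"
  assumes "1 \<le> p"
    and "countable D" and "closure D = UNIV"
    and "E \<subseteq> LC p" and "Lp_loc_bounded_l_bounds p E"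
  shows
    "(\<forall>fs f x0s x0.
        (\<forall>n. fs n \<in> E) \<and> limitin (topology_D p D) fs f sequentially \<and> x0s \<longlonglongrightarrow> x0 \<longrightarrow>
        (\<forall>T1 T2. {T1..T2} \<subseteq> max_interval f x0 \<longrightarrow>
           (\<forall>\<^sub>F n in sequentially. {T1..T2} \<subseteq> max_interval (fs n) (x0s n)) \<and>
           uniform_limit {T1..T2} (\<lambda>n. x_sol (fs n) (x0s n)) (x_sol f x0) sequentially))
     \<and>
     (\<forall>C. C \<subseteq> E \<and> compactin (topology_D p D) C \<longrightarrow>
        (\<forall>j\<ge>1. \<forall>I\<in>rat_intervals. equicontinuous_family (solution_family C j I)) \<and>
        suitable_moduli (moduli C))
     \<and>
     (\<forall>C fs f Fs (F :: real \<Rightarrow> real^'n \<Rightarrow> real^'n^'n) hs (h :: real \<Rightarrow> real^'n \<Rightarrow> real^'n)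
        x0s y0s x0 y0.
        C \<subseteq> E \<and> compactin (topology_D p D) C \<and>
        (\<forall>n. fs n \<in> C) \<and> limitin (topology_D p D) fs f sequentially \<and>
        (\<forall>n. Fs n \<in> Theta_C p (moduli C)) \<and>
        limitin (topology_Theta p (moduli C)) Fs F sequentially \<and>
        (\<forall>n. hs n \<in> Theta_C p (moduli C)) \<and>
        limitin (topology_Theta p (moduli C)) hs h sequentially \<and>
        (\<lambda>n. (x0s n, y0s n)) \<longlonglongrightarrow> (x0, y0) \<longrightarrow>
        (\<forall>T1 T2. {T1..T2} \<subseteq> max_interval f x0 \<longrightarrow>
           (\<forall>\<^sub>F n in sequentially. {T1..T2} \<subseteq> max_interval (fs n) (x0s n)) \<and>
           uniform_limit {T1..T2}
             (\<lambda>n t. (x_sol (fs n) (x0s n) t, y_sol (fs n) (Fs n) (hs n) (x0s n) (y0s n) t))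
             (\<lambda>t. (x_sol f x0 t, y_sol f F h x0 y0 t)) sequentially))"
proof (intro conjI[OF _ conjI] allI impI; elim conjE)
  note A = assms(1,3,4,5)
  {
    fix fs f x0s x0 and T1 T2 :: real
    assume "\<forall>n. fs n \<in> E" and lim: "limitin (topology_D p D) fs f sequentially" and x0: "x0s \<longlonglongrightarrow> x0"
      and T: "{T1..T2} \<subseteq> max_interval f x0"
    then have fs: "\<And>n. fs n \<in> E" by simp
    show "(\<forall>\<^sub>F n in sequentially. {T1..T2} \<subseteq> max_interval (fs n) (x0s n)) \<and>
       uniform_limit {T1..T2} (\<lambda>n. x_sol (fs n) (x0s n)) (x_sol f x0) sequentially"
      by (intro conjI continuous_dependence[OF A fs lim x0 T])
  next
    fix C assume C: "C \<subseteq> E" "compactin (topology_D p D) C"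
    have eq: "equicontinuous_family (solution_family C j I)" if "I \<in> rat_intervals" for j I
      by (rule solution_family_equicontinuous[OF A C that])
    then show "(\<forall>j\<ge>1. \<forall>I\<in>rat_intervals. equicontinuous_family (solution_family C j I)) \<and>
        suitable_moduli (moduli C)"
      by (intro conjI allI impI ballI moduli_suitable)
  next
    fix C fs f Fs and F :: "real \<Rightarrow> real^'n \<Rightarrow> real^'n^'n" and hs and h :: "real \<Rightarrow> real^'n \<Rightarrow> real^'n"
      and x0s y0s :: "nat \<Rightarrow> real^'n" and x0 y0 and T1 T2 :: real
    assume C: "C \<subseteq> E" and "\<forall>n. fs n \<in> C" and lim: "limitin (topology_D p D) fs f sequentially"
      and "\<forall>n. Fs n \<in> Theta_C p (moduli C)"
      and Flim: "limitin (topology_Theta p (moduli C)) Fs F sequentially"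
      and "\<forall>n. hs n \<in> Theta_C p (moduli C)"
      and hlim: "limitin (topology_Theta p (moduli C)) hs h sequentially"
      and xy: "(\<lambda>n. (x0s n, y0s n)) \<longlonglongrightarrow> (x0, y0)" and T: "{T1..T2} \<subseteq> max_interval f x0"
    then have fs: "\<And>n. fs n \<in> C" and Fs: "\<And>n. Fs n \<in> Theta_C p (moduli C)"
      and hs: "\<And>n. hs n \<in> Theta_C p (moduli C)" by simp_all
    have fsE: "\<And>n. fs n \<in> E" using fs C by auto
    have x0: "x0s \<longlonglongrightarrow> x0" and y0: "y0s \<longlonglongrightarrow> y0"
      using tendsto_fst[OF xy] tendsto_snd[OF xy] by simp_all
    note x = continuous_dependence[OF A fsE lim x0 T]
    show "(\<forall>\<^sub>F n in sequentially. {T1..T2} \<subseteq> max_interval (fs n) (x0s n)) \<and>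
       uniform_limit {T1..T2}
         (\<lambda>n t. (x_sol (fs n) (x0s n) t, y_sol (fs n) (Fs n) (hs n) (x0s n) (y0s n) t))
         (\<lambda>t. (x_sol f x0 t, y_sol f F h x0 y0 t)) sequentially"
      by (intro conjI x(1) uniform_limit_Pair x(2) linearised_dependence[OF A C fs lim Fs Flim hs hlim x0 y0 T])
  }
qed

end
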